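(* Let $M$ be a $d\times d$ dilation matrix such that $\mathbb{T}^d\subset M^*\mathbb{T}^d$, let $\delta\in(0,1]$, $\alpha\in\mathcal{A}_M$ and $j\in\mathbb{Z}_+$. Suppose that $\widetilde\varphi\in\mathcal{S}'_{\alpha;M}$ and $\varphi\in\mathcal{L}C$ satisfy: 1) $\operatorname{supp}\widehat\varphi\subset\mathbb{T}^d$; 2) $\varphi$ and $\widetilde\varphi$ are strictly compatible with respect to $\delta$, i.e. $\overline{\widehat\varphi}(\xi)\,\widehat{\widetilde\varphi}(\xi)=1$ for a.e. $\xi\in\delta\mathbb{T}^d$. If $f\in\mathcal{B}_{\delta M^j}$, then $$ f(x)=\sum_{k\in\mathbb{Z}^d}\big(f(M^{-j}\cdot)*\mathcal{N}_1*\widetilde\varphi^-\big)(k)\,\varphi(M^jx-k)\qquad\text{for all }x\in\mathbb{R}^d. $$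
   Context: $\mathbb{Z}_+=\{0,1,2,\dots\}$. $\mathbb{T}^d$, viewed as a subset of $\mathbb{R}^d$, is the unit cube $[-1/2,1/2]^d$. $M^*$ is the conjugate (transpose) of $M$. A dilation matrix is a real $d\times d$ matrix all of whose eigenvalues are bigger than $1$ in modulus. $\widehat f(\xi)=\mathcal{F}f(\xi)=\int_{\mathbb{R}^d}f(x)e^{-2\pi i(x,\xi)}dx$, extended to tempered distributions. For $f\in\mathcal S$ (Schwartz class) and $\psi\in\mathcal S'$, $\langle f,\psi\rangle:=\psi(f)$, where a function $g$ is identified with the functional $f\mapsto\int f\overline g$; $\widehat\psi$ is defined by $\langle\widehat f,\widehat\psi\rangle=\langle f,\psi\rangle$. For a function, $f^-(x)=\overline{f(-x)}$; for $\psi\in\mathcal S'$, $\psi^-$ is defined by $\langle f,\psi^-\rangle=\overline{\langle f^-,\psi\rangle}$, so that $\widehat{\psi^-}=\overline{\widehat\psi}$ when $\widehat\psi$ is a function. $\mathcal{L}C$ is the set of continuous functions $\varphi$ on $\mathbb{R}^d$ such that $\sum_{k\in\mathbb{Z}^d}|\varphi(\cdot+k)|$ converges uniformly on every compact set. $\eta\in C^\infty(\mathbb{R}^d)$ is a fixed real-valued function with $\eta=1$ on $\mathbb{T}^d$ and $\eta=0$ outside $2\mathbb{T}^d$; for an invertible matrix $A$, $\eta_A=\eta((A^* )^{-1}\cdot)$ and $\mathcal{N}_A=\mathcal{F}^{-1}\eta_A$; $\mathcal{N}_1=\mathcal{F}^{-1}\eta$ (that is, $\mathcal N_A$ with $A$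 the identity matrix). Also $\mathcal{N}_A*\widetilde\varphi^-:=\mathcal{F}^{-1}\big(\eta_A\,\overline{\widehat{\widetilde\varphi}}\big)$; in particular $f(M^{-j}\cdot)*\mathcal{N}_1*\widetilde\varphi^-$ is the convolution of the bounded function $f(M^{-j}\cdot)$ with the integrable function $\mathcal{N}_1*\widetilde\varphi^-$. $\mathcal{B}_A=\{g\in L_\infty(\mathbb{R}^d):\operatorname{supp}\widehat g\subset A^*\mathbb{T}^d\}$; its elements are identified with their continuous representatives. $\mathcal{A}_M$ is the set of positive functions $\alpha$ on $\mathbb{R}^{d\times d}$ with $\alpha(M^{\mu+1})\le c(M)\alpha(M^\mu)$ for all $\mu\in\mathbb{Z}_+$. $\mathcal{S}'_{\alpha;M}$ is the class of tempered distributions $\widetilde\varphi$ whose Fourier transform is a measurable locally bounded function and such that for all $\nu\in\mathbb{Z}_+$ the function $\mathcal{N}_{M^\nu}*\widetilde\varphi^-$ is in $L_1(\mathbb{R}^d)$ with $\|\mathcal{N}_{M^\nu}*\widetilde\varphi^-\|_1\le c\,\alpha(M^\nu)$, $c$ independent of $\nu$. *)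

theory Defs
  imports "HOL-Analysis.Analysis"
begin

definition unit_cube :: "(real^'d) set" where
  "unit_cube = {x. \<forall>i. \<bar>x $ i\<bar> \<le> 1/2}"

definition int_lattice :: "(real^'d) set" where
  "int_lattice = {k. \<forall>i. k $ i \<in> \<int>}"

text \<open>The operations \<open>*\<close> and \<open>^\<close> that the library provides on \<open>real^'d^'d\<close> act entrywise,
  so the powers of a matrix are defined through \<open>**\<close>.\<close>

primrec mat_pow :: "real^'d^'d \<Rightarrow> nat \<Rightarrow> real^'d^'d" where
  "mat_pow A 0 = mat 1"
| "mat_pow A (Suc n) = A ** mat_pow A n"

definition eigenvalues :: "real^'d^'d \<Rightarrow> complex set" where
  "eigenvalues A =
     {l. \<exists>v::complex^'d. v \<noteq> 0 \<and> map_matrix complex_of_real A *v v = l *s v}"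

definition dilation_matrix :: "real^'d^'d \<Rightarrow> bool" where
  "dilation_matrix A \<longleftrightarrow> (\<forall>l\<in>eigenvalues A. 1 < norm l)"

definition class_A :: "real^'d^'d \<Rightarrow> (real^'d^'d \<Rightarrow> real) set" where
  "class_A M = {\<alpha>. (\<forall>A. 0 < \<alpha> A) \<and>
     (\<exists>c. \<forall>\<mu>. \<alpha> (mat_pow M (\<mu> + 1)) \<le> c * \<alpha> (mat_pow M \<mu>))}"

definition partial_deriv :: "'d::finite \<Rightarrow> (real^'d \<Rightarrow> 'b::real_normed_vector) \<Rightarrow> real^'d \<Rightarrow> 'b" where
  "partial_deriv i f x = frechet_derivative f (at x) (axis i 1)"

primrec partial_derivs ::
  "'d::finite list \<Rightarrow> (real^'d \<Rightarrow> 'b::real_normed_vector) \<Rightarrow> real^'d \<Rightarrow> 'b" where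
  "partial_derivs [] f = f"
| "partial_derivs (i # ks) f = partial_deriv i (partial_derivs ks f)"

text \<open>This is \<open>C\<^sup>\<infinity>\<close>: differentiability of a partial derivative makes it continuous
  and makes all partial derivatives of the next order exist.\<close>

definition smooth :: "(real^'d \<Rightarrow> 'b::real_normed_vector) \<Rightarrow> bool" where
  "smooth f \<longleftrightarrow> (\<forall>ks. partial_derivs ks f differentiable_on UNIV)"

definition schwartz :: "(real^'d \<Rightarrow> complex) set" where
  "schwartz = {f. smooth f \<and>
     (\<forall>n ks. bounded (range (\<lambda>x. norm x ^ n *\<^sub>R partial_derivs ks f x)))}"

definition schwartz_seminorm :: "nat \<Rightarrow> 'd::finite list \<Rightarrow> (real^'d \<Rightarrow> complex) \<Rightarrow> real" where
  "schwartz_seminorm n ks f = (SUP x. norm x ^ n * norm (partial_derivs ks f x))"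

text \<open>Continuity is expressed by sequences because the Schwartz space is metrizable.  Only the
  values of a distribution on \<open>schwartz\<close> are relevant.\<close>

definition tempered_distribution :: "((real^'d \<Rightarrow> complex) \<Rightarrow> complex) \<Rightarrow> bool" where
  "tempered_distribution \<psi> \<longleftrightarrow>
     (\<forall>f\<in>schwartz. \<forall>g\<in>schwartz. \<psi> (\<lambda>x. f x + g x) = \<psi> f + \<psi> g) \<and>
     (\<forall>c. \<forall>f\<in>schwartz. \<psi> (\<lambda>x. c * f x) = c * \<psi> f) \<and>
     (\<forall>F f. (\<forall>m. F m \<in> schwartz) \<longrightarrow> f \<in> schwartz \<longrightarrow>
        (\<forall>n ks. (\<lambda>m. schwartz_seminorm n ks (\<lambda>x. F m x - f x)) \<longlonglongrightarrow> 0) \<longrightarrow>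
        (\<lambda>m. \<psi> (F m)) \<longlonglongrightarrow> \<psi> f)"

text \<open>A function \<open>g\<close> is identified with the functional \<open>f \<mapsto> \<integral> f \<cdot> cnj g\<close>,
  provided that this integral exists for every Schwartz function \<open>f\<close>.\<close>

definition functional_of :: "(real^'d \<Rightarrow> complex) \<Rightarrow> (real^'d \<Rightarrow> complex) \<Rightarrow> complex" where
  "functional_of g f = (LINT x|lebesgue. f x * cnj (g x))"

definition is_function ::
  "((real^'d \<Rightarrow> complex) \<Rightarrow> complex) \<Rightarrow> (real^'d \<Rightarrow> complex) \<Rightarrow> bool" where
  "is_function \<psi> g \<longleftrightarrow> g \<in> borel_measurable lebesgue \<and>
     (\<forall>f\<in>schwartz. integrable lebesgue (\<lambda>x. f x * cnj (g x)) \<and> \<psi> f = functional_of g f)"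

definition locally_bounded :: "(real^'d \<Rightarrow> complex) \<Rightarrow> bool" where
  "locally_bounded g \<longleftrightarrow> (\<forall>K. compact K \<longrightarrow> bounded (g ` K))"

definition fourier :: "(real^'d \<Rightarrow> complex) \<Rightarrow> real^'d \<Rightarrow> complex" where
  "fourier f \<xi> = (LINT x|lebesgue. f x * exp (- 2 * pi * \<i> * complex_of_real (x \<bullet> \<xi>)))"

definition inv_fourier :: "(real^'d \<Rightarrow> complex) \<Rightarrow> real^'d \<Rightarrow> complex" where
  "inv_fourier f x = (LINT \<xi>|lebesgue. f \<xi> * exp (2 * pi * \<i> * complex_of_real (x \<bullet> \<xi>)))"

text \<open>The transform of a distribution is determined by
  \<open>fourier_dist \<psi> (fourier f) = \<psi> f\<close> for Schwartz functions \<open>f\<close>; the definition solves this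
  equation using that \<open>fourier\<close> is a bijection of \<open>schwartz\<close> with inverse \<open>inv_fourier\<close>.\<close>

definition fourier_dist ::
  "((real^'d \<Rightarrow> complex) \<Rightarrow> complex) \<Rightarrow> (real^'d \<Rightarrow> complex) \<Rightarrow> complex" where
  "fourier_dist \<psi> f = \<psi> (inv_fourier f)"

text \<open>If the transform of \<open>\<psi>\<close> is a measurable locally bounded function, then this function is
  unique up to a null set; any use of it below is insensitive to such changes.\<close>

definition has_fourier_function :: "((real^'d \<Rightarrow> complex) \<Rightarrow> complex) \<Rightarrow> bool" where
  "has_fourier_function \<psi> \<longleftrightarrow> (\<exists>h. is_function (fourier_dist \<psi>) h \<and> locally_bounded h)"

definition fourier_function ::
  "((real^'d \<Rightarrow> complex) \<Rightarrow> complex) \<Rightarrow> real^'d \<Rightarrow> complex" where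
  "fourier_function \<psi> = (SOME h. is_function (fourier_dist \<psi>) h \<and> locally_bounded h)"

definition fun_supp :: "(real^'d \<Rightarrow> complex) \<Rightarrow> (real^'d) set" where
  "fun_supp f = closure {x. f x \<noteq> 0}"

definition test_functions :: "(real^'d) set \<Rightarrow> (real^'d \<Rightarrow> complex) set" where
  "test_functions U = {f. smooth f \<and> compact (fun_supp f) \<and> fun_supp f \<subseteq> U}"

definition dist_supp :: "((real^'d \<Rightarrow> complex) \<Rightarrow> complex) \<Rightarrow> (real^'d) set" where
  "dist_supp \<psi> = - \<Union>{U. open U \<and> (\<forall>f\<in>test_functions U. \<psi> f = 0)}"

text \<open>The elements of the space are bounded measurable functions up to null sets, all of which have
  a continuous representative; the set below consists of these representatives.  For a continuous
  function, being essentially bounded and being bounded are the same.\<close>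

definition band_limited :: "real^'d^'d \<Rightarrow> (real^'d \<Rightarrow> complex) set" where
  "band_limited A = {g. continuous_on UNIV g \<and> bounded (range g) \<and>
     dist_supp (fourier_dist (functional_of g)) \<subseteq> (*v) (transpose A) ` unit_cube}"

text \<open>Convergence of the series over the lattice is unconditional, i.e. along the net of
  finite partial sums.\<close>

definition class_LC :: "(real^'d \<Rightarrow> complex) set" where
  "class_LC = {\<phi>. continuous_on UNIV \<phi> \<and>
     (\<forall>K. compact K \<longrightarrow>
        (\<exists>s. uniform_limit K (\<lambda>I x. \<Sum>k\<in>I. norm (\<phi> (x + k))) s
               (finite_subsets_at_top int_lattice)))}"

definition cutoff :: "(real^'d \<Rightarrow> real) \<Rightarrow> bool" where
  "cutoff \<eta> \<longleftrightarrow> smooth \<eta> \<and> (\<forall>x\<in>unit_cube. \<eta> x = 1) \<and>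
     (\<forall>x. x \<notin> (*\<^sub>R) 2 ` unit_cube \<longrightarrow> \<eta> x = 0)"

text \<open>This is the inverse Fourier transform of
  \<open>\<eta>\<^sub>A \<cdot> cnj (fourier_function \<psi>)\<close>, where \<open>\<eta>\<^sub>A = \<eta> \<circ> (A\<^sup>*)\<^sup>-\<^sup>1\<close>.  If \<open>A\<close> is invertible, this
  product is bounded with compact support, so that its transform is given by the integral.\<close>

definition smoothed_reflection ::
  "(real^'d \<Rightarrow> real) \<Rightarrow> real^'d^'d \<Rightarrow> ((real^'d \<Rightarrow> complex) \<Rightarrow> complex) \<Rightarrow> real^'d \<Rightarrow> complex" where
  "smoothed_reflection \<eta> A \<psi> =
     inv_fourier (\<lambda>\<xi>. complex_of_real (\<eta> (matrix_inv (transpose A) *v \<xi>)) *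
                      cnj (fourier_function \<psi> \<xi>))"

definition class_S' ::
  "(real^'d \<Rightarrow> real) \<Rightarrow> (real^'d^'d \<Rightarrow> real) \<Rightarrow> real^'d^'d \<Rightarrow>
     ((real^'d \<Rightarrow> complex) \<Rightarrow> complex) set" where
  "class_S' \<eta> \<alpha> M = {\<psi>. tempered_distribution \<psi> \<and> has_fourier_function \<psi> \<and>
     (\<forall>\<nu>. integrable lebesgue (smoothed_reflection \<eta> (mat_pow M \<nu>) \<psi>)) \<and>
     (\<exists>c. \<forall>\<nu>. (LINT x|lebesgue. norm (smoothed_reflection \<eta> (mat_pow M \<nu>) \<psi> x))
               \<le> c * \<alpha> (mat_pow M \<nu>))}"

definition strictly_compatible ::
  "real \<Rightarrow> (real^'d \<Rightarrow> complex) \<Rightarrow> ((real^'d \<Rightarrow> complex) \<Rightarrow> complex) \<Rightarrow> bool" where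
  "strictly_compatible \<delta> \<phi> \<psi> \<longleftrightarrow>
     (AE \<xi> in lebesgue. \<xi> \<in> (*\<^sub>R) \<delta> ` unit_cube \<longrightarrow>
        cnj (fourier \<phi> \<xi>) * fourier_function \<psi> \<xi> = 1)"

definition convolution ::
  "(real^'d \<Rightarrow> complex) \<Rightarrow> (real^'d \<Rightarrow> complex) \<Rightarrow> real^'d \<Rightarrow> complex" where
  "convolution u v x = (LINT y|lebesgue. u (x - y) * v y)"

end

theory Submission
  imports "HOL-Probability.Characteristic_Functions" "HOL-Probability.Sinc_Integral" Defs
begin

text \<open>
  Put \<open>B = M\<^sup>j\<close>, \<open>z = B x\<close> and \<open>N = \<N>\<^sub>1 * \<psi>\<^sup>-\<close>.  The series is \<open>\<integral> f(B\<^sup>-\<^sup>1 y) G(y) dy\<close> with the integrable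
  function \<open>G(y) = \<Sum>k. N(k - y) \<phi>(z - k)\<close>.  On the open cube of side \<open>\<delta>\<close> compatibility says that
  the transforms of \<open>N\<close> and \<open>\<phi>\<close> are reciprocal, and Poisson summation gives
  \<open>(\<Sum>k. \<phi>(z - k) e(k \<cdot> \<xi>)) = \<phi>\<^sup>\<and>(\<xi>) e(z \<cdot> \<xi>)\<close> since only one translate of \<open>\<xi>\<close> meets the support of
  \<open>\<phi>\<^sup>\<and>\<close>.  Hence there the transform of \<open>G\<close> agrees with that of the point mass at \<open>z\<close>, and the claim
  follows from spectral synthesis: a finite measure whose transform vanishes on the convex set
  containing the spectrum of \<open>f\<close> annihilates \<open>f\<close>.

  For the synthesis one contracts the measure slightly, so that its transform vanishes near the
  spectrum, and smooths it with a Gaussian.  The result is a superposition of characters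
  \<open>e(x \<cdot> \<xi>)\<close> with \<open>\<xi>\<close> off the spectrum, and \<open>f\<close> annihilates each of them up to a slowly varying
  factor, namely the inverse transform of a small product bump.  The bump is manufactured from the
  restriction of \<open>\<eta>\<close> to an axis.\<close>

section \<open>Integrals over Euclidean space\<close>

text \<open>Two gaps shape the proof. First, compatibility holds only almost everywhere, whereas the
  expansion is claimed at every point; so identities are routed through continuous functions: the
  transform of \<phi>, the periodization of \<phi> (continuous because \<phi> is in LC), and
  \<open>f\<close> itself. Second, \<open>f\<close> is merely bounded and its spectrum may touch the
  boundary of the parallelepiped, while the transform of \<open>G\<close> is known only in the
  interior. Contraction closes this gap because the set is convex and has 0 in its interior: if the
  transform vanishes on the open set U, that of the image measure under y \<mapsto> r y vanishes on
  U/r, which for r < 1 contains a neighbourhood of the closure of U. The Gaussian makes the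
  transform integrable; it multiplies on the frequency side, so the zeros survive although its own
  spectrum is not compact. Both modifications disappear in one limit by continuity and boundedness
  of \<open>f\<close>. All pairings with \<open>f\<close> stay in the space variable, and the
  distribution is tested only on translated and scaled copies of one bump, whose inverse transform
  is an explicit product.\<close>

lemma prod_Basis_cart:
  fixes g :: "real^'d \<Rightarrow> 'a::comm_monoid_mult"
  shows "(\<Prod>b\<in>Basis. g b) = (\<Prod>i\<in>UNIV. g (axis i 1))"
proof -
  have B: "(Basis :: (real^'d) set) = range (\<lambda>i. axis i 1)"
    by (auto simp: Basis_vec_def)
  have "inj (\<lambda>i::'d. axis i (1::real))"
    by (auto simp: inj_on_def axis_eq_axis)
  then show ?thesis
    unfolding B by (subst prod.reindex) (auto simp: o_def)
qed

text \<open>\<open>lborel\<close> is the image of a product measure indexed by \<open>Basis\<close>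
  rather than by the index type of the vectors. \<open>S\<close> is that image map, and the factor
  for coordinate \<open>i\<close> is attached to the basis vector \<open>axis i 1\<close>, so Fubini
  for finite products applies.\<close>

lemma
  fixes g :: "'d::finite \<Rightarrow> real \<Rightarrow> complex"
  assumes g: "\<And>i. integrable lborel (g i)"
  shows integrable_prod_cart: "integrable lborel (\<lambda>x::real^'d. \<Prod>i\<in>UNIV. g i (x $ i))"
    and integral_prod_cart:
      "(LINT x|lborel. (\<Prod>i\<in>UNIV. g i ((x::real^'d) $ i))) = (\<Prod>i\<in>UNIV. LINT t|lborel. g i t)"
proof -
  interpret product_sigma_finite "\<lambda>_::real^'d. lborel :: real measure"
    by unfold_locales
  have [measurable]: "g i \<in> borel_measurable borel" for i
    using borel_measurable_integrable[OF g, of i] by simp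
  define G where "G b = g (axis_index b)" for b :: "real^'d"
  define S where "S f = (\<Sum>b\<in>Basis. f b *\<^sub>R b)" for f :: "real^'d \<Rightarrow> real"
  have S [measurable]: "S \<in> measurable (Pi\<^sub>M Basis (\<lambda>b. lborel)) borel"
    unfolding S_def by measurable
  have nth: "S f $ i = f (axis i 1)" for f :: "real^'d \<Rightarrow> real" and i
  proof -
    have "axis i 1 \<in> (Basis :: (real^'d) set)" by simp
    have "S f $ i = S f \<bullet> axis i 1" by (simp add: inner_axis)
    also have "\<dots> = (\<Sum>b\<in>Basis. if b = axis i 1 then f b else 0)"
      unfolding S_def inner_sum_left by (intro sum.cong) (auto simp: inner_Basis)
    also have "\<dots> = f (axis i 1)" by simp
    finally show ?thesis .
  qed
  have eq: "(\<Prod>i\<in>UNIV. g i (S f $ i)) = (\<Prod>b\<in>Basis. G b (f b))" for f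
    unfolding prod_Basis_cart nth G_def by (simp add: axis_index_axis)
  have I: "integrable (Pi\<^sub>M Basis (\<lambda>_. lborel)) (\<lambda>f. \<Prod>b\<in>Basis. G b (f b))"
    by (rule product_integrable_prod) (auto simp: G_def g)
  have L: "(lborel :: (real^'d) measure) = distr (Pi\<^sub>M Basis (\<lambda>_. lborel)) borel S"
    by (simp add: lborel_def[where 'a="real^'d"] lborel_eq_real S_def[abs_def])
  show "integrable lborel (\<lambda>x::real^'d. \<Prod>i\<in>UNIV. g i (x $ i))"
    unfolding L
    by (subst integrable_distr_eq) (use I in \<open>simp_all add: eq\<close>)
  have "(LINT x|lborel. (\<Prod>i\<in>UNIV. g i ((x::real^'d) $ i))) =
      (LINT f|Pi\<^sub>M Basis (\<lambda>_. lborel). (\<Prod>b\<in>Basis. G b (f b)))"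
    unfolding L
    by (subst integral_distr) (simp_all add: eq)
  also have "\<dots> = (\<Prod>b\<in>Basis. LINT t|lborel. G b t)"
    by (rule product_integral_prod) (auto simp: G_def g)
  also have "\<dots> = (\<Prod>i\<in>UNIV. LINT t|lborel. g i t)"
    by (simp add: prod_Basis_cart G_def)
  finally show "(LINT x|lborel. (\<Prod>i\<in>UNIV. g i ((x::real^'d) $ i))) = (\<Prod>i\<in>UNIV. LINT t|lborel. g i t)" .
qed

section \<open>Affine and linear substitutions in Lebesgue integrals\<close>

lemma integrable_scaleR_iff:
  fixes f :: "'a \<Rightarrow> 'b::{banach, second_countable_topology}"
  assumes "c \<noteq> 0"
  shows "integrable M (\<lambda>x. c *\<^sub>R f x) \<longleftrightarrow> integrable M f"
proof
  assume "integrable M (\<lambda>x. c *\<^sub>R f x)"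
  then have "integrable M (\<lambda>x. (1 / c) *\<^sub>R (c *\<^sub>R f x))" by (rule integrable_scaleR_right)
  then show "integrable M f" using assms by simp
qed (rule integrable_scaleR_right)

lemma
  fixes f :: "'a::euclidean_space \<Rightarrow> 'b::{banach, second_countable_topology}"
  assumes "c \<noteq> 0" and [measurable]: "f \<in> borel_measurable borel"
  shows lborel_integrable_affine_iff:
      "integrable lborel (\<lambda>x. f (t + c *\<^sub>R x)) \<longleftrightarrow> integrable lborel f"
    and lborel_integral_affine:
      "(LINT x|lborel. f x) = \<bar>c\<bar> ^ DIM('a) *\<^sub>R (LINT x|lborel. f (t + c *\<^sub>R x))"
proof -
  let ?m = "density (distr lborel borel (\<lambda>x. t + c *\<^sub>R x)) (\<lambda>_. \<bar>c\<bar>^DIM('a))"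
  have e: "lborel = ?m" by (rule lborel_affine[OF assms(1)])
  have "integrable lborel f \<longleftrightarrow> integrable ?m f" by (subst e) simp
  also have "\<dots> \<longleftrightarrow> integrable lborel (\<lambda>x. f (t + c *\<^sub>R x))"
    using \<open>c \<noteq> 0\<close> by (simp add: integrable_density integrable_distr_eq integrable_scaleR_iff)
  finally show "integrable lborel (\<lambda>x. f (t + c *\<^sub>R x)) \<longleftrightarrow> integrable lborel f" ..
  have "(LINT x|lborel. f x) = (LINT x|?m. f x)" by (subst e) simp
  also have "\<dots> = \<bar>c\<bar> ^ DIM('a) *\<^sub>R (LINT x|lborel. f (t + c *\<^sub>R x))"
    by (simp add: integral_density integral_distr)
  finally show "(LINT x|lborel. f x) = \<bar>c\<bar> ^ DIM('a) *\<^sub>R (LINT x|lborel. f (t + c *\<^sub>R x))" .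
qed

lemma matrix_inv_vector:
  fixes B :: "real^'d^'d"
  assumes "invertible B"
  shows "B *v (matrix_inv B *v x) = x" "matrix_inv B *v (B *v x) = x"
    "B ** matrix_inv B = mat 1" "matrix_inv B ** B = mat 1"
proof -
  have "B ** matrix_inv B = mat 1 \<and> matrix_inv B ** B = mat 1"
    using assms unfolding invertible_def matrix_inv_def by (rule someI_ex)
  then show "B ** matrix_inv B = mat 1" "matrix_inv B ** B = mat 1"
    "B *v (matrix_inv B *v x) = x" "matrix_inv B *v (B *v x) = x"
    by (simp_all add: matrix_vector_mul_assoc)
qed

text \<open>Used for linear substitutions: the library computes the measure of linear images only over
  well-ordered index types, and the value of the constant does not matter here.\<close>

lemma translation_invariant_eq_lborel:
  fixes \<mu> :: "'a::euclidean_space measure"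
  assumes sets [measurable_cong]: "sets \<mu> = sets borel"
    and inv: "\<And>f t. f \<in> borel_measurable borel \<Longrightarrow> (\<integral>\<^sup>+x. f (t + x) \<partial>\<mu>) = (\<integral>\<^sup>+x. f x \<partial>\<mu>)"
    and fin: "\<And>a. bounded a \<Longrightarrow> a \<in> sets borel \<Longrightarrow> emeasure \<mu> a < \<infinity>"
  obtains c where "0 \<le> c" "\<mu> = density lborel (\<lambda>_. ennreal c)"
proof -
  have "sigma_finite_measure \<mu>"
  proof (rule sigma_finite_measure.intro, intro exI conjI)
    show "countable (range (\<lambda>n::nat. cball (0::'a) (real n)))" by simp
    show "range (\<lambda>n::nat. cball (0::'a) (real n)) \<subseteq> sets \<mu>" unfolding sets by auto
    show "\<Union>(range (\<lambda>n::nat. cball (0::'a) (real n))) = space \<mu>"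
      unfolding sets_eq_imp_space_eq[OF sets] by (auto simp: real_arch_simple)
    show "\<forall>a\<in>range (\<lambda>n::nat. cball (0::'a) (real n)). emeasure \<mu> a \<noteq> \<infinity>"
    proof
      fix a assume "a \<in> range (\<lambda>n::nat. cball (0::'a) (real n))"
      then have "bounded a" "a \<in> sets borel" by auto
      from fin[OF this] show "emeasure \<mu> a \<noteq> \<infinity>" by simp
    qed
  qed
  then interpret sigma_finite_measure \<mu> .
  interpret pair_sigma_finite "lborel :: 'a measure" \<mu> by unfold_locales
  have linv: "(\<integral>\<^sup>+x. f (t + x) \<partial>lborel) = (\<integral>\<^sup>+x. f x \<partial>lborel)"
    if [measurable]: "f \<in> borel_measurable borel" for f and t :: 'a
    by (subst (2) lborel_distr_plus[of t, symmetric]) (simp add: nn_integral_distr)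
  \<comment> \<open>The candidate constant is the mass of the reflected unit box: as a function of
    \<open>x\<close>, the indicator of the box at \<open>y - x\<close> is the indicator of a
    translate of \<open>Q\<close>.\<close>
  define Q :: "'a set" where "Q = {x. - x \<in> cbox 0 One}"
  have "Q = uminus ` cbox 0 One"
    proof (intro set_eqI iffI)
    fix x assume "x \<in> Q"
    then show "x \<in> uminus ` cbox 0 One"
      by (intro image_eqI[where x="- x"]) (simp_all only: Q_def mem_Collect_eq minus_minus)
  qed (auto simp only: Q_def mem_Collect_eq minus_minus)
  then have bQ: "bounded Q" by simp
  have Q [measurable]: "Q \<in> sets borel" unfolding Q_def by measurable
  have "emeasure \<mu> Q < \<infinity>" using fin[OF bQ Q] .
  then obtain c where c: "0 \<le> c" "emeasure \<mu> Q = ennreal c"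
    by (cases "emeasure \<mu> Q") auto
  define g :: "'a \<Rightarrow> ennreal" where "g = indicator (cbox 0 One)"
  have [measurable]: "g \<in> borel_measurable borel" unfolding g_def by measurable
  have g1: "(\<integral>\<^sup>+x. g x \<partial>lborel) = 1"
    by (simp add: g_def emeasure_lborel_cbox_eq inner_diff_left)
  have gc: "(\<integral>\<^sup>+x. g (y - x) \<partial>\<mu>) = ennreal c" for y
  proof -
    have "(\<integral>\<^sup>+x. g (y - x) \<partial>\<mu>) = (\<integral>\<^sup>+x. g (- (- y + x)) \<partial>\<mu>)" by simp
    also have "\<dots> = (\<integral>\<^sup>+x. g (- x) \<partial>\<mu>)" by (rule inv) measurable
    also have "\<dots> = (\<integral>\<^sup>+x. indicator Q x \<partial>\<mu>)"
      by (intro nn_integral_cong) (auto simp: g_def Q_def indicator_def)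
    also have "\<dots> = ennreal c" using c by simp
    finally show ?thesis .
  qed
  \<comment> \<open>Uniqueness of translation-invariant measures by two Fubini swaps: insert the
    unit mass of \<open>g\<close>, translate \<open>f\<close> by \<open>y\<close> under \<mu>, swap,
    translate by \<open>x\<close> under \<open>lborel\<close>, swap back; the inner \<mu>-integral
    has become the constant.\<close>
  have key: "(\<integral>\<^sup>+x. f x \<partial>\<mu>) = (\<integral>\<^sup>+x. f x * ennreal c \<partial>lborel)"
    if [measurable]: "f \<in> borel_measurable borel" for f
  proof -
    have "(\<integral>\<^sup>+x. f x \<partial>\<mu>) = (\<integral>\<^sup>+x. f x \<partial>\<mu>) * (\<integral>\<^sup>+y. g y \<partial>lborel)" by (simp add: g1)
    also have "\<dots> = (\<integral>\<^sup>+y. (\<integral>\<^sup>+x. f x \<partial>\<mu>) * g y \<partial>lborel)" by (simp add: nn_integral_cmult)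
    also have "\<dots> = (\<integral>\<^sup>+y. (\<integral>\<^sup>+x. f (y + x) * g y \<partial>\<mu>) \<partial>lborel)"
      by (simp add: nn_integral_multc inv)
    also have "\<dots> = (\<integral>\<^sup>+x. (\<integral>\<^sup>+y. f (y + x) * g y \<partial>lborel) \<partial>\<mu>)"
      by (rule Fubini'[symmetric]) measurable
    also have "\<dots> = (\<integral>\<^sup>+x. (\<integral>\<^sup>+y. f y * g (y - x) \<partial>lborel) \<partial>\<mu>)"
    proof (rule nn_integral_cong)
      fix x
      have "(\<integral>\<^sup>+y. f (x + y) * g ((x + y) - x) \<partial>lborel) = (\<integral>\<^sup>+y. f y * g (y - x) \<partial>lborel)"
        by (rule linv) measurable
      then show "(\<integral>\<^sup>+y. f (y + x) * g y \<partial>lborel) = (\<integral>\<^sup>+y. f y * g (y - x) \<partial>lborel)"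
        by (simp add: add.commute)
    qed
    also have "\<dots> = (\<integral>\<^sup>+y. (\<integral>\<^sup>+x. f y * g (y - x) \<partial>\<mu>) \<partial>lborel)"
      by (rule Fubini') measurable
    also have "\<dots> = (\<integral>\<^sup>+y. f y * ennreal c \<partial>lborel)"
      by (simp add: nn_integral_cmult gc)
    finally show ?thesis .
  qed
  have "\<mu> = density lborel (\<lambda>_. ennreal c)"
  proof (rule measure_eqI)
    fix A assume "A \<in> sets \<mu>"
    then have [measurable]: "A \<in> sets borel" by (simp add: sets)
    show "emeasure \<mu> A = emeasure (density lborel (\<lambda>_. ennreal c)) A"
      using key[of "indicator A"] by (simp add: emeasure_density sets mult.commute)
  qed (simp add: sets)
  with c(1) show ?thesis by (rule that)
qed

text \<open>A shift by t after \<open>B\<close> is a shift by the preimage of t before it, so the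
  image of \<open>lborel\<close> under \<open>B\<close> is translation invariant and hence a
  multiple of \<open>lborel\<close>. The multiple, 1 / |det B|, is positive since the image has
  nonzero total mass.\<close>

lemma lborel_matrix_substitution:
  fixes B :: "real^'d^'d"
  assumes B: "invertible B"
  obtains c where "0 < c"
    "\<And>f :: real^'d \<Rightarrow> 'b::{banach, second_countable_topology}. f \<in> borel_measurable borel \<Longrightarrow>
       integrable lborel (\<lambda>x. f (B *v x)) \<longleftrightarrow> integrable lborel f"
    "\<And>f :: real^'d \<Rightarrow> 'b. f \<in> borel_measurable borel \<Longrightarrow>
       (LINT x|lborel. f (B *v x)) = c *\<^sub>R (LINT x|lborel. f x)"
proof -
  let ?C = "matrix_inv B"
  let ?\<mu> = "distr lborel borel ((*v) B)"
  have Bm [measurable]: "(*v) B \<in> borel_measurable borel"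
    by (intro borel_measurable_continuous_onI continuous_intros)
  obtain c where c: "0 \<le> c" "?\<mu> = density lborel (\<lambda>_. ennreal c)"
  proof (rule translation_invariant_eq_lborel[of ?\<mu>])
    fix f :: "real^'d \<Rightarrow> ennreal" and t
    assume [measurable]: "f \<in> borel_measurable borel"
    have "(\<integral>\<^sup>+x. f (t + B *v x) \<partial>lborel) = (\<integral>\<^sup>+x. f (B *v (?C *v t + x)) \<partial>lborel)"
      by (simp add: matrix_vector_right_distrib matrix_inv_vector[OF B])
    also have "\<dots> = (\<integral>\<^sup>+x. f (B *v x) \<partial>lborel)"
      by (subst (2) lborel_distr_plus[of "?C *v t", symmetric]) (simp add: nn_integral_distr)
    finally show "(\<integral>\<^sup>+x. f (t + x) \<partial>?\<mu>) = (\<integral>\<^sup>+x. f x \<partial>?\<mu>)"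
      by (simp add: nn_integral_distr)
  next
    fix a :: "(real^'d) set"
    assume a: "bounded a" "a \<in> sets borel"
    have "(*v) B -` a \<subseteq> (*v) ?C ` a"
    proof
      fix x assume "x \<in> (*v) B -` a"
      then show "x \<in> (*v) ?C ` a"
        by (intro image_eqI[where x="B *v x"]) (simp_all only: matrix_inv_vector[OF B] vimage_eq)
    qed
    moreover have "bounded ((*v) ?C ` a)"
      using a by (intro bounded_linear_image) (auto simp: matrix_vector_mul_bounded_linear)
    ultimately have "bounded ((*v) B -` a)" by (rule bounded_subset[rotated])
    then have "emeasure lborel ((*v) B -` a) < \<infinity>" by (rule emeasure_bounded_finite)
    then show "emeasure ?\<mu> a < \<infinity>" using a by (simp add: emeasure_distr)
  qed simp_all
  have "c \<noteq> 0"
  proof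
    assume "c = 0"
    then have "emeasure ?\<mu> UNIV = 0" using c by (simp add: emeasure_density)
    then have "emeasure lborel (UNIV :: (real^'d) set) = 0"
      by (simp add: emeasure_distr)
    then show False by simp
  qed
  with c have "0 < c" by simp
  show ?thesis
  proof (rule that[OF \<open>0 < c\<close>])
    fix f :: "real^'d \<Rightarrow> 'b" assume [measurable]: "f \<in> borel_measurable borel"
    have Bm': "(*v) B \<in> measurable lborel borel" by simp
    show "integrable lborel (\<lambda>x. f (B *v x)) \<longleftrightarrow> integrable lborel f"
      using integrable_distr_eq[OF Bm', of f] \<open>0 < c\<close>
      by (simp add: c(2) integrable_density integrable_scaleR_iff)
    show "(LINT x|lborel. f (B *v x)) = c *\<^sub>R (LINT x|lborel. f x)"
      using integral_distr[OF Bm', of f] \<open>0 < c\<close>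
      by (simp add: c(2) integral_density)
  qed
qed

section \<open>Characters\<close>

text \<open>This is e(x \<cdot> \<xi>) of the overview. With \<open>cis\<close>, the group law and
  the unit norm become rewriting facts; forward transforms are written with
  \<open>- \<xi>\<close>.\<close>

definition wave :: "real^'d \<Rightarrow> real^'d \<Rightarrow> complex" where
  "wave x \<xi> = cis (2 * pi * (x \<bullet> \<xi>))"

lemma norm_wave [simp]: "norm (wave x \<xi>) = 1"
  by (simp add: wave_def)

lemma wave_commute: "wave x \<xi> = wave \<xi> x"
  by (simp add: wave_def inner_commute)

lemma wave_0 [simp]: "wave 0 \<xi> = 1" "wave x 0 = 1"
  by (simp_all add: wave_def)

lemma wave_add: "wave (x + y) \<xi> = wave x \<xi> * wave y \<xi>" "wave x (\<xi> + \<zeta>) = wave x \<xi> * wave x \<zeta>"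
  by (simp_all add: wave_def cis_mult inner_add_left inner_add_right algebra_simps)

lemma wave_minus: "wave (- x) \<xi> = cnj (wave x \<xi>)" "wave x (- \<xi>) = cnj (wave x \<xi>)"
  by (simp_all add: wave_def cis_cnj)

lemma wave_mult_cnj [simp]: "wave x \<xi> * cnj (wave x \<xi>) = 1" "cnj (wave x \<xi>) * wave x \<xi> = 1"
  by (simp_all add: wave_def cis_cnj cis_mult)

lemma wave_diff:
  "wave (x - y) \<xi> = wave x \<xi> * cnj (wave y \<xi>)" "wave x (\<xi> - \<zeta>) = wave x \<xi> * cnj (wave x \<zeta>)"
  using wave_add(1)[of x "- y" \<xi>] wave_add(2)[of x \<xi> "- \<zeta>"] by (simp_all add: wave_minus)

lemma wave_scaleR: "wave (c *\<^sub>R x) \<xi> = wave x (c *\<^sub>R \<xi>)"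
  by (simp add: wave_def)

lemma wave_eq_prod: "wave x \<xi> = (\<Prod>i\<in>UNIV. cis (2 * pi * (x $ i * \<xi> $ i)))"
proof -
  have "(\<Prod>i\<in>A. cis (a i)) = cis (\<Sum>i\<in>A. a i)" if "finite A" for A :: "'a set" and a
    using that by induction (auto simp: cis_mult)
  then show ?thesis
    by (simp add: wave_def inner_vec_def sum_distrib_left)
qed

lemma continuous_on_wave [continuous_intros]:
  assumes "continuous_on S f" "continuous_on S g"
  shows "continuous_on S (\<lambda>x. wave (f x) (g x))"
  unfolding wave_def cis_conv_exp by (intro continuous_intros assms)

lemma measurable_wave [measurable (raw)]:
  assumes [measurable]: "f \<in> borel_measurable M" "g \<in> borel_measurable M"
  shows "(\<lambda>x. wave (f x) (g x)) \<in> borel_measurable M"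
  unfolding wave_def cis_conv_exp by measurable

lemma inv_fourier_eq: "inv_fourier f x = (LINT \<xi>|lebesgue. f \<xi> * wave x \<xi>)"
  by (simp add: inv_fourier_def wave_def cis_conv_exp mult_ac)

lemma fourier_eq: "fourier f \<xi> = (LINT x|lebesgue. f x * wave x (- \<xi>))"
  by (simp add: fourier_def wave_def cis_conv_exp mult_ac)

text \<open>The definitions integrate over the completed measure, while Fubini and substitutions run
  over \<open>lborel\<close>; for Borel functions the two agree.\<close>

lemma lebesgue_integral_lborel:
  fixes f :: "'a::euclidean_space \<Rightarrow> 'b::{banach, second_countable_topology}"
  assumes "f \<in> borel_measurable borel"
  shows "(LINT x|lebesgue. f x) = (LINT x|lborel. f x)"
    and "integrable lebesgue f \<longleftrightarrow> integrable lborel f"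
  using assms by (simp_all add: integral_completion integrable_completion)

lemma integrable_mult_bounded:
  fixes f g :: "'a \<Rightarrow> complex"
  assumes f: "integrable M f" and g: "g \<in> borel_measurable M" and b: "\<And>x. norm (g x) \<le> C"
  shows "integrable M (\<lambda>x. f x * g x)" "integrable M (\<lambda>x. g x * f x)"
proof -
  have [measurable]: "f \<in> borel_measurable M" using f by auto
  show *: "integrable M (\<lambda>x. f x * g x)"
  proof (rule Bochner_Integration.integrable_bound[where f="\<lambda>x. C * norm (f x)"])
    show "integrable M (\<lambda>x. C * norm (f x))" using f by auto
    show "(\<lambda>x. f x * g x) \<in> borel_measurable M" using g by measurable
    show "AE x in M. norm (f x * g x) \<le> norm (C * norm (f x))"
    proof (rule AE_I2)
      fix x
      have "0 \<le> C" using b[of x] norm_ge_zero order_trans by blast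
      then show "norm (f x * g x) \<le> norm (C * norm (f x))"
        using b[of x] mult_left_mono[of "norm (g x)" C "norm (f x)"] by (simp add: norm_mult mult.commute)
    qed
  qed
  then show "integrable M (\<lambda>x. g x * f x)" by (simp add: mult.commute)
qed

section \<open>Smooth bumps and their transforms\<close>

lemma partial_derivs_has_derivative:
  assumes "smooth f"
  shows "(partial_derivs ks f has_derivative frechet_derivative (partial_derivs ks f) (at x)) (at x)"
  using assms by (simp add: smooth_def differentiable_on_def frechet_derivative_works)

lemma cutoff_imp_bump_derivatives:
  fixes \<eta> :: "real^'d \<Rightarrow> real"
  assumes \<eta>: "cutoff \<eta>"
  obtains D :: "nat \<Rightarrow> real \<Rightarrow> real" where
    "\<And>n t. (D n has_real_derivative D (Suc n) t) (at t)"
    "\<And>n t. t \<notin> {1/2..1} \<Longrightarrow> D n t = 0"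
    "(LINT t|lborel. D 0 t) = 1"
  \<comment> \<open>\<open>D 0\<close> is minus the derivative of \<open>t \<mapsto> \<eta> (t *\<^sub>R axis i 1)\<close> on the positive half line.\<close>
proof -
  define i :: 'd where "i = undefined"
  define h where "h n t = partial_derivs (replicate n i) \<eta> (t *\<^sub>R axis i 1)" for n and t :: real
  have sm: "smooth \<eta>" using \<eta> by (simp add: cutoff_def)
  have h': "(h n has_real_derivative h (Suc n) t) (at t)" for n t
  proof -
    let ?g = "partial_derivs (replicate n i) \<eta>"
    have "((\<lambda>t. ?g (t *\<^sub>R axis i 1)) has_derivative
        (\<lambda>s. frechet_derivative ?g (at (t *\<^sub>R axis i 1)) (s *\<^sub>R axis i 1))) (at t)"
      by (rule has_derivative_compose[OF has_derivative_scaleR_left[OF has_derivative_ident]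
            partial_derivs_has_derivative[OF sm]])
    moreover have "frechet_derivative ?g (at (t *\<^sub>R axis i 1)) (s *\<^sub>R axis i 1) = h (Suc n) t * s" for s
      using linear_scale[OF has_derivative_linear[OF partial_derivs_has_derivative[OF sm]]]
      by (simp add: h_def partial_deriv_def)
    ultimately show ?thesis
      by (simp add: has_field_derivative_def h_def[abs_def])
  qed
  \<comment> \<open>Used on the two regions where the cutoff is constant along the axis: c = 1 near
    0 and c = 0 beyond 1.\<close>
  have const0: "h (Suc n) t = 0" if "open U" "t \<in> U" "\<And>t. t \<in> U \<Longrightarrow> h 0 t = c" for n t U and c :: real
    using that(2)
  proof (induction n arbitrary: t)
    case 0
    have "(h 0 has_real_derivative 0) (at t)"
      by (rule has_field_derivative_transform_within_open[where f="\<lambda>_. c" and S=U])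
        (use 0 that in auto)
    then show ?case using h'[of 0 t] DERIV_unique by blast
  next
    case (Suc n)
    have "(h (Suc n) has_real_derivative 0) (at t)"
      by (rule has_field_derivative_transform_within_open[where f="\<lambda>_. 0" and S=U])
        (use Suc that in auto)
    then show ?case using h'[of "Suc n" t] DERIV_unique by blast
  qed
  have h1: "h 0 t = 1" if "\<bar>t\<bar> \<le> 1/2" for t
  proof -
    have "t *\<^sub>R axis i 1 \<in> unit_cube"
      using that by (auto simp: unit_cube_def axis_def)
    then show ?thesis using \<eta> by (simp add: h_def cutoff_def)
  qed
  have h0: "h 0 t = 0" if "1 < \<bar>t\<bar>" for t
  proof -
    have "t *\<^sub>R axis i 1 \<notin> (*\<^sub>R) 2 ` unit_cube"
    proof
      assume "t *\<^sub>R axis i 1 \<in> (*\<^sub>R) 2 ` (unit_cube :: (real^'d) set)"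
      then obtain x :: "real^'d" where x: "x \<in> unit_cube" "t *\<^sub>R axis i 1 = 2 *\<^sub>R x" by auto
      have "t = 2 * x $ i" using arg_cong[OF x(2), of "\<lambda>v. v $ i"] by simp
      moreover have "\<bar>x $ i\<bar> \<le> 1/2" using x(1) by (simp add: unit_cube_def)
      ultimately show False using that by simp
    qed
    then show ?thesis using \<eta> by (simp add: h_def cutoff_def)
  qed
  have hs1: "h (Suc n) t = 0" if "\<bar>t\<bar> < 1/2" for n t
    by (rule const0[of "{-1/2<..<1/2}" _ 1]) (use that h1 in \<open>auto simp: abs_if split: if_splits\<close>)
  have hs0: "h (Suc n) t = 0" if "1 < t" for n t
    by (rule const0[of "{1<..}" _ 0]) (use that h0 in auto)
  \<comment> \<open>The cutoff falls from 1 to 0 along the positive half axis, so the sign makes the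
    integral positive. Cutting at 0 creates no singularity, since all derivatives of
    \<open>h 0\<close> vanish for |t| < 1/2.\<close>
  define D where "D n t = (if 0 < t then - h (Suc n) t else 0)" for n and t :: real
  have D': "(D n has_real_derivative D (Suc n) t) (at t)" for n t
  proof (cases "0 < t")
    case True
    have "((\<lambda>t. - h (Suc n) t) has_real_derivative - h (Suc (Suc n)) t) (at t)"
      by (rule DERIV_minus[OF h'])
    then have "(D n has_real_derivative - h (Suc (Suc n)) t) (at t)"
      by (rule has_field_derivative_transform_within_open[where S="{0<..}"])
        (use True in \<open>auto simp: D_def\<close>)
    then show ?thesis using True by (simp add: D_def)
  next
    case False
    have "(D n has_real_derivative 0) (at t)"
      by (rule has_field_derivative_transform_within_open[where f="\<lambda>_. 0" and S="{..<1/2}"])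
        (use False hs1 in \<open>auto simp: D_def abs_if\<close>)
    then show ?thesis using False by (simp add: D_def)
  qed
  have supp: "D n t = 0" if "t \<notin> {1/2..1}" for n t
    using that hs0[of t n] hs1[of t n] by (cases "0 < t") (auto simp: D_def)
  \<comment> \<open>The interval reaches past the support, so the value is
    \<open>h 0 0 - h 0 2\<close>, the full drop of the cutoff.\<close>
  have "(\<integral>t. - h (Suc 0) t * indicator {0..2} t \<partial>lborel) = (- h 0 2) - (- h 0 0)"
    by (rule integral_FTC_Icc_real)
      (simp, rule DERIV_minus[OF h'], rule isCont_minus[OF DERIV_isCont[OF h']])
  moreover have "D 0 t = - h (Suc 0) t * indicator {0..2} t" for t
    using supp[of t 0] hs1[of 0 0] hs0[of t 0] by (cases "t = 0") (auto simp: D_def indicator_def)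
  ultimately have "(LINT t|lborel. D 0 t) = 1"
    using h1[of 0] h0[of 2] by simp
  with D' supp show ?thesis by (rule that)
qed

section \<open>The transform of the one-dimensional bump\<close>

lemma continuous_on_integral_kernel:
  fixes f :: "'a \<Rightarrow> complex" and k :: "'a \<Rightarrow> 'u::metric_space \<Rightarrow> complex"
  assumes f: "integrable M f" and meas: "\<And>u. (\<lambda>x. k x u) \<in> borel_measurable M"
    and bound: "\<And>x u. norm (k x u) \<le> C" and cont: "\<And>x. continuous_on UNIV (k x)"
  shows "continuous_on UNIV (\<lambda>u. LINT x|M. f x * k x u)"
proof (subst continuous_on_sequentially, intro ballI allI impI)
  fix X :: "nat \<Rightarrow> 'u" and a assume X: "(\<forall>n. X n \<in> UNIV) \<and> X \<longlonglongrightarrow> a"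
  have [measurable]: "f \<in> borel_measurable M" using f by auto
  have "(\<lambda>n. LINT x|M. f x * k x (X n)) \<longlonglongrightarrow> (LINT x|M. f x * k x a)"
  proof (rule integral_dominated_convergence[where w="\<lambda>x. norm (f x) * C"])
    show "integrable M (\<lambda>x. norm (f x) * C)" using f by auto
    show "AE x in M. (\<lambda>n. f x * k x (X n)) \<longlonglongrightarrow> f x * k x a"
    proof (rule AE_I2)
      fix x
      have "(\<lambda>n. k x (X n)) \<longlonglongrightarrow> k x a"
        using continuous_on_tendsto_compose[OF cont[of x], of X a] X by simp
      then show "(\<lambda>n. f x * k x (X n)) \<longlonglongrightarrow> f x * k x a" by (intro tendsto_intros)
    qed
    show "AE x in M. norm (f x * k x (X n)) \<le> norm (f x) * C" for n
      using bound by (auto simp: norm_mult intro!: mult_left_mono)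
  qed (use meas in measurable)
  then show "((\<lambda>u. LINT x|M. f x * k x u) \<circ> X) \<longlonglongrightarrow> (LINT x|M. f x * k x a)"
    by (simp add: o_def)
qed

text \<open>All derivatives are carried along as the sequence \<open>D\<close>, so smoothness and
  integration by parts become index shifts.\<close>

locale bump =
  fixes D :: "nat \<Rightarrow> real \<Rightarrow> real"
  assumes D': "\<And>n t. (D n has_real_derivative D (Suc n) t) (at t)"
    and D_support: "\<And>n t. t \<notin> {1/2..1} \<Longrightarrow> D n t = 0"
    and D_integral: "(LINT t|lborel. D 0 t) = 1"
begin

definition bump_ft :: "nat \<Rightarrow> real \<Rightarrow> complex" where
  "bump_ft n u = (LINT t|lborel. complex_of_real (D n t) * cis (2 * pi * (u * t)))"

lemma D_continuous: "continuous_on S (D n)"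
  using D' by (intro continuous_at_imp_continuous_on ballI DERIV_isCont)

lemma D_measurable [measurable]: "D n \<in> borel_measurable borel"
  by (intro borel_measurable_continuous_onI D_continuous)

lemma D_integrable: "integrable lborel (\<lambda>t. complex_of_real (D n t))"
proof -
  have "integrable lborel (\<lambda>t. indicator {0..2} t *\<^sub>R complex_of_real (D n t))"
    by (rule borel_integrable_compact) (auto intro!: continuous_intros continuous_on_of_real D_continuous)
  also have "(\<lambda>t. indicator {0..2} t *\<^sub>R complex_of_real (D n t)) = (\<lambda>t. complex_of_real (D n t))"
    using D_support by (fastforce simp: indicator_def)
  finally show ?thesis .
qed

lemma D_cis_integrable: "integrable lborel (\<lambda>t. complex_of_real (D n t) * cis (2 * pi * (u * t)))"
  by (rule integrable_mult_bounded[OF D_integrable, where C=1]) (auto simp: cis_conv_exp)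

lemma continuous_bump_ft: "continuous_on S (bump_ft n)"
  unfolding bump_ft_def
  by (rule continuous_on_subset[OF continuous_on_integral_kernel[OF D_integrable, where C=1]])
    (auto simp: cis_conv_exp intro!: continuous_intros)

lemma bump_ft_bound: "norm (bump_ft n u) \<le> (LINT t|lborel. \<bar>D n t\<bar>)"
  unfolding bump_ft_def
  by (rule order_trans[OF integral_norm_bound]) (simp add: norm_mult)

lemma bump_ft_0: "bump_ft 0 0 = 1"
  unfolding bump_ft_def using D_integral by simp

text \<open>Integration by parts over the interval from 0 to 2. It contains the support in its
  interior, so the boundary terms vanish and the integral over it is the integral over the
  line.\<close>

lemma bump_ft_Suc: "bump_ft (Suc n) u = - (2 * pi * \<i> * u) * bump_ft n u"
proof -
  define e where "e t = cis (2 * pi * (u * t))" for t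
  have e: "e t = exp ((2 * pi * \<i> * u) * of_real t)" for t
    by (simp add: e_def cis_conv_exp mult_ac)
  have e': "(e has_vector_derivative (2 * pi * \<i> * u) * e t) (at t within S)" for t S
  proof -
    have "((\<lambda>z. exp ((2 * pi * \<i> * u) * z)) has_field_derivative (2 * pi * \<i> * u) * e t) (at (of_real t))"
      unfolding e by (auto intro!: derivative_eq_intros)
    from has_vector_derivative_real_field[OF this] show ?thesis
      unfolding e[abs_def] by (rule has_vector_derivative_at_within)
  qed
  have Dv: "((\<lambda>t. complex_of_real (D n t)) has_vector_derivative complex_of_real (D (Suc n) t)) (at t within S)" for t S
    by (rule has_vector_derivative_of_real)
      (use has_field_derivative_at_within[OF D'] has_real_derivative_iff_has_vector_derivative in blast)
  let ?f = "\<lambda>t. complex_of_real (D n t) * ((2 * pi * \<i> * u) * e t) + complex_of_real (D (Suc n) t) * e t"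
  have ce: "continuous_on S e" for S
    unfolding e[abs_def] by (intro continuous_intros)
  have "(\<integral>t. indicator {0..2} t *\<^sub>R ?f t \<partial>lborel) = complex_of_real (D n 2) * e 2 - complex_of_real (D n 0) * e 0"
    by (rule integral_FTC_Icc, simp, rule has_vector_derivative_mult[OF Dv e'])
      (intro continuous_intros D_continuous ce continuous_on_of_real)
  also have "\<dots> = 0" using D_support by simp
  also have "(\<lambda>t. indicator {0..2} t *\<^sub>R ?f t) = ?f"
    using D_support by (fastforce simp: indicator_def)
  also have "(LINT t|lborel. ?f t) = (2 * pi * \<i> * u) * bump_ft n u + bump_ft (Suc n) u"
  proof -
    have I: "integrable lborel (\<lambda>t. complex_of_real (D n t) * e t)" for n
      unfolding e_def by (rule D_cis_integrable)
    have "(LINT t|lborel. ?f t) = (LINT t|lborel. (2 * pi * \<i> * u) * (complex_of_real (D n t) * e t) +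
       complex_of_real (D (Suc n) t) * e t)"
      by (intro Bochner_Integration.integral_cong) (auto simp: algebra_simps)
    also have "\<dots> = (LINT t|lborel. (2 * pi * \<i> * u) * (complex_of_real (D n t) * e t)) +
       (LINT t|lborel. complex_of_real (D (Suc n) t) * e t)"
      by (rule Bochner_Integration.integral_add) (use I in auto)
    finally show ?thesis by (simp add: bump_ft_def e_def)
  qed
  finally show ?thesis by (simp add: add_eq_0_iff2)
qed

text \<open>Differentiating twice multiplies the transform by a multiple of the square of
  \<open>u\<close>, and every \<open>bump_ft n\<close> is bounded, so \<open>bump_ft 0\<close>
  decays like 1 / (1 + u^2).\<close>

lemma bump_ft_integrable: "integrable lborel (bump_ft 0)"
proof -
  define C where "C = (LINT t|lborel. \<bar>D 0 t\<bar>) + (LINT t|lborel. \<bar>D (Suc (Suc 0)) t\<bar>)"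
  have "(1 + u\<^sup>2) * norm (bump_ft 0 u) \<le> C" for u
  proof -
    have "norm (bump_ft (Suc (Suc 0)) u) = (2 * pi)\<^sup>2 * u\<^sup>2 * norm (bump_ft 0 u)"
      by (simp add: bump_ft_Suc norm_mult power2_eq_square)
    moreover have "1 * u\<^sup>2 * norm (bump_ft 0 u) \<le> (2 * pi)\<^sup>2 * u\<^sup>2 * norm (bump_ft 0 u)"
      using pi_gt3 by (intro mult_right_mono) (auto simp: power2_eq_square intro!: mult_ge1_I)
    ultimately show ?thesis
      using bump_ft_bound[of 0 u] bump_ft_bound[of "Suc (Suc 0)" u] by (simp add: C_def algebra_simps)
  qed
  then have b: "norm (bump_ft 0 u) \<le> C * inverse (1 + u\<^sup>2)" for u
    using pos_le_divide_eq[of "1 + u\<^sup>2" "norm (bump_ft 0 u)" C]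
    by (simp add: field_simps add_pos_nonneg)
  have "integrable lborel (\<lambda>x::real. inverse (1 + x\<^sup>2))"
    using integrable_inverse_1_plus_square by (simp add: set_integrable_def)
  then have "integrable lborel (\<lambda>x::real. C * inverse (1 + x\<^sup>2))" by simp
  then show ?thesis
    by (rule Bochner_Integration.integrable_bound)
      (use b in \<open>auto intro!: borel_measurable_continuous_onI continuous_bump_ft order_trans[OF b]\<close>)
qed

end

section \<open>Product bumps in several variables\<close>

lemma has_derivative_prod_cart:
  fixes d :: "'d::finite \<Rightarrow> nat \<Rightarrow> real \<Rightarrow> complex"
  assumes d: "\<And>i n t. (d i n has_vector_derivative d i (Suc n) t) (at t)"
  shows "((\<lambda>x::real^'d. \<Prod>i\<in>UNIV. d i (m i) (x $ i)) has_derivative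
     (\<lambda>y. \<Sum>i\<in>UNIV. (y $ i *\<^sub>R d i (Suc (m i)) (x $ i)) * (\<Prod>j\<in>UNIV - {i}. d j (m j) (x $ j)))) (at x)"
proof (rule has_derivative_prod)
  fix i :: 'd
  have 1: "((\<lambda>x::real^'d. x $ i) has_derivative (\<lambda>y. y $ i)) (at x)"
    by (rule bounded_linear.has_derivative[OF bounded_linear_vec_nth has_derivative_ident])
  have 2: "(d i (m i) has_derivative (\<lambda>h. h *\<^sub>R d i (Suc (m i)) (x $ i))) (at (x $ i))"
    using d[of i "m i" "x $ i"] by (simp add: has_vector_derivative_def)
  show "((\<lambda>x. d i (m i) (x $ i)) has_derivative (\<lambda>y. y $ i *\<^sub>R d i (Suc (m i)) (x $ i))) (at x)"
    by (rule has_derivative_compose[OF 1 2])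
qed

text \<open>Here \<open>d i n\<close> plays the n-th derivative of the i-th factor. Each entry of
  \<open>ks\<close> differentiates one factor once, so only the multiplicities in the list matter,
  whatever the order.\<close>

lemma partial_derivs_prod_cart:
  fixes d :: "'d::finite \<Rightarrow> nat \<Rightarrow> real \<Rightarrow> complex"
  assumes d: "\<And>i n t. (d i n has_vector_derivative d i (Suc n) t) (at t)"
  shows "partial_derivs ks (\<lambda>x::real^'d. \<Prod>i\<in>UNIV. d i 0 (x $ i)) =
    (\<lambda>x. \<Prod>i\<in>UNIV. d i (count_list ks i) (x $ i))"
proof (induction ks)
  case Nil
  then show ?case by simp
next
  case (Cons k ks)
  show ?case
  proof
    fix x :: "real^'d"
    let ?c = "count_list ks"
    let ?r = "\<lambda>i. \<Prod>j\<in>UNIV - {i}. d j (?c j) (x $ j)"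
    have "partial_derivs (k # ks) (\<lambda>x::real^'d. \<Prod>i\<in>UNIV. d i 0 (x $ i)) x =
       (\<Sum>i\<in>UNIV. ((axis k 1 :: real^'d) $ i *\<^sub>R d i (Suc (?c i)) (x $ i)) * ?r i)"
      unfolding partial_derivs.simps(2) Cons partial_deriv_def
      by (rule fun_cong[OF frechet_derivative_at[OF has_derivative_prod_cart[where d=d, OF d, of "?c" x], symmetric]])
    also have "\<dots> = (\<Sum>i\<in>UNIV. if i = k then d k (Suc (?c k)) (x $ k) * ?r k else 0)"
      by (intro sum.cong) (auto simp: axis_def)
    also have "\<dots> = d k (Suc (?c k)) (x $ k) * ?r k" by simp
    also have "?r k = (\<Prod>j\<in>UNIV - {k}. d j (count_list (k # ks) j) (x $ j))"
      by (intro prod.cong) auto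
    also have "d k (Suc (?c k)) (x $ k) * \<dots> = (\<Prod>j\<in>UNIV. d j (count_list (k # ks) j) (x $ j))"
      by (subst prod.remove[of UNIV k]) auto
    finally show "partial_derivs (k # ks) (\<lambda>x::real^'d. \<Prod>i\<in>UNIV. d i 0 (x $ i)) x = \<dots>" .
  qed
qed

lemma smooth_prod_cart:
  fixes d :: "'d::finite \<Rightarrow> nat \<Rightarrow> real \<Rightarrow> complex"
  assumes d: "\<And>i n t. (d i n has_vector_derivative d i (Suc n) t) (at t)"
  shows "smooth (\<lambda>x::real^'d. \<Prod>i\<in>UNIV. d i 0 (x $ i))"
  unfolding smooth_def partial_derivs_prod_cart[where d=d, OF d]
  using has_derivative_prod_cart[where d=d, OF d] by (auto simp: differentiable_on_def differentiable_def)

context bump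
begin

text \<open>Since \<open>D 0\<close> lives between 1/2 and 1, the support lies in the cube of side
  \<open>s\<close> with lower corner \<xi>; the cube is not centred at \<xi>.\<close>

definition bump_at :: "real^'d \<Rightarrow> real \<Rightarrow> real^'d \<Rightarrow> complex" where
  "bump_at \<xi> s \<zeta> = (\<Prod>i\<in>UNIV. complex_of_real (D 0 ((\<zeta> $ i - \<xi> $ i) / s)))"

text \<open>The inverse transform of \<open>bump_at 0 1\<close>. By scaling,
  \<open>bump_at \<xi> s\<close> has as inverse transform, up to the power of \<open>s\<close>, a
  character times this kernel at \<open>s *\<^sub>R x\<close>, a factor tending to 1 as
  \<open>s\<close> tends to 0.\<close>

definition bump_kernel :: "real^'d \<Rightarrow> complex" where
  "bump_kernel x = (\<Prod>i\<in>UNIV. bump_ft 0 (x $ i))"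

lemma smooth_bump_at: "smooth (bump_at \<xi> s :: real^'d \<Rightarrow> complex)"
proof -
  let ?d = "\<lambda>(i::'d) n t. complex_of_real (D n ((t - \<xi> $ i) / s) / s ^ n)"
  have "(?d i n has_vector_derivative ?d i (Suc n) t) (at t)" for i n t
  proof (rule has_vector_derivative_of_real)
    \<comment> \<open>The case split in the proof is for \<open>s = 0\<close>, where division by
      zero makes the quotient constantly 0 and both sides of the chain rule trivial.\<close>
    have "((\<lambda>t. D n ((t - \<xi> $ i) / s)) has_real_derivative D (Suc n) ((t - \<xi> $ i) / s) * (1 / s)) (at t)"
      by (rule DERIV_chain2[OF D']) (cases "s = 0", auto intro!: derivative_eq_intros)
    then have "((\<lambda>t. D n ((t - \<xi> $ i) / s) / s ^ n) has_real_derivative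
        (D (Suc n) ((t - \<xi> $ i) / s) * (1 / s)) / s ^ n) (at t)"
      by (rule DERIV_cdivide)
    then show "((\<lambda>t. D n ((t - \<xi> $ i) / s) / s ^ n) has_field_derivative
        D (Suc n) ((t - \<xi> $ i) / s) / s ^ Suc n) (at t)"
      by (simp add: mult.commute)
  qed
  from smooth_prod_cart[where d="?d", OF this] show ?thesis
    by (simp add: bump_at_def[abs_def])
qed

lemma bump_at_support:
  assumes "0 < s" "bump_at \<xi> s \<zeta> \<noteq> 0"
  shows "\<xi> $ i \<le> \<zeta> $ i \<and> \<zeta> $ i \<le> \<xi> $ i + s"
proof -
  have "D 0 ((\<zeta> $ i - \<xi> $ i) / s) \<noteq> 0" using assms(2) by (auto simp: bump_at_def)
  then have "(\<zeta> $ i - \<xi> $ i) / s \<in> {1/2..1}" using D_support by blast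
  then show ?thesis using assms(1) by (auto simp: field_simps)
qed

lemma fun_supp_bump_at:
  assumes "0 < s"
  shows "fun_supp (bump_at \<xi> s) \<subseteq> {\<zeta>. \<forall>i. \<xi> $ i \<le> \<zeta> $ i \<and> \<zeta> $ i \<le> \<xi> $ i + s}"
proof -
  have "{\<zeta>. \<forall>i. \<xi> $ i \<le> \<zeta> $ i \<and> \<zeta> $ i \<le> \<xi> $ i + s} = cbox \<xi> (\<chi> i. \<xi> $ i + s)"
    by (auto simp: mem_box_cart)
  then have "closed {\<zeta>. \<forall>i. \<xi> $ i \<le> \<zeta> $ i \<and> \<zeta> $ i \<le> \<xi> $ i + s}"
    by (simp only: closed_cbox)
  then show ?thesis
    unfolding fun_supp_def by (rule closure_minimal[rotated]) (use bump_at_support[OF assms] in auto)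
qed

lemma bump_at_test_function:
  assumes "0 < s" "{\<zeta>. \<forall>i. \<xi> $ i \<le> \<zeta> $ i \<and> \<zeta> $ i \<le> \<xi> $ i + s} \<subseteq> U"
  shows "bump_at \<xi> s \<in> test_functions U"
proof -
  have "{\<zeta>. \<forall>i. \<xi> $ i \<le> \<zeta> $ i \<and> \<zeta> $ i \<le> \<xi> $ i + s} = cbox \<xi> (\<chi> i. \<xi> $ i + s)"
    by (auto simp: mem_box_cart)
  then have "bounded (fun_supp (bump_at \<xi> s))"
    using fun_supp_bump_at[OF assms(1), of \<xi>] bounded_cbox bounded_subset by metis
  then have "compact (fun_supp (bump_at \<xi> s))"
    by (simp add: compact_eq_bounded_closed fun_supp_def)
  then show ?thesis
    using smooth_bump_at fun_supp_bump_at[OF assms(1), of \<xi>] assms(2) by (auto simp: test_functions_def)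
qed

lemma continuous_bump_at: "0 < s \<Longrightarrow> continuous_on S (bump_at \<xi> s)"
  unfolding bump_at_def
  by (intro continuous_intros continuous_on_of_real continuous_on_compose2[OF D_continuous[of UNIV]]) auto

lemma bump_at_measurable [measurable]: "0 < s \<Longrightarrow> bump_at \<xi> s \<in> borel_measurable borel"
  by (intro borel_measurable_continuous_onI continuous_bump_at)

lemma continuous_bump_kernel: "continuous_on S bump_kernel"
  unfolding bump_kernel_def
  by (intro continuous_intros continuous_on_compose2[OF continuous_bump_ft[of UNIV]]) auto

lemma bump_kernel_measurable [measurable]: "bump_kernel \<in> borel_measurable borel"
  by (intro borel_measurable_continuous_onI continuous_bump_kernel)

lemma bump_kernel_0 [simp]: "bump_kernel 0 = 1"
  by (simp add: bump_kernel_def bump_ft_0)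

lemma bump_kernel_bounded:
  obtains C where "\<And>x :: real^'d. norm (bump_kernel x) \<le> C"
proof
  fix x :: "real^'d"
  show "norm (bump_kernel x) \<le> (LINT t|lborel. \<bar>D 0 t\<bar>) ^ CARD('d)"
    unfolding bump_kernel_def prod_norm[symmetric]
    using prod_mono[of UNIV "\<lambda>i. norm (bump_ft 0 (x $ i))" "\<lambda>_. LINT t|lborel. \<bar>D 0 t\<bar>"] bump_ft_bound
    by simp
qed

lemma bump_kernel_integrable: "integrable lborel (bump_kernel :: real^'d \<Rightarrow> complex)"
  unfolding bump_kernel_def[abs_def] by (rule integrable_prod_cart[OF bump_ft_integrable])

lemma
  assumes "0 < s"
  shows bump_at_integrable: "integrable lborel (bump_at \<xi> s :: real^'d \<Rightarrow> complex)"
    and bump_at_ft: "(LINT \<zeta>|lborel. bump_at \<xi> s \<zeta> * wave x \<zeta>) =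
       s ^ CARD('d) *\<^sub>R (wave x \<xi> * bump_kernel (s *\<^sub>R x))"
proof -
  have eq: "bump_at \<xi> s (\<xi> + s *\<^sub>R \<zeta>) = (\<Prod>i\<in>UNIV. complex_of_real (D 0 (\<zeta> $ i)))" for \<zeta>
    using assms by (simp add: bump_at_def)
  have "integrable lborel (\<lambda>x::real^'d. \<Prod>i\<in>UNIV. complex_of_real (D 0 (x $ i)))"
    by (rule integrable_prod_cart[where g="\<lambda>_ t. complex_of_real (D 0 t)", OF D_integrable])
  then show "integrable lborel (bump_at \<xi> s)"
    using lborel_integrable_affine_iff[of s "bump_at \<xi> s" \<xi>] assms by (simp add: eq)
  have eq2: "bump_at \<xi> s (\<xi> + s *\<^sub>R \<zeta>) * wave x (\<xi> + s *\<^sub>R \<zeta>) =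
     wave x \<xi> * (\<Prod>i\<in>UNIV. complex_of_real (D 0 (\<zeta> $ i)) * cis (2 * pi * ((s *\<^sub>R x) $ i * \<zeta> $ i)))" for \<zeta>
    unfolding eq wave_add prod.distrib
    by (simp add: wave_scaleR[symmetric] wave_eq_prod[of "s *\<^sub>R x"] mult_ac)
  have [measurable]: "bump_at \<xi> s \<in> borel_measurable borel" using assms by measurable
  have "(LINT \<zeta>|lborel. bump_at \<xi> s \<zeta> * wave x \<zeta>) =
      \<bar>s\<bar> ^ DIM(real^'d) *\<^sub>R (LINT \<zeta>|lborel. bump_at \<xi> s (\<xi> + s *\<^sub>R \<zeta>) * wave x (\<xi> + s *\<^sub>R \<zeta>))"
    by (rule lborel_integral_affine) (use assms in auto)
  also have "\<dots> = s ^ CARD('d) *\<^sub>R (wave x \<xi> * bump_kernel (s *\<^sub>R x))"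
    unfolding eq2 integral_mult_right_zero bump_kernel_def bump_ft_def
    using assms by (subst integral_prod_cart[OF D_cis_integrable]) simp
  finally show "(LINT \<zeta>|lborel. bump_at \<xi> s \<zeta> * wave x \<zeta>) =
       s ^ CARD('d) *\<^sub>R (wave x \<xi> * bump_kernel (s *\<^sub>R x))" .
qed

end

section \<open>Gaussian means\<close>

text \<open>Normalized to have integral 1 and to be its own Fourier transform; complex-valued so
  that it enters the complex integrals directly.\<close>

definition gauss :: "real^'d \<Rightarrow> complex" where
  "gauss x = complex_of_real (exp (- pi * (x \<bullet> x)))"

text \<open>This is the characteristic function of the standard normal distribution: t = v / sqrt (2
  pi) turns exp (- v^2 / 2) into exp (- pi t^2).\<close>

lemma
  shows gauss_1d_integrable:
      "integrable lborel (\<lambda>t::real. complex_of_real (exp (- pi * t\<^sup>2)) * cis (2 * pi * (u * t)))"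
    and gauss_1d_ft:
      "(LINT t|lborel. complex_of_real (exp (- pi * t\<^sup>2)) * cis (2 * pi * (u * t))) =
         complex_of_real (exp (- pi * u\<^sup>2))"
proof -
  define c where "c = sqrt (2 * pi)"
  have c: "0 < c" "c * c = 2 * pi" by (simp_all add: c_def real_sqrt_mult_self)
  define g where "g t = complex_of_real (exp (- pi * t\<^sup>2)) * cis (2 * pi * (u * t))" for t :: real
  have g_meas [measurable]: "g \<in> borel_measurable borel" unfolding g_def cis_conv_exp by measurable
  have [measurable]: "std_normal_density \<in> borel_measurable borel" by measurable
  have g: "std_normal_density v *\<^sub>R iexp (c * u * v) = (1 / c) *\<^sub>R g (0 + (1 / c) *\<^sub>R v)" for v
  proof -
    have "pi * (v / c)\<^sup>2 = v\<^sup>2 / 2" using c by (simp add: power2_eq_square field_simps)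
    moreover have "2 * pi * (u * (v / c)) = c * u * v" using c by (simp add: field_simps)
    ultimately show ?thesis
      unfolding g_def std_normal_density_def c_def[symmetric]
      by (simp add: scaleR_conv_of_real cis_conv_exp mult_ac)
  qed
  have "integrable lborel (\<lambda>v. std_normal_density v *\<^sub>R iexp (c * u * v))"
  proof (rule Bochner_Integration.integrable_bound[of lborel std_normal_density])
    show "integrable lborel std_normal_density" by (rule integrable_normal_density) simp
  qed (auto simp: norm_mult)
  then have "integrable lborel (\<lambda>v. g (0 + (1 / c) *\<^sub>R v))"
    unfolding g using c by (simp add: integrable_scaleR_iff)
  then show "integrable lborel (\<lambda>t::real. complex_of_real (exp (- pi * t\<^sup>2)) * cis (2 * pi * (u * t)))"
    using lborel_integrable_affine_iff[of "1 / c" g 0] c unfolding g_def[symmetric] by simp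
  have "(LINT v|lborel. std_normal_density v *\<^sub>R iexp (c * u * v)) = char std_normal_distribution (c * u)"
    unfolding char_def by (subst integral_density) auto
  also have "\<dots> = complex_of_real (exp (- pi * u\<^sup>2))"
    unfolding char_std_normal_distribution using c by (simp add: power2_eq_square mult_ac)
  finally have *: "(LINT v|lborel. (1 / c) *\<^sub>R g (0 + (1 / c) *\<^sub>R v)) = complex_of_real (exp (- pi * u\<^sup>2))"
    unfolding g .
  have "(LINT t|lborel. g t) = \<bar>1 / c\<bar> ^ DIM(real) *\<^sub>R (LINT v|lborel. g (0 + (1 / c) *\<^sub>R v))"
    by (rule lborel_integral_affine) (use c in auto)
  also have "\<dots> = complex_of_real (exp (- pi * u\<^sup>2))"
    using * c by simp
  finally show "(LINT t|lborel. complex_of_real (exp (- pi * t\<^sup>2)) * cis (2 * pi * (u * t))) =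
         complex_of_real (exp (- pi * u\<^sup>2))"
    unfolding g_def .
qed

lemma gauss_eq_prod: "gauss x = (\<Prod>i\<in>UNIV. complex_of_real (exp (- pi * (x $ i)\<^sup>2)))"
proof -
  have "exp (- pi * (x \<bullet> x)) = (\<Prod>i\<in>UNIV. exp (- pi * (x $ i)\<^sup>2))"
    by (simp add: inner_vec_def exp_sum[symmetric] sum_distrib_left sum_negf power2_eq_square)
  then show ?thesis by (simp only: gauss_def of_real_prod)
qed

lemma
  fixes u :: "real^'d"
  shows gauss_wave_integrable: "integrable lborel (\<lambda>x. gauss x * wave u x)"
    and gauss_ft: "(LINT x|lborel. gauss x * wave u x) = gauss u"
proof -
  have eq: "gauss x * wave u x =
      (\<Prod>i\<in>UNIV. complex_of_real (exp (- pi * (x $ i)\<^sup>2)) * cis (2 * pi * (u $ i * x $ i)))" for x :: "real^'d"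
    by (simp only: gauss_eq_prod wave_eq_prod prod.distrib)
  show "integrable lborel (\<lambda>x. gauss x * wave u x)"
    unfolding eq by (rule integrable_prod_cart[OF gauss_1d_integrable])
  show "(LINT x|lborel. gauss x * wave u x) = gauss u"
    unfolding eq integral_prod_cart[OF gauss_1d_integrable] gauss_1d_ft gauss_eq_prod[of u, symmetric] ..
qed

lemma continuous_on_gauss [continuous_intros]:
  "continuous_on S f \<Longrightarrow> continuous_on S (\<lambda>x. gauss (f x))"
  unfolding gauss_def by (intro continuous_intros)

lemma gauss_measurable [measurable]: "gauss \<in> borel_measurable borel"
  by (intro borel_measurable_continuous_onI continuous_intros)

lemma gauss_0 [simp]: "gauss 0 = 1"
  by (simp add: gauss_def)

lemma norm_gauss_le: "norm (gauss x) \<le> 1"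
  by (simp add: gauss_def)

lemma gauss_integrable: "integrable lborel (gauss :: real^'d \<Rightarrow> complex)"
  using gauss_wave_integrable[of 0] by simp

lemma gauss_integral: "(LINT x|lborel. gauss (x :: real^'d)) = 1"
  using gauss_ft[of "0 :: real^'d"] by simp

lemma
  fixes u :: "real^'d"
  assumes "0 < \<epsilon>"
  shows gauss_scaled_integrable: "integrable lborel (\<lambda>x :: real^'d. gauss (\<epsilon> *\<^sub>R x))"
    and gauss_scaled_ft:
      "\<epsilon> ^ CARD('d) *\<^sub>R (LINT x|lborel. gauss (\<epsilon> *\<^sub>R x) * wave u x) = gauss (u /\<^sub>R \<epsilon>)"
proof -
  show "integrable lborel (\<lambda>x :: real^'d. gauss (\<epsilon> *\<^sub>R x))"
    using lborel_integrable_affine_iff[of \<epsilon> "gauss :: real^'d \<Rightarrow> complex" 0] assms gauss_integrable by simp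
  have "gauss (u /\<^sub>R \<epsilon>) = (LINT x|lborel. gauss x * wave (u /\<^sub>R \<epsilon>) x)"
    by (simp add: gauss_ft)
  also have "\<dots> = \<bar>\<epsilon>\<bar> ^ DIM(real^'d) *\<^sub>R
      (LINT x|lborel. gauss (0 + \<epsilon> *\<^sub>R x) * wave (u /\<^sub>R \<epsilon>) (0 + \<epsilon> *\<^sub>R x))"
    by (rule lborel_integral_affine) (use assms in auto)
  also have "\<dots> = \<epsilon> ^ CARD('d) *\<^sub>R (LINT x|lborel. gauss (\<epsilon> *\<^sub>R x) * wave u x)"
    using assms by (simp add: wave_scaleR[symmetric])
  finally show "\<epsilon> ^ CARD('d) *\<^sub>R (LINT x|lborel. gauss (\<epsilon> *\<^sub>R x) * wave u x) = gauss (u /\<^sub>R \<epsilon>)" ..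
qed

lemma gauss_mean_eq:
  fixes F :: "real^'d \<Rightarrow> complex"
  assumes "0 < \<epsilon>" and [measurable]: "F \<in> borel_measurable borel"
  shows "(LINT x|lborel. F x * gauss ((x - p) /\<^sub>R \<epsilon>)) =
    \<epsilon> ^ CARD('d) *\<^sub>R (LINT v|lborel. F (p + \<epsilon> *\<^sub>R v) * gauss v)"
proof -
  have "(LINT x|lborel. F x * gauss ((x - p) /\<^sub>R \<epsilon>)) = \<bar>\<epsilon>\<bar> ^ DIM(real^'d) *\<^sub>R
      (LINT v|lborel. F (p + \<epsilon> *\<^sub>R v) * gauss ((p + \<epsilon> *\<^sub>R v - p) /\<^sub>R \<epsilon>))"
    by (rule lborel_integral_affine) (use assms in auto)
  then show ?thesis using assms by simp
qed

lemma gauss_mean_bound: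
  fixes F :: "real^'d \<Rightarrow> complex"
  assumes [measurable]: "F \<in> borel_measurable borel" and C: "\<And>x. norm (F x) \<le> C"
  shows "norm (LINT v|lborel. F (p + \<epsilon> *\<^sub>R v) * gauss v) \<le> C"
proof -
  have "0 \<le> C" using C[of 0] norm_ge_zero order_trans by blast
  have "norm (LINT v|lborel. F (p + \<epsilon> *\<^sub>R v) * gauss v) \<le> (LINT v|lborel. norm (F (p + \<epsilon> *\<^sub>R v) * gauss v))"
    by (rule integral_norm_bound)
  also have "\<dots> \<le> (LINT v|lborel. C * norm (gauss (v :: real^'d)))"
  proof (rule integral_mono)
    show "integrable lborel (\<lambda>v. norm (F (p + \<epsilon> *\<^sub>R v) * gauss v))"
      by (intro integrable_norm integrable_mult_bounded(2)[OF gauss_integrable _ C]) measurable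
    show "integrable lborel (\<lambda>v. C * norm (gauss (v :: real^'d)))"
      using gauss_integrable by auto
  qed (use C in \<open>auto simp: norm_mult intro!: mult_right_mono\<close>)
  also have "\<dots> = C"
  proof -
    have "(LINT v|lborel. norm (gauss (v :: real^'d))) = Re (LINT v|lborel. gauss (v :: real^'d))"
      by (subst integral_Re[symmetric]) (auto simp: gauss_integrable gauss_def)
    then show ?thesis by (simp add: gauss_integral)
  qed
  finally show ?thesis .
qed

text \<open>The centres \<open>p n\<close> may move, as long as \<open>p n + \<epsilon> n *\<^sub>R v\<close> tends to a point of continuity.\<close>

lemma gauss_mean_tendsto:
  fixes F :: "real^'d \<Rightarrow> complex"
  assumes [measurable]: "F \<in> borel_measurable borel" and C: "\<And>x. norm (F x) \<le> C"
    and cont: "isCont F y" and p: "p \<longlonglongrightarrow> y" and \<epsilon>: "\<epsilon> \<longlonglongrightarrow> 0"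
  shows "(\<lambda>n. LINT v|lborel. F (p n + \<epsilon> n *\<^sub>R v) * gauss v) \<longlonglongrightarrow> F y"
proof -
  have "(\<lambda>n. LINT v|lborel. F (p n + \<epsilon> n *\<^sub>R v) * gauss v) \<longlonglongrightarrow> (LINT v|lborel. F y * gauss (v :: real^'d))"
  proof (rule integral_dominated_convergence[where w="\<lambda>v. C * norm (gauss v)"])
    show "integrable lborel (\<lambda>v. C * norm (gauss (v :: real^'d)))"
      using gauss_integrable by auto
    show "AE v in lborel. (\<lambda>n. F (p n + \<epsilon> n *\<^sub>R v) * gauss v) \<longlonglongrightarrow> F y * gauss v"
    proof (rule AE_I2)
      fix v :: "real^'d"
      have "(\<lambda>n. p n + \<epsilon> n *\<^sub>R v) \<longlonglongrightarrow> y + 0 *\<^sub>R v" by (intro tendsto_intros p \<epsilon>)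
      then have "(\<lambda>n. F (p n + \<epsilon> n *\<^sub>R v)) \<longlonglongrightarrow> F y"
        by (intro isCont_tendsto_compose[OF cont]) simp
      then show "(\<lambda>n. F (p n + \<epsilon> n *\<^sub>R v) * gauss v) \<longlonglongrightarrow> F y * gauss v"
        by (intro tendsto_intros)
    qed
    show "AE v in lborel. norm (F (p n + \<epsilon> n *\<^sub>R v) * gauss v) \<le> C * norm (gauss v)" for n
      using C by (auto simp: norm_mult intro!: mult_right_mono)
  qed measurable
  then show ?thesis by (simp add: gauss_integral)
qed

text \<open>The common shape of the exchanges of integrals below: two integrable functions and a
  bounded kernel, mostly a character, so that a multiple of the product of the norms
  dominates.\<close>

lemma Fubini_bounded_kernel:
  fixes g :: "'a::euclidean_space \<Rightarrow> complex" and h :: "'b::euclidean_space \<Rightarrow> complex"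
  assumes g: "integrable lborel g" and h: "integrable lborel h"
    and k [measurable]: "(\<lambda>(x, y). k x y) \<in> borel_measurable (borel \<Otimes>\<^sub>M borel)"
    and C: "\<And>x y. norm (k x y) \<le> C"
  shows "integrable (lborel \<Otimes>\<^sub>M lborel) (\<lambda>(x, y). g x * h y * k x y)"
    and "(LINT x|lborel. g x * (LINT y|lborel. h y * k x y)) = (LINT y|lborel. h y * (LINT x|lborel. g x * k x y))"
proof -
  have [measurable]: "g \<in> borel_measurable borel" "h \<in> borel_measurable borel" using g h by auto
  have k1 [measurable]: "(\<lambda>y. k x y) \<in> borel_measurable borel" for x
    using measurable_compose[OF measurable_Pair1' k, of x] by simp
  have k2 [measurable]: "(\<lambda>x. k x y) \<in> borel_measurable borel" for y
    using measurable_compose[OF measurable_Pair2' k, of y] by simp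
  show I: "integrable (lborel \<Otimes>\<^sub>M lborel) (\<lambda>(x, y). g x * h y * k x y)"
  proof (rule Bochner_Integration.integrable_bound)
    show "integrable (lborel \<Otimes>\<^sub>M lborel) (\<lambda>(x, y). C * (norm (g x) * norm (h y)))"
    proof (rule lborel_pair.Fubini_integrable)
      show "AE x in lborel. integrable lborel (\<lambda>y. case (x, y) of (x, y) \<Rightarrow> C * (norm (g x) * norm (h y)))"
        using h by auto
      show "integrable lborel (\<lambda>x. LINT y|lborel. norm (case (x, y) of (x, y) \<Rightarrow> C * (norm (g x) * norm (h y))))"
        using g by (simp add: abs_mult)
    qed measurable
    show "AE z in lborel \<Otimes>\<^sub>M lborel. norm (case z of (x, y) \<Rightarrow> g x * h y * k x y) \<le>
        norm (case z of (x, y) \<Rightarrow> C * (norm (g x) * norm (h y)))"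
    proof (rule AE_I2)
      fix z :: "'a \<times> 'b"
      obtain x y where z: "z = (x, y)" by (cases z)
      have "0 \<le> C" using C[of x y] norm_ge_zero order_trans by blast
      then show "norm (case z of (x, y) \<Rightarrow> g x * h y * k x y) \<le>
          norm (case z of (x, y) \<Rightarrow> C * (norm (g x) * norm (h y)))"
        using mult_left_mono[OF C[of x y], of "norm (g x) * norm (h y)"]
        by (simp add: z norm_mult abs_mult mult_ac)
    qed
  qed measurable
  have "(LINT x|lborel. (LINT y|lborel. g x * h y * k x y)) = (LINT y|lborel. (LINT x|lborel. g x * h y * k x y))"
    by (rule lborel_pair.Fubini_integral[OF I, symmetric])
  moreover have "(LINT y|lborel. g x * h y * k x y) = g x * (LINT y|lborel. h y * k x y)" for x
    by (simp add: mult.assoc)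
  moreover have "(LINT x|lborel. g x * h y * k x y) = h y * (LINT x|lborel. g x * k x y)" for y
    by (subst integral_mult_right_zero[symmetric]) (simp add: mult_ac)
  ultimately show "(LINT x|lborel. g x * (LINT y|lborel. h y * k x y)) =
      (LINT y|lborel. h y * (LINT x|lborel. g x * k x y))" by simp
qed

section \<open>Spectral synthesis\<close>

context bump
begin

text \<open>Integrating the hypothesis over \<open>\<xi>\<close> with weight \<open>a\<close> gives the conclusion with an
  additional factor \<open>bump_kernel (s *\<^sub>R x)\<close>, which tends to 1.\<close>

lemma superposition:
  fixes f a :: "real^'d \<Rightarrow> complex"
  assumes [measurable]: "f \<in> borel_measurable borel" and C: "\<And>x. norm (f x) \<le> C"
    and a: "integrable lborel a" and A: "integrable lborel (\<lambda>x. LINT \<xi>|lborel. a \<xi> * wave x \<xi>)"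
    and s0: "0 < s0" and zero: "\<And>\<xi> s. a \<xi> \<noteq> 0 \<Longrightarrow> 0 < s \<Longrightarrow> s < s0 \<Longrightarrow>
      (LINT x|lborel. f x * wave x \<xi> * bump_kernel (s *\<^sub>R x)) = 0"
  shows "(LINT x|lborel. f x * (LINT \<xi>|lborel. a \<xi> * wave x \<xi>)) = 0"
proof -
  let ?A = "\<lambda>x. LINT \<xi>|lborel. a \<xi> * wave x \<xi>"
  have A_meas [measurable]: "?A \<in> borel_measurable borel"
    using borel_measurable_integrable[OF A] by simp
  obtain K where K: "\<And>x :: real^'d. norm (bump_kernel x) \<le> K"
    using bump_kernel_bounded[where 'd='d] by blast
  \<comment> \<open>For fixed \<open>s\<close> the kernel is integrable in \<open>x\<close>, which
    makes Fubini available although \<open>f\<close> is only bounded.\<close>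
  have zs: "(LINT x|lborel. f x * bump_kernel (s *\<^sub>R x) * ?A x) = 0" if s: "0 < s" "s < s0" for s
  proof -
    have "integrable lborel (\<lambda>x :: real^'d. bump_kernel (s *\<^sub>R x))"
      using lborel_integrable_affine_iff[of s "bump_kernel :: real^'d \<Rightarrow> complex" 0] s bump_kernel_integrable
      by simp
    then have I: "integrable lborel (\<lambda>x. f x * bump_kernel (s *\<^sub>R x))"
      by (rule integrable_mult_bounded(2)) (use C in auto)
    have "(LINT x|lborel. f x * bump_kernel (s *\<^sub>R x) * ?A x) =
        (LINT \<xi>|lborel. a \<xi> * (LINT x|lborel. f x * bump_kernel (s *\<^sub>R x) * wave x \<xi>))"
      by (rule Fubini_bounded_kernel(2)[OF I a, where C=1]) auto
    also have "\<dots> = (LINT \<xi>|(lborel :: (real^'d) measure). 0)"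
    proof (rule Bochner_Integration.integral_cong[OF refl])
      fix \<xi>
      show "a \<xi> * (LINT x|lborel. f x * bump_kernel (s *\<^sub>R x) * wave x \<xi>) = 0"
        using zero[of \<xi> s] s by (cases "a \<xi> = 0") (auto simp: mult_ac)
    qed
    finally show ?thesis by simp
  qed
  \<comment> \<open>The shift by 2 keeps every \<open>s n\<close> strictly below
    \<open>s0\<close>.\<close>
  define s where "s n = s0 / real (n + 2)" for n
  have s: "0 < s n" "s n < s0" for n using s0 by (auto simp: s_def field_simps add_pos_nonneg)
  have "s \<longlonglongrightarrow> 0"
    unfolding s_def[abs_def] by (rule LIMSEQ_ignore_initial_segment[OF lim_const_over_n])
  have "(\<lambda>n. LINT x|lborel. f x * bump_kernel (s n *\<^sub>R x) * ?A x) \<longlonglongrightarrow> (LINT x|lborel. f x * ?A x)"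
  proof (rule integral_dominated_convergence[where w="\<lambda>x. C * K * norm (?A x)"])
    show "integrable lborel (\<lambda>x. C * K * norm (?A x))" using A by auto
    show "AE x in lborel. (\<lambda>n. f x * bump_kernel (s n *\<^sub>R x) * ?A x) \<longlonglongrightarrow> f x * ?A x"
    proof (rule AE_I2)
      fix x :: "real^'d"
      have "(\<lambda>n. s n *\<^sub>R x) \<longlonglongrightarrow> 0 *\<^sub>R x" using \<open>s \<longlonglongrightarrow> 0\<close> by (intro tendsto_intros)
      then have "(\<lambda>n. bump_kernel (s n *\<^sub>R x)) \<longlonglongrightarrow> bump_kernel (0 *\<^sub>R x)"
        by (rule continuous_on_tendsto_compose[OF continuous_bump_kernel[of UNIV]]) auto
      then have "(\<lambda>n. f x * bump_kernel (s n *\<^sub>R x) * ?A x) \<longlonglongrightarrow> f x * bump_kernel (0 *\<^sub>R x) * ?A x"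
        by (intro tendsto_mult tendsto_const)
      then show "(\<lambda>n. f x * bump_kernel (s n *\<^sub>R x) * ?A x) \<longlonglongrightarrow> f x * ?A x" by simp
    qed
    show "AE x in lborel. norm (f x * bump_kernel (s n *\<^sub>R x) * ?A x) \<le> C * K * norm (?A x)" for n
    proof (rule AE_I2)
      fix x
      have "0 \<le> C" using C[of 0] norm_ge_zero order_trans by blast
      then show "norm (f x * bump_kernel (s n *\<^sub>R x) * ?A x) \<le> C * K * norm (?A x)"
        unfolding norm_mult using C K by (intro mult_right_mono mult_mono) auto
    qed
  qed measurable
  then have "(\<lambda>n. 0) \<longlonglongrightarrow> (LINT x|lborel. f x * ?A x)" using zs[OF s] by simp
  then show ?thesis by (simp add: LIMSEQ_const_iff)
qed

end

lemma borel_measurable_cnj [measurable (raw)]: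
  "f \<in> borel_measurable M \<Longrightarrow> (\<lambda>x. cnj (f x)) \<in> borel_measurable M"
  by (rule measurable_compose[OF _ borel_measurable_continuous_onI[OF continuous_on_cnj[OF continuous_on_id]]])

context bump
begin

text \<open>The inverse transform of the bump is explicit, so testing the distribution on it yields
  this integral times a power of \<open>s\<close>. The conjugate on \<open>f\<close> comes from the
  pairing, which conjugates its second argument.\<close>

lemma bump_annihilated:
  fixes f :: "real^'d \<Rightarrow> complex"
  assumes f: "continuous_on UNIV f" and s: "0 < s"
    and U: "\<And>\<theta>. \<theta> \<in> test_functions U \<Longrightarrow> fourier_dist (functional_of f) \<theta> = 0"
    and sub: "{\<zeta>. \<forall>i. \<xi> $ i \<le> \<zeta> $ i \<and> \<zeta> $ i \<le> \<xi> $ i + s} \<subseteq> U"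
  shows "(LINT x|lborel. cnj (f x) * wave x \<xi> * bump_kernel (s *\<^sub>R x)) = 0"
proof -
  have [measurable]: "f \<in> borel_measurable borel" by (rule borel_measurable_continuous_onI[OF f])
  have [measurable]: "bump_at \<xi> s \<in> borel_measurable borel" by (rule bump_at_measurable[OF s])
  have ift: "inv_fourier (bump_at \<xi> s) x = s ^ CARD('d) *\<^sub>R (wave x \<xi> * bump_kernel (s *\<^sub>R x))" for x
    unfolding inv_fourier_eq by (subst lebesgue_integral_lborel(1)) (auto simp: bump_at_ft[OF s])
  have "0 = functional_of f (inv_fourier (bump_at \<xi> s))"
    using U[OF bump_at_test_function[OF s sub]] by (simp add: fourier_dist_def)
  also have "\<dots> = (LINT x|lborel. s ^ CARD('d) *\<^sub>R (wave x \<xi> * bump_kernel (s *\<^sub>R x)) * cnj (f x))"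
    unfolding functional_of_def ift by (subst lebesgue_integral_lborel(1)) auto
  also have "\<dots> = (LINT x|lborel. s ^ CARD('d) *\<^sub>R (cnj (f x) * wave x \<xi> * bump_kernel (s *\<^sub>R x)))"
    by (simp add: mult_ac)
  also have "\<dots> = s ^ CARD('d) *\<^sub>R (LINT x|lborel. cnj (f x) * wave x \<xi> * bump_kernel (s *\<^sub>R x))"
    by simp
  finally show ?thesis using s by simp
qed

text \<open>Off its support the distribution is known to vanish only on each of many open sets, and
  passing to their union normally takes a partition of unity. Here \<open>superposition\<close> does
  the gluing: around each point of the large cube, sufficiently small bumps fit into a single open
  set, and integrating them with weight \<open>bump_at \<xi> t\<close> recovers the large bump in
  the limit.\<close>

lemma bump_annihilated_off_support:
  fixes f :: "real^'d \<Rightarrow> complex"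
  assumes f: "continuous_on UNIV f" and C: "\<And>x. norm (f x) \<le> C" and t: "0 < t"
    and disj: "{\<zeta>. \<forall>i. \<xi> $ i \<le> \<zeta> $ i \<and> \<zeta> $ i \<le> \<xi> $ i + t} \<inter> dist_supp (fourier_dist (functional_of f)) = {}"
  shows "(LINT x|lborel. cnj (f x) * wave x \<xi> * bump_kernel (t *\<^sub>R x)) = 0"
proof -
  have [measurable]: "f \<in> borel_measurable borel" by (rule borel_measurable_continuous_onI[OF f])
  define K where "K = {\<zeta>. \<forall>i. \<xi> $ i \<le> \<zeta> $ i \<and> \<zeta> $ i \<le> \<xi> $ i + t}"
  define \<U> where "\<U> = {U. open U \<and> (\<forall>\<theta>\<in>test_functions U. fourier_dist (functional_of f) \<theta> = 0)}"
  have "K = cbox \<xi> (\<chi> i. \<xi> $ i + t)" by (auto simp: K_def mem_box_cart)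
  then have "compact K" by (simp only: compact_cbox)
  moreover have "K \<subseteq> \<Union>\<U>" using disj by (auto simp: K_def \<U>_def dist_supp_def)
  moreover have "\<And>U. U \<in> \<U> \<Longrightarrow> open U" by (simp add: \<U>_def)
  \<comment> \<open>\<open>e\<close> is a Lebesgue number of the cover of \<open>K\<close>.\<close>
  ultimately obtain e where e: "0 < e" "\<And>\<zeta>. \<zeta> \<in> K \<Longrightarrow> \<exists>U\<in>\<U>. ball \<zeta> e \<subseteq> U"
    using Heine_Borel_lemma[of K \<U>] by metis
  have A: "(LINT \<zeta>|lborel. bump_at \<xi> t \<zeta> * wave x \<zeta>) =
      t ^ CARD('d) *\<^sub>R (wave x \<xi> * bump_kernel (t *\<^sub>R x))" for x :: "real^'d"
    by (rule bump_at_ft[OF t])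
  have "(LINT x|lborel. cnj (f x) * (LINT \<zeta>|lborel. bump_at \<xi> t \<zeta> * wave x \<zeta>)) = 0"
  proof (rule superposition)
    show "(\<lambda>x. cnj (f x)) \<in> borel_measurable borel" by measurable
    show "norm (cnj (f x)) \<le> C" for x using C by simp
    show "integrable lborel (bump_at \<xi> t)" by (rule bump_at_integrable[OF t])
    have "integrable lborel (\<lambda>x :: real^'d. bump_kernel (t *\<^sub>R x))"
      using lborel_integrable_affine_iff[of t "bump_kernel :: real^'d \<Rightarrow> complex" 0] t bump_kernel_integrable
      by simp
    then have "integrable lborel (\<lambda>x. wave x \<xi> * bump_kernel (t *\<^sub>R x))"
      by (rule integrable_mult_bounded(2)[where C=1]) auto
    then show "integrable lborel (\<lambda>x. LINT \<zeta>|lborel. bump_at \<xi> t \<zeta> * wave x \<zeta>)"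
      unfolding A by (rule integrable_scaleR_right)
    \<comment> \<open>Every point of a cube of side \<open>s\<close> is within \<open>s\<close>
      times the dimension of its corner, so this bound puts the small cube into the ball of radius
      \<open>e\<close>.\<close>
    show "0 < e / real CARD('d)" using e by simp
    fix \<zeta> s assume \<zeta>: "bump_at \<xi> t \<zeta> \<noteq> 0" and s: "0 < s" "s < e / real CARD('d)"
    have "\<zeta> \<in> K" using bump_at_support[OF t \<zeta>] by (simp add: K_def)
    then obtain U where U: "U \<in> \<U>" "ball \<zeta> e \<subseteq> U" using e by blast
    have "{z. \<forall>i. \<zeta> $ i \<le> z $ i \<and> z $ i \<le> \<zeta> $ i + s} \<subseteq> ball \<zeta> e"
    proof
      fix z assume z: "z \<in> {z. \<forall>i. \<zeta> $ i \<le> z $ i \<and> z $ i \<le> \<zeta> $ i + s}"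
      have "norm (\<zeta> - z) \<le> (\<Sum>i\<in>UNIV. \<bar>(\<zeta> - z) $ i\<bar>)" by (rule norm_le_l1_cart)
      also have "\<dots> \<le> (\<Sum>i\<in>(UNIV :: 'd set). s)" using z by (intro sum_mono) (auto simp: abs_le_iff algebra_simps)
      also have "\<dots> < e" using s by (simp add: field_simps)
      finally show "z \<in> ball \<zeta> e" by (simp add: dist_norm)
    qed
    with U have "{z. \<forall>i. \<zeta> $ i \<le> z $ i \<and> z $ i \<le> \<zeta> $ i + s} \<subseteq> U" by blast
    then show "(LINT x|lborel. cnj (f x) * wave x \<zeta> * bump_kernel (s *\<^sub>R x)) = 0"
      using U by (intro bump_annihilated[OF f s(1)]) (auto simp: \<U>_def)
  qed
  then have "t ^ CARD('d) *\<^sub>R (LINT x|lborel. cnj (f x) * wave x \<xi> * bump_kernel (t *\<^sub>R x)) = 0"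
    unfolding A by (simp add: mult.assoc)
  then show ?thesis using t by simp
qed

text \<open>The measure of the overview is \<open>H\<close> minus the point mass at
  \<open>x0\<close>. As \<open>L'\<close> inverts \<open>L\<close>, the assumption \<open>Hx\<close>
  speaks of the open parallelepiped and \<open>supp\<close> of the closed one. A single \<epsilon>
  drives both the contraction by 1 - \<epsilon> and the width of the Gaussian, so one limit undoes
  both.\<close>

lemma spectral_synthesis:
  fixes f H :: "real^'d \<Rightarrow> complex" and L L' :: "real^'d^'d"
  assumes f: "continuous_on UNIV f" and C: "\<And>x. norm (f x) \<le> C"
    and supp: "dist_supp (fourier_dist (functional_of f)) \<subseteq> (*v) L ` unit_cube"
    and L: "\<And>v. L' *v (L *v v) = v"
    and H: "integrable lborel H"
    and Hx: "\<And>\<xi>. (\<forall>i. \<bar>(L' *v \<xi>) $ i\<bar> < 1/2) \<Longrightarrow> (LINT y|lborel. H y * wave y (- \<xi>)) = wave x0 (- \<xi>)"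
  shows "(LINT y|lborel. H y * cnj (f y)) = cnj (f x0)"
proof -
  have [measurable]: "f \<in> borel_measurable borel" by (rule borel_measurable_continuous_onI[OF f])
  have [measurable]: "H \<in> borel_measurable borel" using H by auto
  let ?F = "\<lambda>x. cnj (f x)"
  \<comment> \<open>The mean of \<open>cnj f\<close> around \<open>p\<close> at Gaussian scale
    \<epsilon>. In \<open>eq\<close> below, contracting the measure shows up as contracting the
    centre of the mean.\<close>
  let ?W = "\<lambda>p \<epsilon>. LINT v|lborel. ?F (p + \<epsilon> *\<^sub>R v) * gauss v"
  have eq: "(LINT y|lborel. H y * ?W ((1 - \<epsilon>) *\<^sub>R y) \<epsilon>) = ?W ((1 - \<epsilon>) *\<^sub>R x0) \<epsilon>"
    if \<epsilon>: "0 < \<epsilon>" "\<epsilon> < 1" for \<epsilon> :: real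
  proof -
    define r where "r = 1 - \<epsilon>"
    have r: "0 < r" "r < 1" using \<epsilon> by (auto simp: r_def)
    \<comment> \<open>The transform of the contracted measure. It is bounded but need not be
      integrable, hence the Gaussian factor in \<open>a\<close>.\<close>
    define \<mu> where "\<mu> \<xi> = (LINT y|lborel. H y * wave y (- (r *\<^sub>R \<xi>))) - wave x0 (- (r *\<^sub>R \<xi>))" for \<xi>
    define a where "a \<xi> = gauss (\<epsilon> *\<^sub>R \<xi>) * \<mu> \<xi>" for \<xi>
    define E where "E = \<epsilon> ^ CARD('d)"
    have E: "0 < E" using \<epsilon> by (simp add: E_def)
    have G: "integrable lborel (\<lambda>\<xi> :: real^'d. gauss (\<epsilon> *\<^sub>R \<xi>))" by (rule gauss_scaled_integrable[OF \<epsilon>(1)])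
    have \<mu>_cont: "continuous_on UNIV \<mu>"
      unfolding \<mu>_def
      by (intro continuous_intros continuous_on_integral_kernel[OF H, where C=1]) auto
    have [measurable]: "\<mu> \<in> borel_measurable borel" by (rule borel_measurable_continuous_onI[OF \<mu>_cont])
    have \<mu>_bound: "norm (\<mu> \<xi>) \<le> (LINT y|lborel. norm (H y)) + 1" for \<xi>
      unfolding \<mu>_def
      by (rule order_trans[OF norm_triangle_ineq4], rule add_mono, rule order_trans[OF integral_norm_bound])
        (simp_all add: norm_mult)
    have a: "integrable lborel a"
      unfolding a_def by (rule integrable_mult_bounded(1)[OF G _ \<mu>_bound]) measurable
    have wavey: "wave y (- (r *\<^sub>R \<xi>)) * wave x \<xi> = wave (x - r *\<^sub>R y) \<xi>" for x y \<xi> :: "real^'d"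
      by (simp add: wave_diff wave_minus wave_scaleR mult.commute)
    have G\<mu>: "integrable lborel (\<lambda>\<xi> :: real^'d. gauss (\<epsilon> *\<^sub>R \<xi>) * g \<xi>)"
      if "g \<in> borel_measurable borel" "\<And>\<xi>. norm (g \<xi>) \<le> c" for g c
      using integrable_mult_bounded(1)[OF G _ that(2)] that(1) by simp
    have Gw: "E *\<^sub>R (LINT \<xi>|lborel. gauss (\<epsilon> *\<^sub>R \<xi>) * wave u \<xi>) = gauss (u /\<^sub>R \<epsilon>)" for u :: "real^'d"
      unfolding E_def by (rule gauss_scaled_ft[OF \<epsilon>(1)])
    \<comment> \<open>Inverting \<open>a\<close> returns the contracted measure smoothed by a
      Gaussian of width \<epsilon>; \<open>E\<close> is the normalizing power of \<epsilon>.\<close>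
    have A: "E *\<^sub>R (LINT \<xi>|lborel. a \<xi> * wave x \<xi>) =
        (LINT y|lborel. H y * gauss ((x - r *\<^sub>R y) /\<^sub>R \<epsilon>)) - gauss ((x - r *\<^sub>R x0) /\<^sub>R \<epsilon>)" for x
    proof -
      have m: "(\<lambda>\<xi>. LINT y|lborel. H y * wave (x - r *\<^sub>R y) \<xi>) \<in> borel_measurable borel"
        by (intro borel_measurable_continuous_onI continuous_on_integral_kernel[OF H, where C=1] continuous_intros) auto
      have b: "norm (LINT y|lborel. H y * wave (x - r *\<^sub>R y) \<xi>) \<le> (LINT y|lborel. norm (H y))" for \<xi>
        by (rule order_trans[OF integral_norm_bound]) (simp add: norm_mult)
      have "(LINT \<xi>|lborel. a \<xi> * wave x \<xi>) =
          (LINT \<xi>|lborel. gauss (\<epsilon> *\<^sub>R \<xi>) * (LINT y|lborel. H y * wave (x - r *\<^sub>R y) \<xi>)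
            - gauss (\<epsilon> *\<^sub>R \<xi>) * wave (x - r *\<^sub>R x0) \<xi>)"
      proof (rule Bochner_Integration.integral_cong[OF refl])
        fix \<xi>
        have "(LINT y|lborel. H y * wave y (- (r *\<^sub>R \<xi>))) * wave x \<xi> =
            (LINT y|lborel. H y * wave y (- (r *\<^sub>R \<xi>)) * wave x \<xi>)" by simp
        also have "\<dots> = (LINT y|lborel. H y * wave (x - r *\<^sub>R y) \<xi>)"
          unfolding mult.assoc wavey ..
        finally show "a \<xi> * wave x \<xi> = gauss (\<epsilon> *\<^sub>R \<xi>) * (LINT y|lborel. H y * wave (x - r *\<^sub>R y) \<xi>)
            - gauss (\<epsilon> *\<^sub>R \<xi>) * wave (x - r *\<^sub>R x0) \<xi>"
          by (simp add: a_def \<mu>_def wavey mult.assoc left_diff_distrib right_diff_distrib)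
      qed
      also have "\<dots> = (LINT \<xi>|lborel. gauss (\<epsilon> *\<^sub>R \<xi>) * (LINT y|lborel. H y * wave (x - r *\<^sub>R y) \<xi>))
            - (LINT \<xi>|lborel. gauss (\<epsilon> *\<^sub>R \<xi>) * wave (x - r *\<^sub>R x0) \<xi>)"
        by (intro Bochner_Integration.integral_diff G\<mu>[OF m b] G\<mu>[of "\<lambda>\<xi>. wave (x - r *\<^sub>R x0) \<xi>" 1]) auto
      also have "(LINT \<xi>|lborel. gauss (\<epsilon> *\<^sub>R \<xi>) * (LINT y|lborel. H y * wave (x - r *\<^sub>R y) \<xi>)) =
          (LINT y|lborel. H y * (LINT \<xi>|lborel. gauss (\<epsilon> *\<^sub>R \<xi>) * wave (x - r *\<^sub>R y) \<xi>))"
        by (rule Fubini_bounded_kernel(2)[OF G H, where C=1]) auto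
      finally have *: "(LINT \<xi>|lborel. a \<xi> * wave x \<xi>) =
          (LINT y|lborel. H y * (LINT \<xi>|lborel. gauss (\<epsilon> *\<^sub>R \<xi>) * wave (x - r *\<^sub>R y) \<xi>))
           - (LINT \<xi>|lborel. gauss (\<epsilon> *\<^sub>R \<xi>) * wave (x - r *\<^sub>R x0) \<xi>)" .
      have "E *\<^sub>R (LINT y|lborel. H y * (LINT \<xi>|lborel. gauss (\<epsilon> *\<^sub>R \<xi>) * wave (x - r *\<^sub>R y) \<xi>)) =
          (LINT y|lborel. E *\<^sub>R (H y * (LINT \<xi>|lborel. gauss (\<epsilon> *\<^sub>R \<xi>) * wave (x - r *\<^sub>R y) \<xi>)))"
        by simp
      also have "\<dots> = (LINT y|lborel. H y * gauss ((x - r *\<^sub>R y) /\<^sub>R \<epsilon>))"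
        by (simp only: mult_scaleR_right[symmetric] Gw)
      finally show ?thesis unfolding * scaleR_diff_right Gw by simp
    qed
    \<comment> \<open>Here \<open>g\<close> is only bounded, so integrability in \<open>x\<close>
      must come from the Gaussian: its integral over \<open>x\<close> does not depend on the centre,
      and \<open>H\<close> takes care of \<open>y\<close>.\<close>
    have HG: "integrable (lborel \<Otimes>\<^sub>M lborel) (\<lambda>(y, x). H y * gauss ((x - r *\<^sub>R y) /\<^sub>R \<epsilon>) * g x)"
      if g [measurable]: "g \<in> borel_measurable borel" "\<And>x. norm (g x) \<le> c" for g :: "real^'d \<Rightarrow> complex" and c
    proof -
      have gi: "integrable lborel (\<lambda>x. gauss ((x - p) /\<^sub>R \<epsilon>))" for p :: "real^'d"
        using lborel_integrable_affine_iff[of "1 / \<epsilon>" gauss "- (p /\<^sub>R \<epsilon>)"] \<epsilon> gauss_integrable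
        by (simp add: scaleR_diff_right inverse_eq_divide)
      have norm_eq: "(LINT x|lborel. norm (gauss ((x - p) /\<^sub>R \<epsilon>))) = (LINT x|lborel. norm (gauss ((x :: real^'d) /\<^sub>R \<epsilon>)))" for p :: "real^'d"
      proof -
        have "(LINT x|lborel. norm (gauss ((x - p) /\<^sub>R \<epsilon>))) =
          \<bar>1\<bar> ^ DIM(real^'d) *\<^sub>R (LINT x|lborel. norm (gauss ((p + 1 *\<^sub>R x - p) /\<^sub>R \<epsilon>)))"
          by (rule lborel_integral_affine) auto
        then show ?thesis by simp
      qed
      show ?thesis
      proof (rule Bochner_Integration.integrable_bound)
        show "integrable (lborel \<Otimes>\<^sub>M lborel) (\<lambda>(y, x). H y * gauss ((x - r *\<^sub>R y) /\<^sub>R \<epsilon>) * complex_of_real c)"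
        proof (rule lborel_pair.Fubini_integrable)
          show "integrable lborel (\<lambda>y. LINT x|lborel. norm (case (y, x) of (y, x) \<Rightarrow>
              H y * gauss ((x - r *\<^sub>R y) /\<^sub>R \<epsilon>) * complex_of_real c))"
            using H by (simp add: norm_mult norm_eq)
          show "AE y in lborel. integrable lborel (\<lambda>x. case (y, x) of (y, x) \<Rightarrow>
              H y * gauss ((x - r *\<^sub>R y) /\<^sub>R \<epsilon>) * complex_of_real c)"
            using gi by (intro AE_I2) auto
        qed measurable
        show "AE z in lborel \<Otimes>\<^sub>M lborel. norm (case z of (y, x) \<Rightarrow> H y * gauss ((x - r *\<^sub>R y) /\<^sub>R \<epsilon>) * g x) \<le>
           norm (case z of (y, x) \<Rightarrow> H y * gauss ((x - r *\<^sub>R y) /\<^sub>R \<epsilon>) * complex_of_real c)"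
        proof (rule AE_I2)
          fix z :: "(real^'d) \<times> (real^'d)"
          obtain y x where z: "z = (y, x)" by (cases z)
          show "norm (case z of (y, x) \<Rightarrow> H y * gauss ((x - r *\<^sub>R y) /\<^sub>R \<epsilon>) * g x) \<le>
             norm (case z of (y, x) \<Rightarrow> H y * gauss ((x - r *\<^sub>R y) /\<^sub>R \<epsilon>) * complex_of_real c)"
            using g(2)[of x] by (auto simp: z norm_mult intro!: mult_left_mono)
        qed
      qed measurable
    qed
    have gi0: "integrable lborel (\<lambda>x. gauss ((x - r *\<^sub>R x0) /\<^sub>R \<epsilon>))"
      using lborel_integrable_affine_iff[of "1 / \<epsilon>" gauss "- ((r *\<^sub>R x0) /\<^sub>R \<epsilon>)"] \<epsilon> gauss_integrable
      by (simp add: scaleR_diff_right inverse_eq_divide)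
    have HG1: "integrable lborel (\<lambda>x. LINT y|lborel. H y * gauss ((x - r *\<^sub>R y) /\<^sub>R \<epsilon>))"
      using lborel_pair.integrable_snd[OF HG[of "\<lambda>_. 1" 1]] by simp
    have "integrable lborel (\<lambda>x. (1 / E) *\<^sub>R (E *\<^sub>R (LINT \<xi>|lborel. a \<xi> * wave x \<xi>)))"
      unfolding A by (intro integrable_scaleR_right Bochner_Integration.integrable_diff HG1 gi0)
    then have A_int: "integrable lborel (\<lambda>x. LINT \<xi>|lborel. a \<xi> * wave x \<xi>)"
      using E by simp
    obtain B where B: "0 < B" "\<And>v. norm (L' *v v) \<le> norm v * B"
      using bounded_linear.pos_bounded[OF matrix_vector_mul_bounded_linear[of L']] by blast
    \<comment> \<open>Where \<open>a\<close> is nonzero, some coordinate of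
      \<open>L' *v \<xi>\<close> has modulus at least 1 / (2 r), while on the spectrum it is at most
      1/2. Moving \<xi> inside a cube of side below \<open>s0\<close> changes that coordinate by
      less than the difference: \<open>B\<close> bounds the norm of \<open>L'\<close>, and the
      dimension accounts for passing from coordinates to the norm.\<close>
    define s0 where "s0 = (1 / r - 1) / (2 * B * real CARD('d))"
    have s0: "0 < s0" using r B by (simp add: s0_def field_simps)
    have "(LINT x|lborel. ?F x * (LINT \<xi>|lborel. a \<xi> * wave x \<xi>)) = 0"
    proof (rule superposition[OF _ _ a A_int s0])
      show "?F \<in> borel_measurable borel" by measurable
      show "norm (?F x) \<le> C" for x using C by simp
      fix \<xi> s assume \<xi>: "a \<xi> \<noteq> 0" and s: "0 < s" "s < s0"
      have "\<mu> \<xi> \<noteq> 0" using \<xi> by (auto simp: a_def)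
      then have "\<not> (\<forall>i. \<bar>(L' *v (r *\<^sub>R \<xi>)) $ i\<bar> < 1/2)"
        using Hx[of "r *\<^sub>R \<xi>"] by (auto simp: \<mu>_def)
      then obtain i where "1/2 \<le> \<bar>(L' *v (r *\<^sub>R \<xi>)) $ i\<bar>" by (auto simp: not_less)
      then have i: "1 / (2 * r) \<le> \<bar>(L' *v \<xi>) $ i\<bar>"
        using r by (simp add: scalar_mult_eq_scaleR matrix_vector_mult_scaleR abs_mult field_simps)
      show "(LINT x|lborel. ?F x * wave x \<xi> * bump_kernel (s *\<^sub>R x)) = 0"
      proof (rule bump_annihilated_off_support[OF f C s(1)])
        have "\<zeta> \<notin> (*v) L ` unit_cube" if \<zeta>: "\<forall>i. \<xi> $ i \<le> \<zeta> $ i \<and> \<zeta> $ i \<le> \<xi> $ i + s" for \<zeta>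
        proof
          assume "\<zeta> \<in> (*v) L ` unit_cube"
          then obtain v where "v \<in> unit_cube" "\<zeta> = L *v v" by auto
          then have le: "\<bar>(L' *v \<zeta>) $ i\<bar> \<le> 1/2" using L by (auto simp: unit_cube_def)
          have "norm (\<xi> - \<zeta>) \<le> (\<Sum>i\<in>UNIV. \<bar>(\<xi> - \<zeta>) $ i\<bar>)" by (rule norm_le_l1_cart)
          also have "\<dots> \<le> (\<Sum>i\<in>(UNIV :: 'd set). s)" using \<zeta> by (intro sum_mono) (auto simp: abs_le_iff algebra_simps)
          also have "\<dots> < real CARD('d) * s0" using s by simp
          finally have "norm (\<xi> - \<zeta>) * B < real CARD('d) * s0 * B" using B by simp
          also have "\<dots> = (1 / r - 1) / 2" using B by (simp add: s0_def field_simps)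
          finally have "norm (L' *v (\<xi> - \<zeta>)) < (1 / r - 1) / 2" using B(2)[of "\<xi> - \<zeta>"] by linarith
          moreover have "\<bar>(L' *v (\<xi> - \<zeta>)) $ i\<bar> \<le> norm (L' *v (\<xi> - \<zeta>))" by (rule component_le_norm_cart)
          ultimately have "\<bar>(L' *v \<xi>) $ i - (L' *v \<zeta>) $ i\<bar> < (1 / r - 1) / 2"
            by (simp add: matrix_vector_mult_diff_distrib)
          moreover have "(1 / r - 1) / 2 = 1 / (2 * r) - 1 / 2" by (simp add: field_simps)
          ultimately show False using le i by linarith
        qed
        then show "{\<zeta>. \<forall>i. \<xi> $ i \<le> \<zeta> $ i \<and> \<zeta> $ i \<le> \<xi> $ i + s} \<inter> dist_supp (fourier_dist (functional_of f)) = {}"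
          using supp by blast
      qed
    qed
    then have "0 = E *\<^sub>R (LINT x|lborel. ?F x * (LINT \<xi>|lborel. a \<xi> * wave x \<xi>))" by simp
    also have "\<dots> = (LINT x|lborel. ?F x * (E *\<^sub>R (LINT \<xi>|lborel. a \<xi> * wave x \<xi>)))"
      by simp
    also have "\<dots> = (LINT x|lborel. ?F x * (LINT y|lborel. H y * gauss ((x - r *\<^sub>R y) /\<^sub>R \<epsilon>))
        - ?F x * gauss ((x - r *\<^sub>R x0) /\<^sub>R \<epsilon>))"
      unfolding A by (simp add: right_diff_distrib)
    also have "\<dots> = (LINT x|lborel. ?F x * (LINT y|lborel. H y * gauss ((x - r *\<^sub>R y) /\<^sub>R \<epsilon>)))
        - (LINT x|lborel. ?F x * gauss ((x - r *\<^sub>R x0) /\<^sub>R \<epsilon>))"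
      by (intro Bochner_Integration.integral_diff integrable_mult_bounded(2)[OF HG1, where C=C]
          integrable_mult_bounded(2)[OF gi0, where C=C]) (auto simp: C)
    also have "(LINT x|lborel. ?F x * gauss ((x - r *\<^sub>R x0) /\<^sub>R \<epsilon>)) = E *\<^sub>R ?W (r *\<^sub>R x0) \<epsilon>"
      unfolding E_def by (rule gauss_mean_eq) (use \<epsilon> in auto)
    also have "(LINT x|lborel. ?F x * (LINT y|lborel. H y * gauss ((x - r *\<^sub>R y) /\<^sub>R \<epsilon>))) =
        (LINT x|lborel. (LINT y|lborel. H y * gauss ((x - r *\<^sub>R y) /\<^sub>R \<epsilon>) * ?F x))"
      by (subst integral_mult_left_zero) (simp add: mult.commute)
    also have "\<dots> = (LINT y|lborel. (LINT x|lborel. H y * gauss ((x - r *\<^sub>R y) /\<^sub>R \<epsilon>) * ?F x))"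
      by (rule lborel_pair.Fubini_integral[OF HG[of ?F C]]) (auto simp: C)
    also have "\<dots> = (LINT y|lborel. H y * (E *\<^sub>R ?W (r *\<^sub>R y) \<epsilon>))"
    proof (rule Bochner_Integration.integral_cong[OF refl])
      fix y
      have "(LINT x|lborel. H y * gauss ((x - r *\<^sub>R y) /\<^sub>R \<epsilon>) * ?F x) =
          H y * (LINT x|lborel. ?F x * gauss ((x - r *\<^sub>R y) /\<^sub>R \<epsilon>))"
        by (simp add: mult.assoc mult.commute[of "gauss _"])
      also have "(LINT x|lborel. ?F x * gauss ((x - r *\<^sub>R y) /\<^sub>R \<epsilon>)) = E *\<^sub>R ?W (r *\<^sub>R y) \<epsilon>"
        unfolding E_def by (rule gauss_mean_eq) (use \<epsilon> in auto)
      finally show "(LINT x|lborel. H y * gauss ((x - r *\<^sub>R y) /\<^sub>R \<epsilon>) * ?F x) = H y * (E *\<^sub>R ?W (r *\<^sub>R y) \<epsilon>)" .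
    qed
    also have "\<dots> = E *\<^sub>R (LINT y|lborel. H y * ?W (r *\<^sub>R y) \<epsilon>)" by simp
    finally have "E *\<^sub>R ((LINT y|lborel. H y * ?W (r *\<^sub>R y) \<epsilon>) - ?W (r *\<^sub>R x0) \<epsilon>) = 0"
      by (simp add: scaleR_diff_right)
    then show ?thesis using E by (simp add: r_def)
  qed
  define \<epsilon> where "\<epsilon> n = 1 / real (n + 2)" for n
  have \<epsilon>: "0 < \<epsilon> n" "\<epsilon> n < 1" for n by (auto simp: \<epsilon>_def field_simps)
  have \<epsilon>0: "\<epsilon> \<longlonglongrightarrow> 0"
    unfolding \<epsilon>_def[abs_def] by (rule LIMSEQ_ignore_initial_segment[OF lim_const_over_n])
  have W: "(\<lambda>n. ?W ((1 - \<epsilon> n) *\<^sub>R y) (\<epsilon> n)) \<longlonglongrightarrow> ?F y" for y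
  proof (rule gauss_mean_tendsto[OF _ _ _ _ \<epsilon>0])
    show "?F \<in> borel_measurable borel" by measurable
    show "norm (?F x) \<le> C" for x using C by simp
    show "isCont ?F y" using f by (auto simp: continuous_on_eq_continuous_at)
    have "(\<lambda>n. (1 - \<epsilon> n) *\<^sub>R y) \<longlonglongrightarrow> (1 - 0) *\<^sub>R y" by (intro tendsto_intros \<epsilon>0)
    then show "(\<lambda>n. (1 - \<epsilon> n) *\<^sub>R y) \<longlonglongrightarrow> y" by simp
  qed
  have "(\<lambda>n. LINT y|lborel. H y * ?W ((1 - \<epsilon> n) *\<^sub>R y) (\<epsilon> n)) \<longlonglongrightarrow> (LINT y|lborel. H y * ?F y)"
  proof (rule integral_dominated_convergence[where w="\<lambda>y. norm (H y) * C"])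
    show "integrable lborel (\<lambda>y. norm (H y) * C)" using H by auto
    show "AE y in lborel. (\<lambda>n. H y * ?W ((1 - \<epsilon> n) *\<^sub>R y) (\<epsilon> n)) \<longlonglongrightarrow> H y * ?F y"
      by (intro AE_I2 tendsto_intros W)
    show "AE y in lborel. norm (H y * ?W ((1 - \<epsilon> n) *\<^sub>R y) (\<epsilon> n)) \<le> norm (H y) * C" for n
      unfolding norm_mult by (intro AE_I2 mult_left_mono gauss_mean_bound) (auto simp: C)
  qed measurable
  then have "(\<lambda>n. ?W ((1 - \<epsilon> n) *\<^sub>R x0) (\<epsilon> n)) \<longlonglongrightarrow> (LINT y|lborel. H y * ?F y)"
    by (simp only: eq[OF \<epsilon>])
  then show ?thesis using W[of x0] by (rule LIMSEQ_unique)
qed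

end

section \<open>Fourier series\<close>

lemma int_lattice_add: "k \<in> int_lattice \<Longrightarrow> l \<in> int_lattice \<Longrightarrow> k + l \<in> int_lattice"
  by (simp add: int_lattice_def)

lemma int_lattice_diff: "k \<in> int_lattice \<Longrightarrow> l \<in> int_lattice \<Longrightarrow> k - l \<in> int_lattice"
  by (simp add: int_lattice_def)

lemma int_lattice_minus: "k \<in> int_lattice \<Longrightarrow> - k \<in> int_lattice"
  by (simp add: int_lattice_def)

lemma int_lattice_0 [simp]: "0 \<in> int_lattice"
  by (simp add: int_lattice_def)

lemma axis_in_int_lattice: "axis i 1 \<in> int_lattice"
  by (simp add: int_lattice_def axis_def)

lemma countable_int_lattice: "countable (int_lattice :: (real^'d) set)"
proof -
  have "int_lattice \<subseteq> vec_lambda ` (PiE (UNIV :: 'd set) (\<lambda>_. \<int> :: real set))"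
  proof
    fix k :: "real^'d" assume "k \<in> int_lattice"
    then have "vec_nth k \<in> PiE UNIV (\<lambda>_. \<int>)" by (auto simp: int_lattice_def)
    then show "k \<in> vec_lambda ` (PiE UNIV (\<lambda>_. \<int>))"
      by (intro image_eqI[where x="vec_nth k"]) (simp_all add: vec_lambda_eta)
  qed
  moreover have "countable (\<int> :: real set)"
    unfolding Ints_def by simp
  then have "countable (vec_lambda ` (PiE (UNIV :: 'd set) (\<lambda>_. \<int> :: real set)))"
    by (intro countable_image countable_PiE) auto
  ultimately show ?thesis
    by (rule countable_subset)
qed

lemma infinite_int_lattice: "infinite (int_lattice :: (real^'d) set)"
proof
  assume fin: "finite (int_lattice :: (real^'d) set)"
  let ?g = "\<lambda>n::nat. (\<chi> i. real n) :: real^'d"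
  have "inj ?g" by (auto simp: inj_on_def vec_eq_iff)
  moreover have "range ?g \<subseteq> int_lattice" by (auto simp: int_lattice_def)
  ultimately show False using fin finite_subset finite_imageD by blast
qed

lemma int_lattice_enumeration:
  obtains e :: "nat \<Rightarrow> real^'d" where "bij_betw e UNIV int_lattice"
  using bij_betw_from_nat_into[OF countable_int_lattice infinite_int_lattice] by blast

lemma wave_lattice:
  assumes "k \<in> int_lattice" "m \<in> int_lattice"
  shows "wave k m = 1"
proof -
  have "k \<bullet> m \<in> \<int>"
    using assms by (auto simp: inner_vec_def int_lattice_def intro!: Ints_sum Ints_mult)
  then show ?thesis by (simp add: wave_def cis_multiple_2pi)
qed

text \<open>Half-open, so that the lattice translates tile the space exactly and not just up to null
  sets.\<close>

definition cell :: "(real^'d) set" where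
  "cell = {x. \<forall>i. - 1/2 \<le> x $ i \<and> x $ i < 1/2}"

lemma cell_unique_translate: "\<exists>!k. k \<in> int_lattice \<and> x - k \<in> cell"
proof -
  have *: "- 1/2 \<le> t - of_int n \<and> t - of_int n < 1/2 \<longleftrightarrow> n = \<lfloor>t + 1/2\<rfloor>" for t :: real and n
    by linarith
  define k :: "real^'a" where "k = (\<chi> i. of_int \<lfloor>x $ i + 1/2\<rfloor>)"
  show ?thesis
  proof (rule ex1I[of _ k])
    show "k \<in> int_lattice \<and> x - k \<in> cell"
      using * by (auto simp: k_def int_lattice_def cell_def)
    fix l assume l: "l \<in> int_lattice \<and> x - l \<in> cell"
    show "l = k"
    proof (subst vec_eq_iff, rule allI)
      fix i
      obtain n where n: "l $ i = of_int n"
        using l by (auto simp: int_lattice_def elim: Ints_cases)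
      have "- 1/2 \<le> x $ i - of_int n \<and> x $ i - of_int n < 1/2"
        using l unfolding n[symmetric] by (auto simp: cell_def)
      then show "l $ i = k $ i" using * n by (simp add: k_def)
    qed
  qed
qed

lemma cell_indicator_prod:
  "(indicator cell x :: complex) = (\<Prod>i\<in>UNIV. indicator {-1/2..<1/2} (x $ i))"
proof (cases "x \<in> cell")
  case True
  then show ?thesis by (auto simp: cell_def)
next
  case False
  then obtain i where "x $ i \<notin> {-1/2..<1/2}" by (auto simp: cell_def)
  then have "(\<Prod>i\<in>UNIV. indicator {-1/2..<1/2} (x $ i) :: complex) = 0"
    by (intro prod_zero bexI[of _ i]) (auto simp del: atLeastLessThan_iff)
  then show ?thesis using False by simp
qed

lemma
  fixes a b :: real
  shows indicator_interval_integrable: "integrable lborel (indicator {a..<b} :: real \<Rightarrow> complex)"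
    and indicator_interval_integral: "a \<le> b \<Longrightarrow> (LINT t|lborel. indicator {a..<b} t :: complex) = complex_of_real (b - a)"
proof -
  have eq: "(indicator {a..<b} :: real \<Rightarrow> complex) = (\<lambda>t. complex_of_real (indicator {a..<b} t))"
    by (auto simp: fun_eq_iff indicator_def)
  show "integrable lborel (indicator {a..<b} :: real \<Rightarrow> complex)"
    unfolding eq by (cases "a \<le> b") auto
  show "a \<le> b \<Longrightarrow> (LINT t|lborel. indicator {a..<b} t :: complex) = complex_of_real (b - a)"
    unfolding eq integral_complex_of_real by simp
qed

lemma cell_integrable: "integrable lborel (indicator cell :: real^'d \<Rightarrow> complex)"
proof -
  have "integrable lborel (\<lambda>x::real^'d. \<Prod>i\<in>UNIV. indicator {-1/2..<1/2} (x $ i) :: complex)"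
    by (rule integrable_prod_cart[OF indicator_interval_integrable])
  then show ?thesis
    by (simp only: cell_indicator_prod[symmetric] flip: cell_indicator_prod)
qed

lemma cell_measurable [measurable]: "cell \<in> sets borel"
proof -
  have "cell = (\<Inter>i. {x::real^'a. - 1/2 \<le> x $ i} \<inter> {x. x $ i < 1/2})"
    by (auto simp: cell_def)
  moreover have "\<dots> \<in> sets borel"
    by (intro sets.finite_INT sets.Int borel_open borel_closed closed_halfspace_component_ge_cart open_halfspace_component_lt_cart) auto
  ultimately show ?thesis by metis
qed

lemma cell_1d_integral:
  fixes m :: int
  shows "(LINT t|lborel. indicator {-1/2..<1/2} t * cis (2 * pi * (t * of_int m))) = (if m = 0 then 1 else 0)"
proof (cases "m = 0")
  case True
  then show ?thesis using indicator_interval_integral[of "-1/2" "1/2"] by simp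
next
  case False
  let ?c = "2 * pi * \<i> * of_int m"
  have c: "?c \<noteq> 0" using False by simp
  have "(\<integral>t. indicator {-1/2..1/2} t *\<^sub>R exp (?c * of_real t) \<partial>lborel) =
      exp (?c * of_real (1/2)) / ?c - exp (?c * of_real (-1/2)) / ?c"
  proof (rule integral_FTC_Icc)
    show "((\<lambda>t. exp (?c * of_real t) / ?c) has_vector_derivative exp (?c * of_real x)) (at x within {-1/2..1/2})" for x
    proof (rule has_vector_derivative_at_within)
      have "((\<lambda>z. exp (?c * z) / ?c) has_field_derivative exp (?c * of_real x)) (at (of_real x))"
        using c by (auto intro!: derivative_eq_intros)
      then show "((\<lambda>t. exp (?c * of_real t) / ?c) has_vector_derivative exp (?c * of_real x)) (at x)"
        by (rule has_vector_derivative_real_field)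
    qed
    show "continuous_on {- 1/2..1/2} (\<lambda>t. exp (?c * of_real t))" by (intro continuous_intros)
  qed simp
  also have "exp (?c * of_real (1/2)) = exp (?c * of_real (-1/2))"
  proof -
    have "exp (?c * of_real (1/2)) = exp (?c * of_real (-1/2)) * exp (2 * pi * \<i> * of_int m)"
      unfolding exp_add[symmetric] by (rule arg_cong[where f=exp]) (simp add: field_simps)
    also have "exp (2 * pi * \<i> * of_int m) = 1"
      by (simp add: exp_eq_1)
    finally show ?thesis by simp
  qed
  also have "(\<integral>t. indicator {-1/2..1/2} t *\<^sub>R exp (?c * of_real t) \<partial>lborel) =
      (LINT t|lborel. indicator {-1/2..<1/2} t * cis (2 * pi * (t * of_int m)))"
  proof (rule integral_cong_AE)
    show "AE t in lborel. indicator {-1/2..1/2} t *\<^sub>R exp (?c * of_real t) =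
        indicator {-1/2..<1/2} t * cis (2 * pi * (t * of_int m))"
      using AE_lborel_singleton[of "1/2"]
      by eventually_elim (auto simp: indicator_def cis_conv_exp mult_ac)
  qed (auto simp: cis_conv_exp)
  finally show ?thesis using False by simp
qed

lemma cell_orthogonality:
  fixes m :: "real^'d"
  assumes "m \<in> int_lattice"
  shows "(LINT z|lborel. indicator cell z * wave z m) = (if m = 0 then 1 else 0)"
proof -
  obtain n where n: "\<And>i. m $ i = of_int (n i)"
    using assms unfolding int_lattice_def mem_Collect_eq Ints_def image_iff by metis
  have "(LINT z|lborel. indicator cell z * wave z m) =
      (LINT z|lborel. (\<Prod>i\<in>UNIV. indicator {-1/2..<1/2} (z $ i) * cis (2 * pi * (z $ i * of_int (n i)))))"
    by (simp only: cell_indicator_prod wave_eq_prod prod.distrib n)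
  also have "\<dots> = (\<Prod>i\<in>UNIV. if n i = 0 then 1 else 0)"
  proof (subst integral_prod_cart)
    show "integrable lborel (\<lambda>t. indicator {-1/2..<1/2} t * cis (2 * pi * (t * of_int (n i))))" for i
      by (rule integrable_mult_bounded(1)[OF indicator_interval_integrable, where C=1]) (auto simp: cis_conv_exp)
  qed (simp only: cell_1d_integral of_int_eq_0_iff)
  also have "\<dots> = (if m = 0 then 1 else 0)"
    by (auto simp: vec_eq_iff n intro: prod_zero)
  finally show ?thesis .
qed

text \<open>If \<open>R y \<noteq> 0\<close>, multiply \<open>R\<close> by powers of the trigonometric polynomial
  \<open>\<Prod>i. (1 + cos (2 * pi * (z $ i - y $ i))) / 2\<close>, which concentrate at \<open>y\<close>.\<close>

lemma fourier_uniqueness_interior: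
  fixes R :: "real^'d \<Rightarrow> complex"
  assumes R: "continuous_on UNIV R" and C: "\<And>z. norm (R z) \<le> C"
    and zero: "\<And>m. m \<in> int_lattice \<Longrightarrow> (LINT z|lborel. indicator cell z * (R z * wave z m)) = 0"
    and y: "\<And>i. \<bar>y $ i\<bar> < 1/2"
  shows "R y = 0"
proof (rule ccontr)
  assume "R y \<noteq> 0"
  have R_meas [measurable]: "R \<in> borel_measurable borel" by (rule borel_measurable_continuous_onI[OF R])
  \<comment> \<open>One cosine factor, spelled out in characters of lattice frequency, so that
    multiplication by it only shifts \<open>m\<close>; \<open>v\<close> is the same factor in real
    form.\<close>
  define u :: "'d \<Rightarrow> real^'d \<Rightarrow> complex" where
    "u i z = 1/2 + (cnj (wave y (axis i 1)) / 4) * wave z (axis i 1)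
       + (wave y (axis i 1) / 4) * wave z (- axis i 1)" for i z
  define v where "v i z = (1 + cos (2 * pi * (z $ i - y $ i))) / 2" for i and z :: "real^'d"
  have uv: "u i z = complex_of_real (v i z)" for i z
  proof -
    have w: "wave z (axis i 1) = cis (2 * pi * z $ i)" for z :: "real^'d"
      by (simp add: wave_def inner_axis)
    have "u i z = 1/2 + (cis (2 * pi * (z $ i - y $ i)) + cis (- (2 * pi * (z $ i - y $ i)))) / 4"
      unfolding u_def wave_minus w
      by (simp add: cis_cnj cis_mult algebra_simps add_divide_distrib)
    also have "\<dots> = complex_of_real (v i z)"
    proof -
      have "1/2 + (cis \<theta> + cis (- \<theta>)) / 4 = complex_of_real ((1 + cos \<theta>) / 2)" for \<theta>
        by (simp add: complex_eq_iff add_divide_distrib)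
      then show ?thesis unfolding v_def .
    qed
    finally show ?thesis .
  qed
  have v01: "0 \<le> v i z" "v i z \<le> 1" for i z
    by (auto simp: v_def) (smt (verit) cos_ge_minus_one)
  have cu: "continuous_on UNIV (u i)" for i
    unfolding u_def by (intro continuous_intros)
  \<comment> \<open>The multipliers \<open>p\<close> for which \<open>R\<close> times
    \<open>p\<close> still has vanishing Fourier coefficients. All coefficients are kept, not only
    the one at 0, so that the property survives multiplication by the cosine factors.\<close>
  define Z where "Z p \<longleftrightarrow> continuous_on UNIV p \<and> (\<forall>z. norm (p z) \<le> 1) \<and>
    (\<forall>m\<in>int_lattice. (LINT z|lborel. indicator cell z * (R z * p z * wave z m)) = 0)"
    for p :: "real^'d \<Rightarrow> complex"
  have Zu: "Z (\<lambda>z. p z * u i z)" if "Z p" for p i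
  proof -
    have p: "continuous_on UNIV p" "\<And>z. norm (p z) \<le> 1"
      "\<And>m. m \<in> int_lattice \<Longrightarrow> (LINT z|lborel. indicator cell z * (R z * p z * wave z m)) = 0"
      using that by (auto simp: Z_def)
    have [measurable]: "p \<in> borel_measurable borel" by (rule borel_measurable_continuous_onI[OF p(1)])
    have I: "integrable lborel (\<lambda>z. indicator cell z * (R z * p z * wave z m))" for m
    proof (rule integrable_mult_bounded(1)[OF cell_integrable])
      fix z
      show "norm (R z * p z * wave z m) \<le> C"
        using mult_mono[OF C[of z] p(2)[of z]] C[of z] by (simp add: norm_mult order_trans[OF norm_ge_zero C])
    qed measurable
    have "(LINT z|lborel. indicator cell z * (R z * (p z * u i z) * wave z m)) = 0" if m: "m \<in> int_lattice" for m
    proof -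
      let ?a = "cnj (wave y (axis i 1)) / 4" and ?b = "wave y (axis i 1) / 4"
      let ?I = "\<lambda>m z. indicator cell z * (R z * p z * wave z m)"
      have "(LINT z|lborel. indicator cell z * (R z * (p z * u i z) * wave z m)) =
        (LINT z|lborel. (1/2) * ?I m z + ?a * ?I (m + axis i 1) z + ?b * ?I (m + - axis i 1) z)"
        by (rule Bochner_Integration.integral_cong[OF refl]) (simp only: u_def wave_add, simp add: algebra_simps)
      also have "\<dots> = (1/2) * (LINT z|lborel. ?I m z) + ?a * (LINT z|lborel. ?I (m + axis i 1) z) +
          ?b * (LINT z|lborel. ?I (m + - axis i 1) z)"
        using I by (simp only: Bochner_Integration.integral_add integrable_mult_right Bochner_Integration.integrable_add integral_mult_right_zero)
      also have "\<dots> = 0"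
        using p(3)[OF m] p(3)[OF int_lattice_add[OF m axis_in_int_lattice]]
          p(3)[OF int_lattice_add[OF m int_lattice_minus[OF axis_in_int_lattice]]] by simp
      finally show ?thesis .
    qed
    moreover have "norm (p z * u i z) \<le> 1" for z
      using mult_mono[OF p(2)[of z], of "norm (u i z)" 1] v01[of i z] by (simp add: norm_mult uv)
    ultimately show ?thesis
      using p cu[of i] by (auto simp: Z_def intro!: continuous_intros)
  qed
  define w where "w z = (\<Prod>i\<in>UNIV. v i z)" for z
  have Zprod: "Z (\<lambda>z. p z * (\<Prod>i\<in>A. u i z))" if "Z p" "finite A" for p A
    using that(2)
  proof induction
    case empty
    then show ?case using that by simp
  next
    case (insert i A)
    from Zu[OF insert.IH, of i] insert.hyps show ?case by (simp add: mult_ac)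
  qed
  have Zw: "Z (\<lambda>z. complex_of_real (w z ^ N))" for N
  proof (induction N)
    case 0
    then show ?case using zero by (simp add: Z_def)
  next
    case (Suc N)
    from Zprod[OF Suc, of UNIV] show ?case by (simp add: w_def uv mult.commute)
  qed
  have cw: "continuous_on UNIV w"
    unfolding w_def v_def by (intro continuous_intros) auto
  then have [measurable]: "w \<in> borel_measurable borel" by (rule borel_measurable_continuous_onI)
  have w01: "0 \<le> w z" "w z \<le> 1" for z
    unfolding w_def by (auto intro!: prod_nonneg prod_le_1 v01)
  have wv: "w z \<le> v i z" for z i
  proof -
    have "w z = v i z * (\<Prod>j\<in>UNIV - {i}. v j z)"
      unfolding w_def by (rule prod.remove) auto
    also have "\<dots> \<le> v i z * 1"
      by (intro mult_left_mono prod_le_1) (auto simp: v01)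
    finally show ?thesis by simp
  qed
  have "v i y = 1" for i by (simp add: v_def)
  then have wy: "w y = 1" by (simp add: w_def)
  \<comment> \<open>Multiplying by \<open>cnj (R y)\<close> before taking real parts makes
    \<open>g y\<close> the squared modulus of \<open>R y\<close>, hence positive; \<open>c\<close>
    is half of it and a lower bound near \<open>y\<close>.\<close>
  define g where "g z = Re (cnj (R y) * R z)" for z
  define c where "c = g y / 2"
  have "0 < c"
    using \<open>R y \<noteq> 0\<close> by (simp add: c_def g_def complex_neq_0[symmetric] sum_power2_gt_zero_iff power2_eq_square[symmetric] complex_eq_iff)
  have cg: "continuous_on UNIV g" unfolding g_def by (intro continuous_intros R)
  then have [measurable]: "g \<in> borel_measurable borel" by (rule borel_measurable_continuous_onI)
  have "open {z. c < g z}"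
    by (rule open_Collect_less[OF continuous_on_const cg])
  moreover have "y \<in> {z. c < g z}"
    using \<open>0 < c\<close> by (simp add: c_def)
  moreover have "open (\<Inter>i. {z::real^'d. \<bar>z $ i\<bar> < 1/2})"
    by (intro open_INT) (auto intro!: open_Collect_less continuous_intros)
  ultimately have "open ({z. c < g z} \<inter> (\<Inter>i. {z. \<bar>z $ i\<bar> < 1/2}))" "y \<in> {z. c < g z} \<inter> (\<Inter>i. {z. \<bar>z $ i\<bar> < 1/2})"
    using y by auto
  then obtain r where r: "0 < r" "cball y r \<subseteq> {z. c < g z} \<inter> (\<Inter>i. {z. \<bar>z $ i\<bar> < 1/2})"
    unfolding open_contains_cball by blast
  define \<delta> where "\<delta> = r / real CARD('d)"
  have \<delta>: "0 < \<delta>" using r by (simp add: \<delta>_def)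
  have \<delta>r: "z \<in> cball y r" if "\<And>i. \<bar>z $ i - y $ i\<bar> \<le> \<delta>" for z
  proof -
    have "norm (z - y) \<le> (\<Sum>i\<in>UNIV. \<bar>(z - y) $ i\<bar>)" by (rule norm_le_l1_cart)
    also have "\<dots> \<le> (\<Sum>i\<in>(UNIV :: 'd set). \<delta>)" using that by (intro sum_mono) auto
    also have "\<dots> = r" by (simp add: \<delta>_def)
    finally show ?thesis by (simp add: dist_norm norm_minus_commute)
  qed
  \<comment> \<open>The box of half-width \<delta> around \<open>y\<close> stays in the open cube.
    So a point of the cell differs from \<open>y\<close> by less than 1 - \<delta> in each
    coordinate, which keeps it clear of the next peak of the cosine.\<close>
  have yd: "\<bar>y $ i\<bar> + \<delta> < 1/2" for i
  proof -
    define s where "s = (if 0 \<le> y $ i then 1 else -1 :: real)"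
    have "y + (s * \<delta>) *\<^sub>R axis i 1 \<in> cball y r"
      by (rule \<delta>r) (use \<delta> in \<open>auto simp: axis_def s_def\<close>)
    then have "\<bar>(y + (s * \<delta>) *\<^sub>R axis i 1) $ i\<bar> < 1/2" using r by blast
    then show ?thesis using \<delta> by (auto simp: s_def split: if_splits)
  qed
  have "\<delta> < 1/2" using yd[of undefined] by linarith
  define q where "q = (1 + cos (2 * pi * \<delta>)) / 2"
  have "cos (2 * pi * \<delta>) < cos 0"
    by (rule cos_monotone_0_pi) (use \<delta> \<open>\<delta> < 1/2\<close> in auto)
  then have "q < 1" by (simp add: q_def)
  moreover have "0 \<le> q"
  proof -
    have "0 \<le> 1 + cos x" for x :: real by (smt (verit) cos_ge_minus_one)
    then show ?thesis by (simp add: q_def)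
  qed
  ultimately have q: "0 \<le> q" "q < 1" by auto
  have wq: "w z \<le> q" if z: "z \<in> cell" "z \<notin> cball y r" for z
  proof -
    obtain i where i: "\<delta> < \<bar>z $ i - y $ i\<bar>" using z \<delta>r not_le by blast
    let ?t = "\<bar>z $ i - y $ i\<bar>"
    have zi: "- 1/2 \<le> z $ i" "z $ i < 1/2" using z by (auto simp: cell_def)
    have t: "\<delta> \<le> ?t" "?t \<le> 1 - \<delta>" using i zi yd[of i] by linarith+
    have "cos (2 * pi * ?t) \<le> cos (2 * pi * \<delta>)"
    proof (cases "?t \<le> 1/2")
      case True
      then show ?thesis by (intro cos_monotone_0_pi_le) (use t \<delta> in auto)
    next
      case False
      have "cos (2 * pi * ?t) = cos (2 * pi - 2 * pi * ?t)" by (simp add: cos_diff)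
      also have "\<dots> = cos (2 * pi * (1 - ?t))" by (simp add: right_diff_distrib)
      also have "\<dots> \<le> cos (2 * pi * \<delta>)"
        by (intro cos_monotone_0_pi_le) (use t \<delta> False in auto)
      finally show ?thesis .
    qed
    also have "cos (2 * pi * ?t) = cos (2 * pi * (z $ i - y $ i))"
      using cos_abs_real[of "2 * pi * (z $ i - y $ i)"] by (simp add: abs_mult)
    finally have "v i z \<le> q" by (simp add: v_def q_def)
    then show ?thesis using wv[of z i] by linarith
  qed
  \<comment> \<open>Away from \<open>y\<close> the product is at most \<open>q\<close>; by
    continuity it exceeds \<open>q'\<close> on a small ball around \<open>y\<close>. Since
    \<open>q < q'\<close>, the powers on the ball eventually win.\<close>
  define q' where "q' = (1 + q) / 2"
  have q': "q < q'" "q' < 1" "0 < q'" using q by (auto simp: q'_def)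
  have "open ({z. q' < w z} \<inter> ball y r)"
    by (intro open_Int open_Collect_less continuous_on_const cw open_ball)
  moreover have "y \<in> {z. q' < w z} \<inter> ball y r"
    using q' wy r by simp
  ultimately obtain s where s: "0 < s" "ball y s \<subseteq> {z. q' < w z} \<inter> ball y r"
    unfolding open_contains_ball by blast
  have b0: "0 < measure lborel (ball y s)" using s by (simp add: content_ball_pos)
  have C0: "0 \<le> C" using C[of y] norm_ge_zero order_trans by blast
  \<comment> \<open>The integral of \<open>g z * w z ^ N\<close> over the cell is 0. The small ball
    contributes at least the left side, the rest of \<open>cball y r\<close> is nonnegative, and the
    remainder of the cell, of measure at most 1, costs at most the right side.\<close>
  have key: "c * measure lborel (ball y s) * q' ^ N \<le> C * C * q ^ N" for N
  proof -
    have [measurable]: "indicator cell \<in> borel_measurable borel" by measurable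
    have ci: "integrable lborel (indicator cell :: real^'d \<Rightarrow> real)"
    proof -
      have "(indicator cell :: real^'d \<Rightarrow> real) = (\<lambda>z. Re (indicator cell z))"
        by (auto simp: fun_eq_iff indicator_def)
      then show ?thesis using integrable_Re[OF cell_integrable] by simp
    qed
    have c1: "(LINT z|lborel. (indicator cell (z :: real^'d) :: real)) = 1"
    proof -
      have "(indicator cell :: real^'d \<Rightarrow> real) = (\<lambda>z. Re (indicator cell z))"
        by (auto simp: fun_eq_iff indicator_def)
      then have "(LINT z|lborel. (indicator cell (z :: real^'d) :: real)) = Re (LINT z|lborel. indicator cell (z :: real^'d))"
        using integral_Re[OF cell_integrable] by simp
      then show ?thesis using cell_orthogonality[of "0 :: real^'d"] by simp
    qed
    have bi: "integrable lborel (indicator (ball y s) :: real^'d \<Rightarrow> real)"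
      by (rule integrable_real_indicator) (use emeasure_bounded_finite[OF bounded_ball] in simp_all)
    have gC: "\<bar>g z\<bar> \<le> C * C" for z
      using abs_Re_le_cmod[of "cnj (R y) * R z"] mult_mono[OF C[of y] C[of z] C0 norm_ge_zero]
      by (simp add: g_def norm_mult)
    have I0: "integrable lborel (\<lambda>z. indicator cell z * (g z * w z ^ N))"
    proof (rule Bochner_Integration.integrable_bound[of _ "\<lambda>z. C * C * indicator cell z"])
      show "AE z in lborel. norm (indicator cell z * (g z * w z ^ N)) \<le> norm (C * C * indicator cell z)"
      proof (rule AE_I2)
        fix z
        have "\<bar>g z\<bar> * w z ^ N \<le> (C * C) * 1"
          using gC[of z] w01[of z] C0 by (intro mult_mono power_le_one) auto
        then show "norm (indicator cell z * (g z * w z ^ N)) \<le> norm (C * C * indicator cell z)"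
          using w01[of z] C0 by (auto simp: indicator_def abs_mult)
      qed
    qed (use ci in auto)
    have "(LINT z|lborel. indicator cell z * (g z * w z ^ N)) = 0"
    proof -
      have "(LINT z|lborel. indicator cell z * (R z * complex_of_real (w z ^ N) * wave z 0)) = 0"
        using Zw[of N] int_lattice_0 unfolding Z_def by blast
      then have "cnj (R y) * (LINT z|lborel. indicator cell z * (R z * complex_of_real (w z ^ N))) = 0" by simp
      then have z: "(LINT z|lborel. cnj (R y) * (indicator cell z * (R z * complex_of_real (w z ^ N)))) = 0" by simp
      have "integrable lborel (\<lambda>z. indicator cell z * (R z * complex_of_real (w z ^ N)))"
      proof (rule integrable_mult_bounded(1)[OF cell_integrable])
        show "norm (R z * complex_of_real (w z ^ N)) \<le> C * 1" for z
          unfolding norm_mult using C[of z] w01[of z] C0 by (intro mult_mono) (auto simp: norm_power power_le_one)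
      qed measurable
      then have "integrable lborel (\<lambda>z. cnj (R y) * (indicator cell z * (R z * complex_of_real (w z ^ N))))"
        by simp
      from integral_Re[OF this]
      have "(LINT z|lborel. Re (cnj (R y) * (indicator cell z * (R z * complex_of_real (w z ^ N))))) = 0"
        unfolding z by (simp only: zero_complex.sel)
      also have "(\<lambda>z. Re (cnj (R y) * (indicator cell z * (R z * complex_of_real (w z ^ N))))) =
          (\<lambda>z. indicator cell z * (g z * w z ^ N))"
        by (auto simp: fun_eq_iff g_def indicator_def algebra_simps)
      finally show ?thesis .
    qed
    moreover have "(LINT z|lborel. c * q' ^ N * indicator (ball y s) z - C * C * q ^ N * indicator cell z)
        \<le> (LINT z|lborel. indicator cell z * (g z * w z ^ N))"
    proof (rule integral_mono)
      show "integrable lborel (\<lambda>z. c * q' ^ N * indicator (ball y s) z - C * C * q ^ N * indicator cell z)"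
        using ci bi by (intro Bochner_Integration.integrable_diff) auto
      fix z
      have cellr: "z \<in> cell" if "z \<in> cball y r"
      proof -
        have "\<bar>z $ i\<bar> < 1/2" for i using that r by blast
        then have "- 1/2 \<le> z $ i \<and> z $ i < 1/2" for i
          unfolding abs_less_iff by (smt (verit) divide_minus_left)
        then show ?thesis by (simp add: cell_def)
      qed
      show "c * q' ^ N * indicator (ball y s) z - C * C * q ^ N * indicator cell z
        \<le> indicator cell z * (g z * w z ^ N)"
      proof (cases "z \<in> cball y r")
        case True
        then have gz: "c < g z" using r by blast
        have "c * q' ^ N * indicator (ball y s) z \<le> g z * w z ^ N"
        proof (cases "z \<in> ball y s")
          case True
          then have "q' < w z" using s by blast
          then show ?thesis using True gz \<open>0 < c\<close> q'
            by (auto intro!: mult_mono power_mono)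
        next
          case False
          then show ?thesis using gz \<open>0 < c\<close> w01[of z] by simp
        qed
        moreover have "0 \<le> C * C * q ^ N" using C0 q by simp
        ultimately show ?thesis using cellr[OF True] by simp
      next
        case False
        then have "z \<notin> ball y s" using s by fastforce
        moreover have "- (C * C * q ^ N) \<le> g z * w z ^ N" if "z \<in> cell"
        proof -
          have "\<bar>g z * w z ^ N\<bar> \<le> C * C * q ^ N"
            unfolding abs_mult using gC[of z] wq[OF that False] w01[of z] C0
            by (intro mult_mono) (auto intro!: power_mono simp: power_abs)
          then show ?thesis by linarith
        qed
        ultimately show ?thesis by (simp add: indicator_def)
      qed
    qed (rule I0)
    moreover have "(LINT z|lborel. c * q' ^ N * indicator (ball y s) z - C * C * q ^ N * indicator cell z) =
       c * q' ^ N * measure lborel (ball y s) - C * C * q ^ N"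
      using ci c1 bi by (subst Bochner_Integration.integral_diff) auto
    ultimately show ?thesis by (simp add: mult_ac)
  qed
  have "(\<lambda>N. C * C * (q / q') ^ N) \<longlonglongrightarrow> C * C * 0"
    using q q' by (intro tendsto_mult tendsto_const LIMSEQ_power_zero) auto
  moreover have "c * measure lborel (ball y s) \<le> C * C * (q / q') ^ N" for N
    using key[of N] q' by (simp add: power_divide field_simps)
  ultimately have "c * measure lborel (ball y s) \<le> C * C * 0"
    by (intro LIMSEQ_le_const) auto
  then show False using \<open>0 < c\<close> b0 by (simp add: mult_le_0_iff)
qed

text \<open>Periodicity moves the point into the cell. There it may lie on the boundary of the cube,
  but its contractions towards 0 are interior and converge to it.\<close>

lemma fourier_uniqueness:
  fixes R :: "real^'d \<Rightarrow> complex"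
  assumes R: "continuous_on UNIV R" and C: "\<And>z. norm (R z) \<le> C"
    and per: "\<And>z k. k \<in> int_lattice \<Longrightarrow> R (z + k) = R z"
    and zero: "\<And>m. m \<in> int_lattice \<Longrightarrow> (LINT z|lborel. indicator cell z * (R z * wave z m)) = 0"
  shows "R y = 0"
proof -
  obtain k where k: "k \<in> int_lattice" "y - k \<in> cell" using cell_unique_translate[of y] by blast
  define x where "x = y - k"
  have x: "\<bar>x $ i\<bar> \<le> 1/2" for i using k by (auto simp: x_def cell_def abs_le_iff) (smt (verit, best) field_sum_of_halves)+
  have "(\<lambda>n. (1 - 1 / real (n + 1)) *\<^sub>R x) \<longlonglongrightarrow> (1 - 0) *\<^sub>R x"
    by (intro tendsto_intros LIMSEQ_ignore_initial_segment[OF lim_const_over_n])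
  then have "(\<lambda>n. R ((1 - 1 / real (n + 1)) *\<^sub>R x)) \<longlonglongrightarrow> R ((1 - 0) *\<^sub>R x)"
    by (rule continuous_on_tendsto_compose[OF R]) auto
  moreover have "R ((1 - 1 / real (n + 1)) *\<^sub>R x) = 0" for n
  proof (rule fourier_uniqueness_interior[OF R C zero])
    fix i
    have "\<bar>((1 - 1 / real (n + 1)) *\<^sub>R x) $ i\<bar> = (1 - 1 / real (n + 1)) * \<bar>x $ i\<bar>"
      by (simp add: abs_mult)
    also have "\<dots> \<le> (1 - 1 / real (n + 1)) * (1/2)" using x by (intro mult_left_mono) auto
    also have "\<dots> < 1/2" by simp
    finally show "\<bar>((1 - 1 / real (n + 1)) *\<^sub>R x) $ i\<bar> < 1/2" .
  qed
  ultimately have "R x = 0" by (simp add: LIMSEQ_const_iff)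
  then show ?thesis using per[OF k(1), of x] by (simp add: x_def)
qed

section \<open>Poisson summation\<close>

lemma class_LC_uniform_limit:
  assumes "\<phi> \<in> class_LC" "compact K" "0 < \<epsilon>"
  obtains I s where "finite I" "I \<subseteq> int_lattice"
    "\<And>J x. finite J \<Longrightarrow> I \<subseteq> J \<Longrightarrow> J \<subseteq> int_lattice \<Longrightarrow> x \<in> K \<Longrightarrow> \<bar>(\<Sum>k\<in>J. norm (\<phi> (x + k))) - s x\<bar> < \<epsilon>"
proof -
  obtain s where "uniform_limit K (\<lambda>I x. \<Sum>k\<in>I. norm (\<phi> (x + k))) s (finite_subsets_at_top int_lattice)"
    using assms by (auto simp: class_LC_def)
  from uniform_limitD[OF this assms(3)]
  have "\<exists>I. finite I \<and> I \<subseteq> int_lattice \<and> (\<forall>J. finite J \<and> I \<subseteq> J \<and> J \<subseteq> int_lattice \<longrightarrow>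
      (\<forall>x\<in>K. dist (\<Sum>k\<in>J. norm (\<phi> (x + k))) (s x) < \<epsilon>))"
    unfolding eventually_finite_subsets_at_top .
  then obtain I where I: "finite I" "I \<subseteq> int_lattice"
      "\<forall>J. finite J \<and> I \<subseteq> J \<and> J \<subseteq> int_lattice \<longrightarrow> (\<forall>x\<in>K. dist (\<Sum>k\<in>J. norm (\<phi> (x + k))) (s x) < \<epsilon>)"
    by (elim exE conjE)
  show ?thesis
  proof (rule that[OF I(1,2)])
    fix J x assume "finite J" "I \<subseteq> J" "J \<subseteq> int_lattice" "x \<in> K"
    then show "\<bar>(\<Sum>k\<in>J. norm (\<phi> (x + k))) - s x\<bar> < \<epsilon>"
      using I(3) unfolding dist_real_def by blast
  qed
qed

text \<open>The Cauchy criterion: the sums over \<open>I\<close> and over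
  \<open>J \<union> I\<close> are both within half of \<epsilon> of the limit.\<close>

lemma class_LC_tail:
  assumes "\<phi> \<in> class_LC" "compact K" "0 < \<epsilon>"
  obtains I where "finite I" "I \<subseteq> int_lattice"
    "\<And>J x. finite J \<Longrightarrow> J \<inter> I = {} \<Longrightarrow> J \<subseteq> int_lattice \<Longrightarrow> x \<in> K \<Longrightarrow> (\<Sum>k\<in>J. norm (\<phi> (x + k))) < \<epsilon>"
proof -
  obtain I s where I: "finite I" "I \<subseteq> int_lattice"
    "\<And>J x. finite J \<Longrightarrow> I \<subseteq> J \<Longrightarrow> J \<subseteq> int_lattice \<Longrightarrow> x \<in> K \<Longrightarrow> \<bar>(\<Sum>k\<in>J. norm (\<phi> (x + k))) - s x\<bar> < \<epsilon> / 2"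
    using class_LC_uniform_limit[OF assms(1,2) half_gt_zero[OF assms(3)]] by blast
  show ?thesis
  proof (rule that[OF I(1,2)])
    fix J x assume J: "finite J" "J \<inter> I = {}" "J \<subseteq> int_lattice" "x \<in> K"
    have "(\<Sum>k\<in>J \<union> I. norm (\<phi> (x + k))) = (\<Sum>k\<in>J. norm (\<phi> (x + k))) + (\<Sum>k\<in>I. norm (\<phi> (x + k)))"
      using J I by (intro sum.union_disjoint) auto
    moreover have "\<bar>(\<Sum>k\<in>J \<union> I. norm (\<phi> (x + k))) - s x\<bar> < \<epsilon> / 2"
      by (rule I(3)) (use I(1,2) J in auto)
    moreover have "\<bar>(\<Sum>k\<in>I. norm (\<phi> (x + k))) - s x\<bar> < \<epsilon> / 2"
      by (rule I(3)) (use I(1,2) J in auto)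
    ultimately show "(\<Sum>k\<in>J. norm (\<phi> (x + k))) < \<epsilon>" by linarith
  qed
qed

text \<open>A fixed finite part is bounded by continuity on the compact set, and whatever lies
  outside it adds less than 1.\<close>

lemma class_LC_bounded_sums:
  fixes \<phi> :: "real^'d \<Rightarrow> complex"
  assumes \<phi>: "\<phi> \<in> class_LC" and K: "compact K"
  obtains C where "\<And>J x. finite J \<Longrightarrow> J \<subseteq> int_lattice \<Longrightarrow> x \<in> K \<Longrightarrow> (\<Sum>k\<in>J. norm (\<phi> (x + k))) \<le> C"
proof -
  obtain I where I: "finite I" "I \<subseteq> int_lattice"
    "\<And>J x. finite J \<Longrightarrow> J \<inter> I = {} \<Longrightarrow> J \<subseteq> int_lattice \<Longrightarrow> x \<in> K \<Longrightarrow> (\<Sum>k\<in>J. norm (\<phi> (x + k))) < 1"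
    using class_LC_tail[OF \<phi> K zero_less_one] by blast
  have c\<phi>: "continuous_on UNIV \<phi>" using \<phi> by (simp add: class_LC_def)
  have "continuous_on K (\<lambda>x. \<Sum>k\<in>I. norm (\<phi> (x + k)))"
    by (rule continuous_on_sum, rule continuous_on_norm, rule continuous_on_compose2[OF c\<phi>])
      (auto intro!: continuous_intros)
  then have "bounded ((\<lambda>x. \<Sum>k\<in>I. norm (\<phi> (x + k))) ` K)"
    using K compact_continuous_image compact_imp_bounded by blast
  then obtain B where B: "\<And>x. x \<in> K \<Longrightarrow> \<bar>\<Sum>k\<in>I. norm (\<phi> (x + k))\<bar> \<le> B"
    unfolding bounded_iff by auto
  show ?thesis
  proof (rule that[of "B + 1"])
    fix J :: "(real^'d) set" and x assume J: "finite J" "J \<subseteq> int_lattice" "x \<in> K"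
    have "(\<Sum>k\<in>J. norm (\<phi> (x + k))) \<le> (\<Sum>k\<in>(J - I) \<union> I. norm (\<phi> (x + k)))"
      using J I by (intro sum_mono2) auto
    also have "\<dots> = (\<Sum>k\<in>J - I. norm (\<phi> (x + k))) + (\<Sum>k\<in>I. norm (\<phi> (x + k)))"
      using J I by (intro sum.union_disjoint) auto
    also have "\<dots> \<le> B + 1"
    proof -
      have "(\<Sum>k\<in>J - I. norm (\<phi> (x + k))) < 1"
        by (rule I(3)) (use J in auto)
      then show ?thesis using B[OF J(3)] by linarith
    qed
    finally show "(\<Sum>k\<in>J. norm (\<phi> (x + k))) \<le> B + 1" .
  qed
qed

lemma class_LC_summable:
  assumes "\<phi> \<in> class_LC"
  shows "(\<lambda>k. norm (\<phi> (x + k))) summable_on int_lattice"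
proof -
  obtain C where "\<And>J y. finite J \<Longrightarrow> J \<subseteq> int_lattice \<Longrightarrow> y \<in> {x} \<Longrightarrow> (\<Sum>k\<in>J. norm (\<phi> (y + k))) \<le> C"
    using class_LC_bounded_sums[OF assms, of "{x}"] by auto
  then show ?thesis
    by (intro nonneg_bdd_above_summable_on bdd_aboveI[of _ C]) auto
qed

lemma compact_closure_cell: "compact {x::real^'d. \<forall>i. \<bar>x $ i\<bar> \<le> 1/2}"
proof -
  have *: "\<bar>t\<bar> \<le> 1/2 \<longleftrightarrow> - (1/2) \<le> t \<and> t \<le> 1/2" for t :: real by linarith
  have "{x::real^'d. \<forall>i. \<bar>x $ i\<bar> \<le> 1/2} = cbox (\<chi> i. - (1/2)) (\<chi> i. 1/2)"
    unfolding * by (auto simp: mem_box_cart)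
  then show ?thesis by (simp only: compact_cbox)
qed

lemma cell_bound:
  assumes "x \<in> cell"
  shows "\<bar>x $ i\<bar> \<le> 1/2"
proof -
  have "- 1/2 \<le> x $ i \<and> x $ i < 1/2" using assms unfolding cell_def by blast
  then show ?thesis by linarith
qed

lemma cell_translates_sum:
  fixes e :: "nat \<Rightarrow> real^'d"
  assumes e: "bij_betw e UNIV int_lattice"
  obtains n where "\<And>m. x - e m \<in> cell \<longleftrightarrow> m = n"
proof -
  obtain k where k: "k \<in> int_lattice" "x - k \<in> cell" "\<And>l. l \<in> int_lattice \<Longrightarrow> x - l \<in> cell \<Longrightarrow> l = k"
    using cell_unique_translate[of x] by blast
  obtain n where n: "k = e n" using k(1) e by (auto simp: bij_betw_def)
  show ?thesis
  proof (rule that[of n])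
    fix m
    have "e m \<in> int_lattice" using e by (auto simp: bij_betw_def)
    then have "e m = e n" if "x - e m \<in> cell" using k(3) that n by blast
    then show "x - e m \<in> cell \<longleftrightarrow> m = n"
      using k(2) n e by (auto simp: bij_betw_def inj_on_def)
  qed
qed

text \<open>Cutting the space into translates of the cell turns the integral of the norm into an
  integral over the cell of the lattice sum of norms, which is bounded on the closed cube.\<close>

lemma class_LC_integrable:
  fixes \<phi> :: "real^'d \<Rightarrow> complex"
  assumes \<phi>: "\<phi> \<in> class_LC"
  shows "integrable lborel \<phi>"
proof (rule integrableI_bounded)
  have cont: "continuous_on UNIV \<phi>" using \<phi> by (simp add: class_LC_def)
  show "\<phi> \<in> borel_measurable lborel" using borel_measurable_continuous_onI[OF cont] by simp
  then have [measurable]: "\<phi> \<in> borel_measurable borel" by simp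
  obtain e :: "nat \<Rightarrow> real^'d" where e: "bij_betw e UNIV int_lattice" by (rule int_lattice_enumeration)
  obtain C where C: "\<And>J x. finite J \<Longrightarrow> J \<subseteq> int_lattice \<Longrightarrow> x \<in> {x. \<forall>i. \<bar>x $ i\<bar> \<le> 1/2} \<Longrightarrow>
      (\<Sum>k\<in>J. norm (\<phi> (x + k))) \<le> C"
    using class_LC_bounded_sums[OF \<phi> compact_closure_cell] by blast
  have sum1: "(\<Sum>n. indicator cell (x - e n) * ennreal (norm (\<phi> x))) = ennreal (norm (\<phi> x))" for x
  proof -
    obtain n where n: "\<And>m. x - e m \<in> cell \<longleftrightarrow> m = n" using cell_translates_sum[OF e, of x] by blast
    show ?thesis by (subst suminf_finite[of "{n}"]) (auto simp: indicator_def n)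
  qed
  have "(\<integral>\<^sup>+x. ennreal (norm (\<phi> x)) \<partial>lborel) = (\<integral>\<^sup>+x. (\<Sum>n. indicator cell (x - e n) * ennreal (norm (\<phi> x))) \<partial>lborel)"
    by (simp only: sum1)
  also have "\<dots> = (\<Sum>n. \<integral>\<^sup>+x. indicator cell (x - e n) * ennreal (norm (\<phi> x)) \<partial>lborel)"
    by (rule nn_integral_suminf) measurable
  also have "\<dots> = (\<Sum>n. \<integral>\<^sup>+x. indicator cell x * ennreal (norm (\<phi> (x + e n))) \<partial>lborel)"
  proof (rule arg_cong[where f=suminf], rule ext)
    fix n
    show "(\<integral>\<^sup>+x. indicator cell (x - e n) * ennreal (norm (\<phi> x)) \<partial>lborel) =
        (\<integral>\<^sup>+x. indicator cell x * ennreal (norm (\<phi> (x + e n))) \<partial>lborel)"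
      by (subst lborel_distr_plus[of "e n", symmetric], subst nn_integral_distr) (simp_all add: add.commute)
  qed
  also have "\<dots> = (\<integral>\<^sup>+x. (\<Sum>n. indicator cell x * ennreal (norm (\<phi> (x + e n)))) \<partial>lborel)"
    by (rule nn_integral_suminf[symmetric]) measurable
  also have "\<dots> \<le> (\<integral>\<^sup>+x. ennreal C * indicator {x::real^'d. \<forall>i. \<bar>x $ i\<bar> \<le> 1/2} x \<partial>lborel)"
  proof (rule nn_integral_mono)
    fix x :: "real^'d"
    show "(\<Sum>n. indicator cell x * ennreal (norm (\<phi> (x + e n)))) \<le> ennreal C * indicator {x. \<forall>i. \<bar>x $ i\<bar> \<le> 1/2} x"
    proof (cases "x \<in> cell")
      case True
      have "(\<Sum>n. ennreal (norm (\<phi> (x + e n)))) \<le> ennreal C"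
      proof (rule suminf_le_const[OF summableI])
        fix N
        have inj: "inj_on e {..<N}" using e by (auto simp: bij_betw_def inj_on_def)
        have "(\<Sum>k\<in>e ` {..<N}. norm (\<phi> (x + k))) \<le> C"
          by (rule C) (use e cell_bound[OF True] in \<open>auto simp: bij_betw_def\<close>)
        then show "(\<Sum>n<N. ennreal (norm (\<phi> (x + e n)))) \<le> ennreal C"
          by (simp add: sum.reindex[OF inj] sum_ennreal ennreal_leI)
      qed
      then show ?thesis using True cell_bound[OF True] by simp
    qed simp
  qed
  also have "\<dots> < \<infinity>"
    using emeasure_bounded_finite[OF compact_imp_bounded[OF compact_closure_cell]] borel_compact[OF compact_closure_cell]
    by (subst nn_integral_cmult_indicator) (auto simp: ennreal_mult_less_top)
  finally show "(\<integral>\<^sup>+x. ennreal (norm (\<phi> x)) \<partial>lborel) < \<infinity>" .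
qed

lemma integral_unfold_cell:
  fixes G :: "real^'d \<Rightarrow> 'b::{banach, second_countable_topology}"
  assumes G: "integrable lborel G" and e: "bij_betw e UNIV int_lattice"
  shows "(\<lambda>n. LINT z|lborel. indicator cell z *\<^sub>R G (z + e n)) sums (LINT z|lborel. G z)"
proof -
  have [measurable]: "G \<in> borel_measurable borel" using G by auto
  define f where "f n z = indicator cell (z - e n) *\<^sub>R G z" for n z
  have [measurable]: "f n \<in> borel_measurable borel" for n unfolding f_def by measurable
  have fi: "integrable lborel (f n)" for n
    by (rule Bochner_Integration.integrable_bound[OF G]) (auto simp: f_def indicator_def)
  have fsum: "(\<Sum>n. f n z) = G z" "summable (\<lambda>n. norm (f n z))" "(\<Sum>n<N. norm (f n z)) \<le> norm (G z)" for z N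
  proof -
    obtain n where n: "\<And>m. z - e m \<in> cell \<longleftrightarrow> m = n" using cell_translates_sum[OF e, of z] by blast
    have f: "f m z = (if m = n then G z else 0)" for m by (simp add: f_def n indicator_def)
    show "(\<Sum>n. f n z) = G z" by (subst suminf_finite[of "{n}"]) (auto simp: f)
    show "summable (\<lambda>n. norm (f n z))" by (rule summable_finite[of "{n}"]) (auto simp: f)
    have "(\<Sum>m<N. norm (f m z)) = (\<Sum>m<N. if m = n then norm (G z) else 0)" by (intro sum.cong) (auto simp: f)
    then show "(\<Sum>m<N. norm (f m z)) \<le> norm (G z)" by simp
  qed
  have "(\<lambda>n. integral\<^sup>L lborel (f n)) sums (LINT z|lborel. (\<Sum>n. f n z))"
  proof (rule sums_integral[OF fi])
    show "AE z in lborel. summable (\<lambda>n. norm (f n z))" using fsum by auto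
    show "summable (\<lambda>n. LINT z|lborel. norm (f n z))"
    proof (rule bounded_imp_summable)
      fix N
      have "(\<Sum>n\<le>N. LINT z|lborel. norm (f n z)) = (LINT z|lborel. (\<Sum>n\<le>N. norm (f n z)))"
        by (rule Bochner_Integration.integral_sum[symmetric]) (use fi in auto)
      also have "\<dots> \<le> (LINT z|lborel. norm (G z))"
        by (rule integral_mono) (use fi G fsum(3)[of _ "Suc N"] in \<open>auto simp: lessThan_Suc_atMost\<close>)
      finally show "(\<Sum>n\<le>N. LINT z|lborel. norm (f n z)) \<le> (LINT z|lborel. norm (G z))" .
    qed simp
  qed
  moreover have "integral\<^sup>L lborel (f n) = (LINT z|lborel. indicator cell z *\<^sub>R G (z + e n))" for n
    using lborel_integral_affine[of 1 "f n" "e n"] by (simp add: f_def[abs_def] add.commute)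
  ultimately show ?thesis by (simp add: fsum)
qed

text \<open>The periodization \<open>P\<close> of \<phi> times the character has the values of the
  transform of \<phi> on \<xi> plus the lattice as Fourier coefficients. Only the one at 0 survives,
  so \<open>P\<close> minus a constant has no coefficients and vanishes. Uniform summability makes
  \<open>P\<close> continuous, which yields the identity at every \<open>z\<close>.\<close>

lemma poisson_summation:
  fixes \<phi> :: "real^'d \<Rightarrow> complex"
  assumes \<phi>: "\<phi> \<in> class_LC"
    and zero: "\<And>m. m \<in> int_lattice \<Longrightarrow> m \<noteq> 0 \<Longrightarrow> (LINT x|lborel. \<phi> x * wave x (- (\<xi> + m))) = 0"
  shows "((\<lambda>k. \<phi> (z + k) * wave (z + k) (- \<xi>)) has_sum (LINT x|lborel. \<phi> x * wave x (- \<xi>))) int_lattice"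
proof -
  define F where "F x = \<phi> x * wave x (- \<xi>)" for x
  have nF: "norm (F x) = norm (\<phi> x)" for x by (simp add: F_def norm_mult)
  have c\<phi>: "continuous_on UNIV \<phi>" using \<phi> by (simp add: class_LC_def)
  have cF: "continuous_on UNIV F" unfolding F_def by (intro continuous_intros c\<phi>)
  have [measurable]: "F \<in> borel_measurable borel" by (rule borel_measurable_continuous_onI[OF cF])
  have F_int: "integrable lborel F"
    unfolding F_def by (rule integrable_mult_bounded(1)[OF class_LC_integrable[OF \<phi>], where C=1]) auto
  define P where "P x = infsum (\<lambda>k. F (x + k)) int_lattice" for x
  have abs: "(\<lambda>k. norm (F (x + k))) summable_on int_lattice" for x
    using class_LC_summable[OF \<phi>] by (simp add: nF)
  have hs: "((\<lambda>k. F (x + k)) has_sum P x) int_lattice" for x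
    unfolding P_def by (rule has_sum_infsum[OF abs_summable_summable[OF abs]])
  have lim: "((\<lambda>J. \<Sum>k\<in>J. F (x + k)) \<longlongrightarrow> P x) (finite_subsets_at_top int_lattice)" for x
    using hs[of x] by (simp add: has_sum_def)
  have per: "P (x + m) = P x" if m: "m \<in> int_lattice" for x m
  proof -
    have "bij_betw (\<lambda>k. m + k) int_lattice int_lattice"
    proof (rule bij_betwI[where g="\<lambda>k. k - m"])
    qed (use m int_lattice_add int_lattice_diff in auto)
    from infsum_reindex_bij_betw[OF this, of "\<lambda>k. F (x + k)"] show ?thesis
      by (simp add: P_def add.assoc)
  qed
  obtain C where C: "\<And>J x. finite J \<Longrightarrow> J \<subseteq> int_lattice \<Longrightarrow> x \<in> {x. \<forall>i. \<bar>x $ i\<bar> \<le> 1/2} \<Longrightarrow>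
      (\<Sum>k\<in>J. norm (\<phi> (x + k))) \<le> C"
    using class_LC_bounded_sums[OF \<phi> compact_closure_cell] by blast
  \<comment> \<open>The bound on partial sums holds only over a compact set; periodicity brings
    every point into the cell.\<close>
  have PC: "norm (P x) \<le> C" for x
  proof -
    obtain k where k: "k \<in> int_lattice" "x - k \<in> cell" using cell_unique_translate[of x] by blast
    have "norm (P (x - k)) \<le> C"
    proof (rule tendsto_upperbound[OF tendsto_norm[OF lim]])
      show "\<forall>\<^sub>F J in finite_subsets_at_top int_lattice. norm (\<Sum>l\<in>J. F (x - k + l)) \<le> C"
      proof (rule eventually_finite_subsets_at_top_weakI)
        fix J assume J: "finite J" "J \<subseteq> (int_lattice :: (real^'d) set)"
        have "norm (\<Sum>l\<in>J. F (x - k + l)) \<le> (\<Sum>l\<in>J. norm (F (x - k + l)))" by (rule norm_sum)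
        also have "\<dots> \<le> C" unfolding nF using J cell_bound[OF k(2)] by (intro C) auto
        finally show "norm (\<Sum>l\<in>J. F (x - k + l)) \<le> C" .
      qed
    qed simp
    then show ?thesis using per[OF k(1), of "x - k"] by simp
  qed
  \<comment> \<open>Comparing a partial sum with larger ones and letting those grow gives a bound of
    half of \<epsilon> against \<open>P\<close>, uniformly on the closed ball.\<close>
  have "continuous_on (ball y 1) P" for y
  proof -
    have "uniform_limit (cball y 1) (\<lambda>J x. \<Sum>k\<in>J. F (x + k)) P (finite_subsets_at_top int_lattice)"
    proof (rule uniform_limitI)
      fix \<epsilon> :: real assume \<epsilon>: "0 < \<epsilon>"
      obtain I where I: "finite I" "I \<subseteq> int_lattice"
        "\<And>J x. finite J \<Longrightarrow> J \<inter> I = {} \<Longrightarrow> J \<subseteq> int_lattice \<Longrightarrow> x \<in> cball y 1 \<Longrightarrow> (\<Sum>k\<in>J. norm (\<phi> (x + k))) < \<epsilon> / 2"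
        using class_LC_tail[OF \<phi> compact_cball[of y 1] half_gt_zero[OF \<epsilon>]] by blast
      have le: "dist (\<Sum>k\<in>J. F (x + k)) (P x) < \<epsilon>" if J: "finite J" "I \<subseteq> J" "J \<subseteq> int_lattice" and x: "x \<in> cball y 1" for J x
      proof -
        have "dist (\<Sum>k\<in>J. F (x + k)) (P x) \<le> \<epsilon> / 2"
        proof (rule tendsto_upperbound[OF tendsto_dist[OF tendsto_const lim]])
          show "\<forall>\<^sub>F L in finite_subsets_at_top int_lattice. dist (\<Sum>k\<in>J. F (x + k)) (\<Sum>k\<in>L. F (x + k)) \<le> \<epsilon> / 2"
            unfolding eventually_finite_subsets_at_top
          proof (intro exI[of _ J] conjI allI impI J)
            fix L assume L: "finite L \<and> J \<subseteq> L \<and> L \<subseteq> (int_lattice :: (real^'d) set)"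
            have "(\<Sum>k\<in>L. F (x + k)) - (\<Sum>k\<in>J. F (x + k)) = (\<Sum>k\<in>L - J. F (x + k))"
              using L by (simp add: sum_diff)
            then have "dist (\<Sum>k\<in>J. F (x + k)) (\<Sum>k\<in>L. F (x + k)) \<le> (\<Sum>k\<in>L - J. norm (\<phi> (x + k)))"
              using norm_sum[of "\<lambda>k. F (x + k)" "L - J"] 
              by (subst dist_commute) (simp add: dist_norm nF)
            also have "\<dots> < \<epsilon> / 2"
              using L J x by (intro I(3)) auto
            finally show "dist (\<Sum>k\<in>J. F (x + k)) (\<Sum>k\<in>L. F (x + k)) \<le> \<epsilon> / 2" by simp
          qed
        qed simp
        then show ?thesis using \<epsilon> by simp
      qed
      show "\<forall>\<^sub>F J in finite_subsets_at_top int_lattice. \<forall>x\<in>cball y 1. dist (\<Sum>k\<in>J. F (x + k)) (P x) < \<epsilon>"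
        unfolding eventually_finite_subsets_at_top using I(1,2) le by (intro exI[of _ I]) auto
    qed
    then have "continuous_on (cball y 1) P"
    proof (rule uniform_limit_theorem[rotated])
      have "continuous_on (cball y 1) (\<lambda>x. \<Sum>k\<in>J. F (x + k))" for J
        by (rule continuous_on_sum, rule continuous_on_compose2[OF cF]) (auto intro!: continuous_intros)
      then show "\<forall>\<^sub>F J in finite_subsets_at_top int_lattice. continuous_on (cball y 1) (\<lambda>x. \<Sum>k\<in>J. F (x + k))"
        by simp
    qed simp
    then show ?thesis by (rule continuous_on_subset) auto
  qed
  then have cP: "continuous_on UNIV P"
    by (metis UNIV_I centre_in_ball continuous_on_interior continuous_at_imp_continuous_on interior_ball zero_less_one)
  have [measurable]: "P \<in> borel_measurable borel" by (rule borel_measurable_continuous_onI[OF cP])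
  obtain e :: "nat \<Rightarrow> real^'d" where e: "bij_betw e UNIV int_lattice" by (rule int_lattice_enumeration)
  have eL: "e n \<in> int_lattice" for n using e by (auto simp: bij_betw_def)
  \<comment> \<open>A character of lattice frequency is unchanged by lattice translates, so the
    coefficient over the cell unfolds into an integral over the whole space.\<close>
  have coeff: "(LINT z|lborel. indicator cell z * (P z * wave z m)) = (LINT x|lborel. \<phi> x * wave x (- (\<xi> - m)))"
    if m: "m \<in> int_lattice" for m
  proof -
    define G where "G x = F x * wave x m" for x
    have nG: "norm (G x) = norm (F x)" for x by (simp add: G_def norm_mult)
    have [measurable]: "G \<in> borel_measurable borel" unfolding G_def by measurable
    have G_int: "integrable lborel G"
      unfolding G_def by (rule integrable_mult_bounded(1)[OF F_int, where C=1]) auto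
    define f where "f n z = indicator cell z *\<^sub>R G (z + e n)" for n z
    have [measurable]: "f n \<in> borel_measurable borel" for n unfolding f_def by measurable
    have PG: "(\<lambda>n. f n z) sums (indicator cell z * (P z * wave z m))" "summable (\<lambda>n. norm (f n z))" for z
    proof -
      have "((\<lambda>n. F (z + e n)) has_sum P z) UNIV"
        using hs[of z] by (subst has_sum_reindex_bij_betw[OF e])
      then have "(\<lambda>n. F (z + e n)) sums P z" by (rule has_sum_imp_sums)
      then have "(\<lambda>n. indicator cell z * wave z m * F (z + e n)) sums (indicator cell z * wave z m * P z)"
        by (rule sums_mult)
      moreover have "indicator cell z * wave z m * F (z + e n) = f n z" for n
        by (simp add: f_def G_def wave_add wave_lattice[OF eL m] indicator_def)
      ultimately show "(\<lambda>n. f n z) sums (indicator cell z * (P z * wave z m))" by (simp add: mult_ac)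
      have "(\<lambda>n. norm (F (z + e n))) summable_on UNIV"
        using abs[of z] by (subst summable_on_reindex_bij_betw[OF e])
      then have "summable (\<lambda>n. norm (F (z + e n)))" by (rule summable_on_imp_summable)
      then show "summable (\<lambda>n. norm (f n z))"
        by (rule summable_comparison_test') (auto simp: f_def nG indicator_def)
    qed
    have "(\<lambda>n. integral\<^sup>L lborel (f n)) sums (LINT z|lborel. (\<Sum>n. f n z))"
    proof (rule sums_integral)
      fix n
      have "integrable lborel (\<lambda>z. G (z + e n))"
        using lborel_integrable_affine_iff[of 1 G "e n"] G_int by (simp add: add.commute)
      then show "integrable lborel (f n)"
        by (rule Bochner_Integration.integrable_bound) (auto simp: f_def indicator_def)
    next
      show "AE z in lborel. summable (\<lambda>n. norm (f n z))" using PG by auto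
      have "(\<lambda>n. LINT z|lborel. indicator cell z *\<^sub>R norm (G (z + e n))) sums (LINT z|lborel. norm (G z))"
        by (rule integral_unfold_cell[OF integrable_norm[OF G_int] e])
      then show "summable (\<lambda>n. LINT z|lborel. norm (f n z))"
        by (simp add: f_def sums_iff)
    qed
    moreover have "(\<lambda>n. integral\<^sup>L lborel (f n)) sums (LINT z|lborel. G z)"
      unfolding f_def by (rule integral_unfold_cell[OF G_int e])
    moreover have "(\<Sum>n. f n z) = indicator cell z * (P z * wave z m)" for z
      using PG(1)[of z] by (simp add: sums_iff)
    ultimately have "(LINT z|lborel. indicator cell z * (P z * wave z m)) = (LINT z|lborel. G z)"
      using sums_unique2 by fastforce
    then show ?thesis by (simp add: G_def F_def wave_add[symmetric] mult.assoc)
  qed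
  define c where "c = (LINT x|lborel. \<phi> x * wave x (- \<xi>))"
  have "P z - c = 0"
  proof (rule fourier_uniqueness[where R="\<lambda>z. P z - c"])
    show "continuous_on UNIV (\<lambda>z. P z - c)" by (intro continuous_intros cP)
    show "norm (P z - c) \<le> C + norm c" for z
      using norm_triangle_ineq4[of "P z" c] PC[of z] by linarith
    show "P (z + k) - c = P z - c" if "k \<in> int_lattice" for z k using per[OF that] by simp
    fix m :: "real^'d" assume m: "m \<in> int_lattice"
    have "(LINT z|lborel. indicator cell z * ((P z - c) * wave z m)) =
        (LINT z|lborel. indicator cell z * (P z * wave z m) - c * (indicator cell z * wave z m))"
      by (simp add: algebra_simps)
    also have "\<dots> = (LINT z|lborel. indicator cell z * (P z * wave z m)) - (LINT z|lborel. c * (indicator cell z * wave z m))"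
    proof (rule Bochner_Integration.integral_diff)
      show "integrable lborel (\<lambda>z. indicator cell z * (P z * wave z m))"
        by (rule integrable_mult_bounded(1)[OF cell_integrable, where C=C]) (auto simp: norm_mult PC)
      have "integrable lborel (\<lambda>z. indicator cell z * wave z m)"
        by (rule integrable_mult_bounded(1)[OF cell_integrable, where C=1]) auto
      then show "integrable lborel (\<lambda>z. c * (indicator cell z * wave z m))" by simp
    qed
    also have "\<dots> = 0"
      using zero[OF int_lattice_minus[OF m]] by (simp add: coeff[OF m] cell_orthogonality[OF m] c_def)
    finally show "(LINT z|lborel. indicator cell z * ((P z - c) * wave z m)) = 0" .
  qed
  then show ?thesis using hs[of z] by (simp add: F_def c_def)
qed

section \<open>The sampling expansion\<close>

text \<open>A nonzero real kernel vector, read as a complex one, would make 0 an eigenvalue, against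
  the bound on the moduli.\<close>

lemma invertible_dilation_matrix:
  assumes "dilation_matrix A"
  shows "invertible A"
proof -
  have "v = 0" if v: "A *v v = 0" for v
  proof (rule ccontr)
    assume "v \<noteq> 0"
    let ?w = "(\<chi> i. complex_of_real (v $ i)) :: complex^'a"
    have "?w \<noteq> 0" using \<open>v \<noteq> 0\<close> by (auto simp: vec_eq_iff)
    moreover have "map_matrix complex_of_real A *v ?w = 0 *s ?w"
    proof (subst vec_eq_iff, rule allI)
      fix i
      have "(map_matrix complex_of_real A *v ?w) $ i = complex_of_real ((A *v v) $ i)"
        by (simp add: matrix_vector_mult_def map_matrix_def)
      then show "(map_matrix complex_of_real A *v ?w) $ i = (0 *s ?w) $ i" by (simp add: v)
    qed
    ultimately have "0 \<in> eigenvalues A" unfolding eigenvalues_def by blast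
    then show False using assms by (auto simp: dilation_matrix_def)
  qed
  then show ?thesis
    unfolding invertible_left_inverse matrix_left_invertible_ker by blast
qed

lemma invertible_mat_pow: "invertible A \<Longrightarrow> invertible (mat_pow A n)"
proof (induction n)
  case 0
  have "mat 1 ** mat 1 = (mat 1 :: real^'a^'a)" by simp
  then show ?case unfolding invertible_def mat_pow.simps by blast
next
  case (Suc n)
  then show ?case by (simp add: invertible_mult)
qed

text \<open>A nonempty open set contains a ball of positive measure. This upgrades almost-everywhere
  relations to pointwise ones for continuous functions.\<close>

lemma AE_lborel_open_ex:
  fixes S :: "'a::euclidean_space set"
  assumes "AE x in lborel. P x" "open S" "x \<in> S"
  shows "\<exists>y\<in>S. P y"
proof (rule ccontr)
  assume *: "\<not> (\<exists>y\<in>S. P y)"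
  obtain N where N: "N \<in> null_sets lborel" "{y \<in> space lborel. \<not> P y} \<subseteq> N"
    using assms(1) by (auto simp: eventually_ae_filter)
  obtain e where e: "0 < e" "ball x e \<subseteq> S"
    using assms(2,3) open_contains_ball by blast
  have "ball x e \<subseteq> N" using e * N(2) by auto
  then have "emeasure lborel (ball x e) \<le> emeasure lborel N"
    using N(1) by (intro emeasure_mono) auto
  then have "emeasure lborel (ball x e) = 0" using N(1) by auto
  then have "measure lborel (ball x e) = 0" by (simp add: measure_def)
  then show False using content_ball_pos[OF e(1), of x] by simp
qed

section \<open>Pointwise Fourier inversion and the transform of the smoothed distribution\<close>

lemma lebesgue_measurable_AE_borel:
  fixes u :: "'a::euclidean_space \<Rightarrow> complex"
  assumes "u \<in> borel_measurable lebesgue"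
  obtains v where "v \<in> borel_measurable borel" "AE x in lborel. u x = v x"
proof -
  have "(\<lambda>x. Re (u x)) \<in> borel_measurable lebesgue" "(\<lambda>x. Im (u x)) \<in> borel_measurable lebesgue"
    using assms by measurable
  then obtain a b where ab: "a \<in> borel_measurable lborel" "AE x in lborel. Re (u x) = a x"
      "b \<in> borel_measurable lborel" "AE x in lborel. Im (u x) = b x"
    by (metis completion_ex_borel_measurable_real)
  show ?thesis
  proof (rule that[of "\<lambda>x. complex_of_real (a x) + \<i> * complex_of_real (b x)"])
    show "(\<lambda>x. complex_of_real (a x) + \<i> * complex_of_real (b x)) \<in> borel_measurable borel"
      using ab(1,3) by simp
    show "AE x in lborel. u x = complex_of_real (a x) + \<i> * complex_of_real (b x)"
      using ab(2,4) by eventually_elim (simp add: complex_eq_iff)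
  qed
qed

text \<open>Gaussian summability: with a factor \<open>gauss (\<epsilon> n *\<^sub>R y)\<close>
  inserted, Fubini turns the left side into a Gaussian mean of \<open>v\<close> around \<xi>0. The
  mean tends to \<open>v \<xi>0\<close> by continuity at that one point, and the factor tends to 1
  under domination by the inverse transform, integrable by assumption.\<close>

lemma fourier_inversion_at_continuity:
  fixes v :: "real^'d \<Rightarrow> complex"
  assumes v: "integrable lborel v" and C: "\<And>\<xi>. norm (v \<xi>) \<le> C" and cont: "isCont v \<xi>0"
    and N: "integrable lborel (\<lambda>y. LINT \<xi>|lborel. v \<xi> * wave y \<xi>)"
  shows "(LINT y|lborel. (LINT \<xi>|lborel. v \<xi> * wave y \<xi>) * wave y (- \<xi>0)) = v \<xi>0"
proof -
  let ?N = "\<lambda>y. LINT \<xi>|lborel. v \<xi> * wave y \<xi>"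
  have [measurable]: "v \<in> borel_measurable borel" using v by auto
  have [measurable]: "?N \<in> borel_measurable borel" using N by auto
  define \<epsilon> where "\<epsilon> n = 1 / real (n + 1)" for n
  have \<epsilon>: "0 < \<epsilon> n" for n by (simp add: \<epsilon>_def)
  have \<epsilon>0: "\<epsilon> \<longlonglongrightarrow> 0"
    unfolding \<epsilon>_def[abs_def] by (rule LIMSEQ_ignore_initial_segment[OF lim_const_over_n])
  have eq: "(LINT y|lborel. gauss (\<epsilon> n *\<^sub>R y) * (?N y * wave y (- \<xi>0))) =
      (LINT x|lborel. v (\<xi>0 + \<epsilon> n *\<^sub>R x) * gauss x)" for n
  proof -
    let ?E = "\<epsilon> n ^ CARD('d)"
    have "(LINT y|lborel. gauss (\<epsilon> n *\<^sub>R y) * (?N y * wave y (- \<xi>0))) =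
        (LINT y|lborel. gauss (\<epsilon> n *\<^sub>R y) * (LINT \<xi>|lborel. v \<xi> * wave y (\<xi> - \<xi>0)))"
    proof (rule Bochner_Integration.integral_cong[OF refl])
      fix y
      have "?N y * wave y (- \<xi>0) = (LINT \<xi>|lborel. v \<xi> * wave y \<xi> * wave y (- \<xi>0))" by simp
      also have "\<dots> = (LINT \<xi>|lborel. v \<xi> * wave y (\<xi> - \<xi>0))"
        by (simp add: wave_add(2)[symmetric] mult.assoc)
      finally show "gauss (\<epsilon> n *\<^sub>R y) * (?N y * wave y (- \<xi>0)) =
        gauss (\<epsilon> n *\<^sub>R y) * (LINT \<xi>|lborel. v \<xi> * wave y (\<xi> - \<xi>0))" by simp
    qed
    also have "\<dots> = (LINT \<xi>|lborel. v \<xi> * (LINT y|lborel. gauss (\<epsilon> n *\<^sub>R y) * wave y (\<xi> - \<xi>0)))"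
      by (rule Fubini_bounded_kernel(2)[OF gauss_scaled_integrable[OF \<epsilon>] v, where C=1]) auto
    finally have "?E *\<^sub>R (LINT y|lborel. gauss (\<epsilon> n *\<^sub>R y) * (?N y * wave y (- \<xi>0))) =
        ?E *\<^sub>R (LINT \<xi>|lborel. v \<xi> * (LINT y|lborel. gauss (\<epsilon> n *\<^sub>R y) * wave y (\<xi> - \<xi>0)))" by simp
    also have "\<dots> = (LINT \<xi>|lborel. ?E *\<^sub>R (v \<xi> * (LINT y|lborel. gauss (\<epsilon> n *\<^sub>R y) * wave y (\<xi> - \<xi>0))))"
      by simp
    also have "\<dots> = (LINT \<xi>|lborel. v \<xi> * gauss ((\<xi> - \<xi>0) /\<^sub>R \<epsilon> n))"
      by (simp only: mult_scaleR_right[symmetric] wave_commute[of _ "_ - \<xi>0"] gauss_scaled_ft[OF \<epsilon>])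
    also have "\<dots> = ?E *\<^sub>R (LINT x|lborel. v (\<xi>0 + \<epsilon> n *\<^sub>R x) * gauss x)"
      by (rule gauss_mean_eq[OF \<epsilon>]) measurable
    finally show ?thesis using \<epsilon>[of n] by simp
  qed
  have "(\<lambda>n. LINT y|lborel. gauss (\<epsilon> n *\<^sub>R y) * (?N y * wave y (- \<xi>0))) \<longlonglongrightarrow>
      (LINT y|lborel. ?N y * wave y (- \<xi>0))"
  proof (rule integral_dominated_convergence[where w="\<lambda>y. norm (?N y)"])
    show "integrable lborel (\<lambda>y. norm (?N y))" using N by (rule integrable_norm)
    show "AE y in lborel. (\<lambda>n. gauss (\<epsilon> n *\<^sub>R y) * (?N y * wave y (- \<xi>0))) \<longlonglongrightarrow> ?N y * wave y (- \<xi>0)"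
    proof (rule AE_I2)
      fix y :: "real^'d"
      have "(\<lambda>n. \<epsilon> n *\<^sub>R y) \<longlonglongrightarrow> 0 *\<^sub>R y" by (intro tendsto_intros \<epsilon>0)
      moreover have "continuous_on UNIV (gauss :: real^'d \<Rightarrow> complex)" by (intro continuous_intros)
      ultimately have "(\<lambda>n. gauss (\<epsilon> n *\<^sub>R y)) \<longlonglongrightarrow> gauss (0 *\<^sub>R y)"
        by (intro continuous_on_tendsto_compose[of UNIV gauss]) auto
      then have "(\<lambda>n. gauss (\<epsilon> n *\<^sub>R y) * (?N y * wave y (- \<xi>0))) \<longlonglongrightarrow> gauss (0 *\<^sub>R y) * (?N y * wave y (- \<xi>0))"
        by (intro tendsto_mult tendsto_const)
      then show "(\<lambda>n. gauss (\<epsilon> n *\<^sub>R y) * (?N y * wave y (- \<xi>0))) \<longlonglongrightarrow> ?N y * wave y (- \<xi>0)" by simp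
    qed
    show "AE y in lborel. norm (gauss (\<epsilon> n *\<^sub>R y) * (?N y * wave y (- \<xi>0))) \<le> norm (?N y)" for n
      using mult_right_mono[OF norm_gauss_le norm_ge_zero] by (auto simp: norm_mult)
  qed measurable
  moreover have "(\<lambda>n. LINT x|lborel. v (\<xi>0 + \<epsilon> n *\<^sub>R x) * gauss x) \<longlonglongrightarrow> v \<xi>0"
    by (rule gauss_mean_tendsto[OF _ C cont tendsto_const \<epsilon>0]) measurable
  ultimately show ?thesis unfolding eq by (rule LIMSEQ_unique)
qed

lemma matrix_inv_mat_1: "matrix_inv (mat 1 :: real^'d^'d) = mat 1"
proof -
  have "invertible (mat 1 :: real^'d^'d)"
    unfolding invertible_def by (intro exI[of _ "mat 1"]) simp
  from matrix_inv_vector(3)[OF this] show ?thesis by simp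
qed

text \<open>On the open cube the function \<open>\<eta> \<cdot> cnj (fourier_function \<psi>)\<close> agrees almost everywhere with
  \<open>1 / fourier \<phi>\<close>, hence with a continuous function there, so that inversion holds at every point.\<close>

lemma smoothed_reflection_fourier:
  fixes \<eta> :: "real^'d \<Rightarrow> real"
  assumes \<eta>: "cutoff \<eta>" and \<psi>: "has_fourier_function \<psi>"
    and \<phi>: "integrable lborel \<phi>" and compat: "strictly_compatible \<delta> \<phi> \<psi>" and \<delta>: "0 < \<delta>" "\<delta> \<le> 1"
    and N_int: "integrable lebesgue (smoothed_reflection \<eta> (mat 1) \<psi>)"
  obtains C where "\<And>x. norm (smoothed_reflection \<eta> (mat 1) \<psi> x) \<le> C"
    "integrable lborel (smoothed_reflection \<eta> (mat 1) \<psi>)"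
    "\<And>\<xi>. (\<forall>i. \<bar>\<xi> $ i\<bar> < \<delta> / 2) \<Longrightarrow>
      (LINT y|lborel. smoothed_reflection \<eta> (mat 1) \<psi> y * wave y (- \<xi>)) * (LINT x|lborel. \<phi> x * wave x (- \<xi>)) = 1"
proof -
  let ?N = "smoothed_reflection \<eta> (mat 1) \<psi>"
  define h where "h = fourier_function \<psi>"
  have "is_function (fourier_dist \<psi>) h \<and> locally_bounded h"
    unfolding h_def fourier_function_def using \<psi> unfolding has_fourier_function_def by (rule someI_ex)
  then have h: "h \<in> borel_measurable lebesgue" "locally_bounded h" by (auto simp: is_function_def)
  define Q :: "(real^'d) set" where "Q = (*\<^sub>R) 2 ` unit_cube"
  have cube: "unit_cube = {x :: real^'d. \<forall>i. \<bar>x $ i\<bar> \<le> 1/2}" by (simp add: unit_cube_def)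
  have "compact Q" unfolding Q_def cube by (intro compact_scaling compact_closure_cell)
  have Q [measurable]: "Q \<in> sets borel" using \<open>compact Q\<close> by (rule borel_compact)
  have Q_fin: "emeasure lborel Q < \<infinity>"
    using \<open>compact Q\<close> by (intro emeasure_bounded_finite compact_imp_bounded)
  have \<eta>_cont: "continuous_on UNIV \<eta>"
  proof -
    have "smooth \<eta>" using \<eta> by (simp add: cutoff_def)
    then have "partial_derivs [] \<eta> differentiable_on UNIV" unfolding smooth_def by blast
    then show ?thesis by (simp add: differentiable_imp_continuous_on)
  qed
  have [measurable]: "\<eta> \<in> borel_measurable borel" by (rule borel_measurable_continuous_onI[OF \<eta>_cont])
  have \<eta>1: "\<eta> \<xi> = 1" if "\<xi> \<in> unit_cube" for \<xi> using \<eta> that by (simp add: cutoff_def)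
  have \<eta>0: "\<eta> \<xi> = 0" if "\<xi> \<notin> Q" for \<xi> using \<eta> that by (simp add: cutoff_def Q_def)
  define u where "u \<xi> = complex_of_real (\<eta> \<xi>) * cnj (h \<xi>)" for \<xi>
  have \<eta>_leb: "\<eta> \<in> borel_measurable lebesgue"
    by (rule measurable_completion) simp
  have u_meas: "u \<in> borel_measurable lebesgue"
    unfolding u_def using h(1) \<eta>_leb by measurable
  have "bounded (\<eta> ` Q)"
    using \<open>compact Q\<close> \<eta>_cont by (meson compact_continuous_image compact_imp_bounded continuous_on_subset subset_UNIV)
  moreover have "bounded (h ` Q)" using h(2) \<open>compact Q\<close> by (simp add: locally_bounded_def)
  ultimately obtain A1 A2 where A: "\<And>\<xi>. \<xi> \<in> Q \<Longrightarrow> \<bar>\<eta> \<xi>\<bar> \<le> A1" "\<And>\<xi>. \<xi> \<in> Q \<Longrightarrow> norm (h \<xi>) \<le> A2"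
    unfolding bounded_iff by auto
  \<comment> \<open>The maximum with 1 keeps the later lower bound 1 / A meaningful.\<close>
  define A where "A = max 1 (A1 * A2)"
  have A1: "1 \<le> A" by (simp add: A_def)
  have u_bound: "norm (u \<xi>) \<le> A" for \<xi>
  proof (cases "\<xi> \<in> Q")
    case True
    have "norm (u \<xi>) = \<bar>\<eta> \<xi>\<bar> * norm (h \<xi>)" by (simp add: u_def norm_mult)
    also have "\<dots> \<le> A1 * A2"
      using A[OF True] by (intro mult_mono) (auto intro: order_trans[OF abs_ge_zero])
    finally show ?thesis by (simp add: A_def)
  next
    case False
    then show ?thesis using A1 by (simp add: u_def \<eta>0)
  qed
  have N_eq: "?N x = (LINT \<xi>|lebesgue. u \<xi> * wave x \<xi>)" for x
    by (simp add: smoothed_reflection_def inv_fourier_eq u_def h_def transpose_mat matrix_inv_mat_1)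
  define p where "p \<xi> = (LINT x|lborel. \<phi> x * wave x (- \<xi>))" for \<xi>
  have p_cont: "continuous_on UNIV p"
    unfolding p_def by (rule continuous_on_integral_kernel[OF \<phi>, where C=1]) (auto intro!: continuous_intros)
  have [measurable]: "p \<in> borel_measurable borel" by (rule borel_measurable_continuous_onI[OF p_cont])
  have [measurable]: "\<phi> \<in> borel_measurable borel" using \<phi> by auto
  have p_fourier: "fourier \<phi> \<xi> = p \<xi>" for \<xi>
    unfolding fourier_eq p_def by (rule lebesgue_integral_lborel(1)) measurable
  define S where "S = {\<xi> :: real^'d. \<forall>i. \<bar>\<xi> $ i\<bar> < \<delta> / 2}"
  have S_eq: "S = (\<Inter>i. {\<xi>. \<bar>\<xi> $ i\<bar> < \<delta> / 2})" by (auto simp: S_def)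
  have "open S"
    unfolding S_eq by (intro open_INT finite ballI open_Collect_less continuous_intros)
  then have [measurable]: "S \<in> sets borel" by (rule borel_open)
  have S_sub: "\<xi> \<in> (*\<^sub>R) \<delta> ` unit_cube" "\<xi> \<in> unit_cube" "\<xi> \<in> Q" if "\<xi> \<in> S" for \<xi>
  proof -
    have x: "\<bar>\<xi> $ i\<bar> < \<delta> / 2" for i using that by (simp add: S_def)
    have "\<xi> /\<^sub>R \<delta> \<in> unit_cube"
      unfolding unit_cube_def using x \<delta> by (auto simp: abs_mult field_simps intro: less_imp_le)
    then show "\<xi> \<in> (*\<^sub>R) \<delta> ` unit_cube" using \<delta> by (intro image_eqI[of _ _ "\<xi> /\<^sub>R \<delta>"]) auto
    have x1: "\<bar>\<xi> $ i\<bar> < 1 / 2" for i using x[of i] \<delta> by linarith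
    then show "\<xi> \<in> unit_cube" unfolding unit_cube_def by (auto intro: less_imp_le)
    have "(1/2) *\<^sub>R \<xi> \<in> unit_cube"
    proof -
      have "\<bar>((1/2) *\<^sub>R \<xi>) $ i\<bar> \<le> 1/2" for i using x1[of i] by (simp add: abs_mult)
      then show ?thesis unfolding unit_cube_def by blast
    qed
    then show "\<xi> \<in> Q" unfolding Q_def by (intro image_eqI[of _ _ "(1/2) *\<^sub>R \<xi>"]) auto
  qed
  have pu: "AE \<xi> in lborel. \<xi> \<in> S \<longrightarrow> p \<xi> * u \<xi> = 1"
  proof -
    have "AE \<xi> in lborel. \<xi> \<in> (*\<^sub>R) \<delta> ` unit_cube \<longrightarrow> cnj (p \<xi>) * h \<xi> = 1"
      using compat unfolding strictly_compatible_def p_fourier h_def by (simp add: AE_completion_iff)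
    then show ?thesis
    proof eventually_elim
      case (elim \<xi>)
      show ?case
      proof
        assume \<xi>: "\<xi> \<in> S"
        then have "cnj (p \<xi>) * h \<xi> = 1" using elim S_sub by blast
        then have "cnj (cnj (p \<xi>) * h \<xi>) = 1" by simp
        then show "p \<xi> * u \<xi> = 1" using \<eta>1[OF S_sub(2)[OF \<xi>]] by (simp add: u_def)
      qed
    qed
  qed
  \<comment> \<open>Almost everywhere on \<open>S\<close> the product of \<open>p\<close> and
    \<open>u\<close> is 1 and \<open>u\<close> is bounded by \<open>A\<close>. By continuity of
    \<open>p\<close>, a violation at one point would spread to an open set, which must contain a
    point where the relation holds.\<close>
  have p_ge: "1 / A \<le> norm (p \<xi>)" if "\<xi> \<in> S" for \<xi>
  proof (rule ccontr)
    assume "\<not> 1 / A \<le> norm (p \<xi>)"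
    then have "\<xi> \<in> S \<inter> {\<zeta>. norm (p \<zeta>) < 1 / A}" using that by simp
    moreover have "open (S \<inter> {\<zeta>. norm (p \<zeta>) < 1 / A})"
      by (intro open_Int \<open>open S\<close> open_Collect_less continuous_intros p_cont)
    ultimately obtain \<zeta> where \<zeta>: "\<zeta> \<in> S" "norm (p \<zeta>) < 1 / A" "p \<zeta> * u \<zeta> = 1"
      using AE_lborel_open_ex[OF pu] by blast
    have "1 = norm (p \<zeta>) * norm (u \<zeta>)" using \<zeta>(3) by (metis norm_mult norm_one)
    also have "\<dots> \<le> norm (p \<zeta>) * A" using u_bound by (intro mult_left_mono) auto
    also have "\<dots> < 1" using \<zeta>(2) A1 by (simp add: field_simps)
    finally show False by simp
  qed
  have p_nz: "p \<xi> \<noteq> 0" if "\<xi> \<in> S" for \<xi>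
  proof -
    have "0 < 1 / A" using A1 by simp
    with p_ge[OF that] have "0 < norm (p \<xi>)" by linarith
    then show ?thesis by simp
  qed
  obtain w where w [measurable]: "w \<in> borel_measurable borel" and uw: "AE \<xi> in lborel. u \<xi> = w \<xi>"
    using lebesgue_measurable_AE_borel[OF u_meas] by blast
  \<comment> \<open>A Borel version of \<open>u\<close>. Putting 1 / p on \<open>S\<close> makes it
    continuous at every point of the open cube; off \<open>S\<close> the truncation makes the bound
    and the compact support hold everywhere, not just almost everywhere.\<close>
  define v where "v \<xi> = (if \<xi> \<in> S then 1 / p \<xi> else if \<xi> \<in> Q \<and> norm (w \<xi>) \<le> A then w \<xi> else 0)" for \<xi>
  have v_meas [measurable]: "v \<in> borel_measurable borel" unfolding v_def by measurable
  have uv: "AE \<xi> in lborel. u \<xi> = v \<xi>"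
    using pu uw
  proof eventually_elim
    case (elim \<xi>)
    show ?case
    proof (cases "\<xi> \<in> S")
      case True
      then show ?thesis using elim p_nz[OF True] by (simp add: v_def field_simps)
    next
      case False
      then show ?thesis using elim u_bound[of \<xi>] \<eta>0[of \<xi>] by (auto simp: v_def u_def)
    qed
  qed
  have v_bound: "norm (v \<xi>) \<le> A * indicator Q \<xi>" for \<xi>
    using p_ge[of \<xi>] S_sub(3)[of \<xi>] A1 p_nz[of \<xi>] by (auto simp: v_def norm_divide field_simps)
  then have v_bound': "norm (v \<xi>) \<le> A" for \<xi>
    using A1 order_trans[OF v_bound[of \<xi>], of A] by (auto simp: indicator_def)
  have v_int: "integrable lborel v"
  proof (rule Bochner_Integration.integrable_bound[of _ "\<lambda>\<xi>. A * indicator Q \<xi>"])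
    show "integrable lborel (\<lambda>\<xi>. A * indicator Q \<xi>)"
      using Q_fin by (intro integrable_mult_right integrable_real_indicator) auto
    show "AE \<xi> in lborel. norm (v \<xi>) \<le> norm (A * indicator Q \<xi>)"
      using order_trans[OF v_bound abs_ge_self] by simp
  qed simp
  have N_v: "?N = (\<lambda>x. LINT \<xi>|lborel. v \<xi> * wave x \<xi>)"
  proof
    fix x
    have m: "(\<lambda>\<xi>. v \<xi> * wave x \<xi>) \<in> borel_measurable borel" by measurable
    have wl: "(\<lambda>\<xi>. wave x \<xi>) \<in> borel_measurable lebesgue"
      by (rule measurable_completion) simp
    have "?N x = (LINT \<xi>|lebesgue. v \<xi> * wave x \<xi>)"
      unfolding N_eq
    proof (rule integral_cong_AE)
      show "(\<lambda>\<xi>. u \<xi> * wave x \<xi>) \<in> borel_measurable lebesgue"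
        using u_meas wl by measurable
      show "(\<lambda>\<xi>. v \<xi> * wave x \<xi>) \<in> borel_measurable lebesgue"
        by (rule measurable_completion) (use m in simp)
      have "AE \<xi> in lebesgue. u \<xi> = v \<xi>" using uv by (rule AE_completion)
      then show "AE \<xi> in lebesgue. u \<xi> * wave x \<xi> = v \<xi> * wave x \<xi>" by eventually_elim simp
    qed
    also have "\<dots> = (LINT \<xi>|lborel. v \<xi> * wave x \<xi>)"
      by (rule lebesgue_integral_lborel(1)[OF m])
    finally show "?N x = (LINT \<xi>|lborel. v \<xi> * wave x \<xi>)" .
  qed
  have N_cont: "continuous_on UNIV ?N"
    unfolding N_v by (rule continuous_on_integral_kernel[OF v_int, where C=1]) (auto intro!: continuous_intros)
  have N_bound: "norm (?N x) \<le> (LINT \<xi>|lborel. norm (v \<xi>))" for x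
    unfolding N_v by (rule order_trans[OF integral_norm_bound]) (simp add: norm_mult)
  have N_int': "integrable lborel ?N"
    using N_int lebesgue_integral_lborel(2)[OF borel_measurable_continuous_onI[OF N_cont]] by simp
  show ?thesis
  proof (rule that[OF N_bound N_int'])
    fix \<xi> :: "real^'d" assume "\<forall>i. \<bar>\<xi> $ i\<bar> < \<delta> / 2"
    then have \<xi>: "\<xi> \<in> S" by (simp add: S_def)
    have "isCont v \<xi>"
    proof -
      have "isCont (\<lambda>\<zeta>. 1 / p \<zeta>) \<xi>"
        using p_cont p_nz[OF \<xi>] by (intro continuous_intros) (auto simp: continuous_on_eq_continuous_at)
      moreover have ev: "\<forall>\<^sub>F \<zeta> in nhds \<xi>. 1 / p \<zeta> = v \<zeta>"
        using eventually_nhds_in_open[OF \<open>open S\<close> \<xi>] by eventually_elim (simp add: v_def)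
      ultimately show ?thesis using isCont_cong[OF ev] by simp
    qed
    then have "(LINT y|lborel. ?N y * wave y (- \<xi>)) = v \<xi>"
      unfolding N_v using N_int' by (intro fourier_inversion_at_continuity[OF v_int v_bound']) (simp_all add: N_v)
    then show "(LINT y|lborel. ?N y * wave y (- \<xi>)) * (LINT x|lborel. \<phi> x * wave x (- \<xi>)) = 1"
      using p_nz[OF \<xi>] \<xi> by (simp add: v_def p_def[symmetric])
  qed
qed

text \<open>Termwise integration, dominated by the absolutely convergent sum of the values of \<phi>
  times the integral of the norm of \<open>N\<close>. It is stated for any bounded \<open>g\<close>
  so as to serve twice: for the sampled function and for characters, which gives the transform of
  the kernel. The lattice point k of the expansion is \<open>- e n\<close>.\<close>

lemma lattice_series:
  fixes \<phi> N g :: "real^'d \<Rightarrow> complex"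
  assumes \<phi>: "\<phi> \<in> class_LC" and e: "bij_betw e UNIV int_lattice"
    and N: "integrable lborel N" "\<And>x. norm (N x) \<le> C"
    and g: "g \<in> borel_measurable borel" "\<And>x. norm (g x) \<le> K"
  shows "(\<lambda>n. \<phi> (z + e n) * (LINT y|lborel. g y * N (- e n - y))) sums
      (LINT y|lborel. g y * (\<Sum>n. \<phi> (z + e n) * N (- e n - y)))"
    and "integrable lborel (\<lambda>y. \<Sum>n. \<phi> (z + e n) * N (- e n - y))"
    and "summable (\<lambda>n. norm (\<phi> (z + e n) * (LINT y|lborel. g y * N (- e n - y))))"
proof -
  have [measurable]: "N \<in> borel_measurable borel" "g \<in> borel_measurable borel" using N g by auto
  have "(\<lambda>n. norm (\<phi> (z + e n))) summable_on UNIV"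
    using class_LC_summable[OF \<phi>, of z] by (subst summable_on_reindex_bij_betw[OF e])
  then have sum: "summable (\<lambda>n. norm (\<phi> (z + e n)))" by (rule summable_on_imp_summable)
  have Nk: "integrable lborel (\<lambda>y. N (k - y))" "(LINT y|lborel. norm (N (k - y))) = (LINT y|lborel. norm (N y))" for k
    using lborel_integrable_affine_iff[of "-1" N k] N(1) lborel_integral_affine[of "-1" "\<lambda>y. norm (N y)" k] by simp_all
  have sumN: "summable (\<lambda>n. norm (\<phi> (z + e n) * N (- e n - y)))" for y
    by (rule summable_comparison_test'[OF summable_mult2[OF sum, of C]])
      (use N(2) in \<open>auto simp: norm_mult intro!: mult_left_mono\<close>)
  have *: "(\<lambda>n. LINT y|lborel. u y * (\<phi> (z + e n) * N (- e n - y))) sums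
      (LINT y|lborel. (\<Sum>n. u y * (\<phi> (z + e n) * N (- e n - y))))"
      "integrable lborel (\<lambda>y. \<Sum>n. u y * (\<phi> (z + e n) * N (- e n - y)))"
      "summable (\<lambda>n. norm (\<phi> (z + e n) * (LINT y|lborel. u y * N (- e n - y))))"
    if u [measurable]: "u \<in> borel_measurable borel" and L: "\<And>x. norm (u x) \<le> L" for u L
  proof -
    have L0: "0 \<le> L" using L[of 0] norm_ge_zero order_trans by blast
    have I: "integrable lborel (\<lambda>y. u y * (\<phi> (z + e n) * N (- e n - y)))" for n
      by (rule integrable_mult_bounded(2)[OF _ _ L]) (use Nk(1) in auto)
    have I': "integrable lborel (\<lambda>y. u y * N (- e n - y))" for n
      by (rule integrable_mult_bounded(2)[OF Nk(1) _ L]) simp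
    have S: "AE y in lborel. summable (\<lambda>n. norm (u y * (\<phi> (z + e n) * N (- e n - y))))"
      by (rule AE_I2) (subst norm_mult, rule summable_mult[OF sumN])
    have b: "(LINT y|lborel. norm (u y * (\<phi> (z + e n) * N (- e n - y)))) \<le>
        norm (\<phi> (z + e n)) * (L * (LINT y|lborel. norm (N y)))" for n
    proof -
      have "(LINT y|lborel. norm (u y * (\<phi> (z + e n) * N (- e n - y)))) \<le>
          (LINT y|lborel. (norm (\<phi> (z + e n)) * L) * norm (N (- e n - y)))"
      proof (rule integral_mono[OF integrable_norm[OF I]])
        show "integrable lborel (\<lambda>y. (norm (\<phi> (z + e n)) * L) * norm (N (- e n - y)))"
          using Nk(1) by auto
        fix y
        have "norm (u y) * (norm (\<phi> (z + e n)) * norm (N (- e n - y))) \<le> L * (norm (\<phi> (z + e n)) * norm (N (- e n - y)))"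
          using L by (intro mult_right_mono) auto
        then show "norm (u y * (\<phi> (z + e n) * N (- e n - y))) \<le> (norm (\<phi> (z + e n)) * L) * norm (N (- e n - y))"
          by (simp add: norm_mult mult_ac)
      qed
      also have "\<dots> = norm (\<phi> (z + e n)) * (L * (LINT y|lborel. norm (N y)))"
        by (simp add: Nk(2) mult.assoc)
      finally show ?thesis .
    qed
    have M: "summable (\<lambda>n. LINT y|lborel. norm (u y * (\<phi> (z + e n) * N (- e n - y))))"
      by (rule summable_comparison_test'[OF summable_mult2[OF sum, of "L * (LINT y|lborel. norm (N y))"]])
        (use b in auto)
    show "(\<lambda>n. LINT y|lborel. u y * (\<phi> (z + e n) * N (- e n - y))) sums
        (LINT y|lborel. (\<Sum>n. u y * (\<phi> (z + e n) * N (- e n - y))))"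
      by (rule sums_integral[OF I S M])
    show "integrable lborel (\<lambda>y. \<Sum>n. u y * (\<phi> (z + e n) * N (- e n - y)))"
      by (rule integrable_suminf[OF I S M])
    show "summable (\<lambda>n. norm (\<phi> (z + e n) * (LINT y|lborel. u y * N (- e n - y))))"
    proof (rule summable_comparison_test'[OF M])
      fix n
      have "norm (\<phi> (z + e n) * (LINT y|lborel. u y * N (- e n - y))) =
          norm (LINT y|lborel. u y * (\<phi> (z + e n) * N (- e n - y)))"
        by (subst integral_mult_right_zero[symmetric]) (simp add: mult_ac)
      also have "\<dots> \<le> (LINT y|lborel. norm (u y * (\<phi> (z + e n) * N (- e n - y))))"
        by (rule integral_norm_bound)
      finally show "norm (norm (\<phi> (z + e n) * (LINT y|lborel. u y * N (- e n - y)))) \<le>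
          (LINT y|lborel. norm (u y * (\<phi> (z + e n) * N (- e n - y))))" by simp
    qed
  qed
  have "(\<Sum>n. g y * (\<phi> (z + e n) * N (- e n - y))) = g y * (\<Sum>n. \<phi> (z + e n) * N (- e n - y))" for y
    by (rule suminf_mult[OF summable_norm_cancel[OF sumN]])
  moreover have "(LINT y|lborel. g y * (\<phi> (z + e n) * N (- e n - y))) =
      \<phi> (z + e n) * (LINT y|lborel. g y * N (- e n - y))" for n
    by (subst integral_mult_right_zero[symmetric]) (simp add: mult_ac)
  ultimately show "(\<lambda>n. \<phi> (z + e n) * (LINT y|lborel. g y * N (- e n - y))) sums
      (LINT y|lborel. g y * (\<Sum>n. \<phi> (z + e n) * N (- e n - y)))"
    using *(1)[OF g] by simp
  show "integrable lborel (\<lambda>y. \<Sum>n. \<phi> (z + e n) * N (- e n - y))"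
    using *(2)[of "\<lambda>_. 1" 1] by simp
  show "summable (\<lambda>n. norm (\<phi> (z + e n) * (LINT y|lborel. g y * N (- e n - y))))"
    by (rule *(3)[OF g])
qed

theorem theorem17:
  fixes M :: "real^'d^'d" and \<delta> :: real and \<alpha> :: "real^'d^'d \<Rightarrow> real" and j :: nat
    and \<eta> :: "real^'d \<Rightarrow> real"
    and \<phi> :: "real^'d \<Rightarrow> complex"
    and \<psi> :: "(real^'d \<Rightarrow> complex) \<Rightarrow> complex"
    and f :: "real^'d \<Rightarrow> complex"
  assumes "dilation_matrix M"
    and "unit_cube \<subseteq> (*v) (transpose M) ` unit_cube"
    and "0 < \<delta>" and "\<delta> \<le> 1"
    and "\<alpha> \<in> class_A M"
    and "cutoff \<eta>"
    and "\<psi> \<in> class_S' \<eta> \<alpha> M"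
    and "\<phi> \<in> class_LC"
    and "fun_supp (fourier \<phi>) \<subseteq> unit_cube"
    and "strictly_compatible \<delta> \<phi> \<psi>"
    and "f \<in> band_limited (\<delta> *\<^sub>R mat_pow M j)"
  shows "\<forall>x. ((\<lambda>k. convolution (\<lambda>y. f (matrix_inv (mat_pow M j) *v y))
                      (smoothed_reflection \<eta> (mat 1) \<psi>) k
                   * \<phi> (mat_pow M j *v x - k)) has_sum f x) int_lattice"
proof
  fix x :: "real^'d"
  define B where "B = mat_pow M j"
  define N where "N = smoothed_reflection \<eta> (mat 1) \<psi>"
  define z where "z = B *v x"
  define p where "p \<xi> = (LINT x|lborel. \<phi> x * wave x (- \<xi>))" for \<xi>
  have B: "invertible B"
    unfolding B_def by (rule invertible_mat_pow[OF invertible_dilation_matrix[OF assms(1)]])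
  note Binv = matrix_inv_vector[OF B]
  have \<phi>_int: "integrable lborel \<phi>" by (rule class_LC_integrable[OF assms(8)])
  then have [measurable]: "\<phi> \<in> borel_measurable borel" by auto
  have "has_fourier_function \<psi>" "integrable lebesgue (smoothed_reflection \<eta> (mat_pow M 0) \<psi>)"
    using assms(7) unfolding class_S'_def by blast+
  then have N0: "has_fourier_function \<psi>" "integrable lebesgue (smoothed_reflection \<eta> (mat 1) \<psi>)" by simp_all
  obtain C where N: "\<And>y. norm (N y) \<le> C" "integrable lborel N"
    and Np: "\<And>\<xi>. (\<forall>i. \<bar>\<xi> $ i\<bar> < \<delta> / 2) \<Longrightarrow> (LINT y|lborel. N y * wave y (- \<xi>)) * p \<xi> = 1"
    unfolding N_def p_def
    using smoothed_reflection_fourier[OF assms(6) N0(1) \<phi>_int assms(10,3,4) N0(2)] by blast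
  have N_meas [measurable]: "N \<in> borel_measurable borel" using N(2) by auto
  have f_cont: "continuous_on UNIV f" and "bounded (range f)"
    and f_supp: "dist_supp (fourier_dist (functional_of f)) \<subseteq> (*v) (transpose (\<delta> *\<^sub>R B)) ` unit_cube"
    using assms(11) by (auto simp: band_limited_def B_def)
  then obtain K where K: "\<And>y. norm (f y) \<le> K" unfolding bounded_iff by auto
  have [measurable]: "f \<in> borel_measurable borel" by (rule borel_measurable_continuous_onI[OF f_cont])
  define g where "g y = f (matrix_inv B *v y)" for y
  have [measurable]: "(*v) A \<in> borel_measurable borel" for A :: "real^'d^'d"
    by (intro borel_measurable_continuous_onI continuous_intros)
  have g: "g \<in> borel_measurable borel" "\<And>y. norm (g y) \<le> K"
    unfolding g_def using K by auto
  have conv: "convolution g N k = (LINT y|lborel. g y * N (k - y))" for k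
  proof -
    have [measurable]: "g \<in> borel_measurable borel" by (rule g)
    have "convolution g N k = (LINT y|lborel. g (k - y) * N y)"
      unfolding convolution_def by (rule lebesgue_integral_lborel(1)) measurable
    also have "\<dots> = (LINT y|lborel. g y * N (k - y))"
      using lborel_integral_affine[of "-1" "\<lambda>y. g (k - y) * N y" k] by simp
    finally show ?thesis .
  qed
  obtain e :: "nat \<Rightarrow> real^'d" where e: "bij_betw e UNIV int_lattice" by (rule int_lattice_enumeration)
  have eL: "e n \<in> int_lattice" for n using e by (auto simp: bij_betw_def)
  \<comment> \<open>The \<open>G\<close> of the overview, with the lattice enumerated by k = - e
    n.\<close>
  define G where "G y = (\<Sum>n. \<phi> (z + e n) * N (- e n - y))" for y
  have G_int: "integrable lborel G"
    unfolding G_def by (rule lattice_series(2)[OF assms(8) e N(2,1) g])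
  have [measurable]: "G \<in> borel_measurable borel" using G_int by auto
  \<comment> \<open>The strict bound matters: a nonzero lattice vector has a coordinate of modulus
    at least 1, so it moves \<xi> out of the closed cube carrying the transform of \<phi>.\<close>
  have poisson: "((\<lambda>k. \<phi> (z + k) * wave (z + k) (- \<xi>)) has_sum p \<xi>) int_lattice"
    if \<xi>: "\<forall>i. \<bar>\<xi> $ i\<bar> < 1 / 2" for \<xi>
    unfolding p_def
  proof (rule poisson_summation[OF assms(8)])
    fix m :: "real^'d" assume m: "m \<in> int_lattice" "m \<noteq> 0"
    then obtain i where "m $ i \<noteq> 0" by (auto simp: vec_eq_iff)
    moreover have "m $ i \<in> \<int>" using m by (simp add: int_lattice_def)
    ultimately have "1 \<le> \<bar>m $ i\<bar>" by (rule Ints_nonzero_abs_ge1[rotated])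
    then have "1/2 < \<bar>(\<xi> + m) $ i\<bar>" using \<xi>[rule_format, of i] unfolding vector_add_component by linarith
    then have "\<xi> + m \<notin> unit_cube"
      unfolding unit_cube_def mem_Collect_eq not_all not_le by blast
    then have "\<xi> + m \<notin> {\<zeta>. fourier \<phi> \<zeta> \<noteq> 0}"
      using assms(9) closure_subset[of "{\<zeta>. fourier \<phi> \<zeta> \<noteq> 0}"] unfolding fun_supp_def by blast
    then show "(LINT x|lborel. \<phi> x * wave x (- (\<xi> + m))) = 0"
      unfolding mem_Collect_eq not_not fourier_eq
      by (subst lebesgue_integral_lborel(1)[symmetric]) auto
  qed
  \<comment> \<open>Every translate of \<open>N\<close> contributes the same transform
    \<open>?n\<close> up to a character, the \<phi>-terms add up to \<open>p \<xi>\<close> by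
    Poisson summation, and \<open>?n * p \<xi>\<close> is 1.\<close>
  have G_ft: "(LINT y|lborel. wave y \<xi> * G y) = wave z \<xi>" if \<xi>: "\<forall>i. \<bar>\<xi> $ i\<bar> < \<delta> / 2" for \<xi>
  proof -
    let ?n = "LINT y|lborel. N y * wave y (- \<xi>)"
    have N_ft: "(LINT y|lborel. wave y \<xi> * N (- k - y)) = wave (- k) \<xi> * ?n" for k
    proof -
      have "(LINT y|lborel. wave y \<xi> * N (- k - y)) = (LINT y|lborel. wave (- k - y) \<xi> * N y)"
        using lborel_integral_affine[of "-1" "\<lambda>y. wave y \<xi> * N (- k - y)" "- k"] by simp
      also have "\<dots> = (LINT y|lborel. wave (- k) \<xi> * (N y * wave y (- \<xi>)))"
        by (simp add: wave_diff(1)[of "- k"] wave_minus(2) mult_ac)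
      finally show ?thesis by simp
    qed
    have "(\<lambda>n. \<phi> (z + e n) * (LINT y|lborel. wave y \<xi> * N (- e n - y))) sums (LINT y|lborel. wave y \<xi> * G y)"
      unfolding G_def by (rule lattice_series(1)[OF assms(8) e N(2,1), of _ 1]) auto
    moreover have "\<phi> (z + e n) * (LINT y|lborel. wave y \<xi> * N (- e n - y)) =
        (wave z \<xi> * ?n) * (\<phi> (z + e n) * wave (z + e n) (- \<xi>))" for n
      by (simp add: N_ft wave_add wave_minus mult_ac)
    ultimately have 1: "(\<lambda>n. (wave z \<xi> * ?n) * (\<phi> (z + e n) * wave (z + e n) (- \<xi>))) sums (LINT y|lborel. wave y \<xi> * G y)"
      by simp
    have "\<forall>i. \<bar>\<xi> $ i\<bar> < 1 / 2" using \<xi> assms(4) by (auto intro: less_le_trans)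
    from poisson[OF this] have "((\<lambda>n. \<phi> (z + e n) * wave (z + e n) (- \<xi>)) has_sum p \<xi>) UNIV"
      by (subst has_sum_reindex_bij_betw[OF e])
    then have "(\<lambda>n. (wave z \<xi> * ?n) * (\<phi> (z + e n) * wave (z + e n) (- \<xi>))) sums ((wave z \<xi> * ?n) * p \<xi>)"
      by (intro sums_mult has_sum_imp_sums)
    from sums_unique2[OF 1 this] show ?thesis using Np[OF \<xi>] by (simp add: mult.assoc)
  qed
  obtain c where c: "0 < c"
    and c_int: "\<And>u :: real^'d \<Rightarrow> complex. u \<in> borel_measurable borel \<Longrightarrow>
       integrable lborel (\<lambda>x. u (B *v x)) \<longleftrightarrow> integrable lborel u"
    and c_eq: "\<And>u :: real^'d \<Rightarrow> complex. u \<in> borel_measurable borel \<Longrightarrow>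
       (LINT x|lborel. u (B *v x)) = c *\<^sub>R (LINT x|lborel. u x)"
    using lborel_matrix_substitution[OF B, where 'b=complex] by metis
  \<comment> \<open>\<open>G\<close> lives in the variable B y. The factor 1 / c compensates the
    substitution, and the conjugate matches \<open>spectral_synthesis\<close>, which pairs with
    \<open>cnj f\<close> and takes transforms at \<open>- \<xi>\<close>.\<close>
  define H where "H y = (1 / c) *\<^sub>R cnj (G (B *v y))" for y
  \<comment> \<open>The inverse of the transpose of \<open>B\<close>; divided by \<delta>, it
    carries the set containing the spectrum back to the unit cube.\<close>
  define T where "T = transpose (matrix_inv B)"
  have TB: "T *v (transpose B *v v) = v" for v
    by (simp only: T_def matrix_vector_mul_assoc matrix_transpose_mul[symmetric] Binv(3) transpose_mat matrix_vector_mul_lid)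
  obtain D where "bump D"
    using cutoff_imp_bump_derivatives[OF assms(6)] unfolding bump_def by metis
  then interpret bump D .
  have "(LINT y|lborel. H y * cnj (f y)) = cnj (f x)"
  proof (rule spectral_synthesis[OF f_cont K f_supp])
    show "((1 / \<delta>) *\<^sub>R T) *v (transpose (\<delta> *\<^sub>R B) *v v) = v" for v
    proof -
      have "transpose (\<delta> *\<^sub>R B) = \<delta> *\<^sub>R transpose B" by (simp add: transpose_def vec_eq_iff)
      then show ?thesis
        using assms(3) by (simp add: scaleR_matrix_vector_assoc[symmetric] matrix_vector_mult_scaleR TB
            del: transpose_matrix_vector)
    qed
    have "integrable lborel (\<lambda>y. cnj (G (B *v y)))"
      using c_int[of "\<lambda>y. cnj (G y)"] G_int by simp
    then show "integrable lborel H" unfolding H_def by (rule integrable_scaleR_right)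
    fix \<xi> :: "real^'d" assume "\<forall>i. \<bar>(((1 / \<delta>) *\<^sub>R T) *v \<xi>) $ i\<bar> < 1 / 2"
    then have \<xi>: "\<forall>i. \<bar>(T *v \<xi>) $ i\<bar> < \<delta> / 2"
      using assms(3) by (simp add: scaleR_matrix_vector_assoc[symmetric] abs_mult field_simps)
    have wT: "wave (B *v y) (T *v \<xi>) = wave y \<xi>" for y
      unfolding wave_def T_def by (simp add: inner_commute[of "B *v y"] dot_lmul_matrix Binv inner_commute[of \<xi>])
    have "(LINT y|lborel. H y * wave y (- \<xi>)) = (LINT y|lborel. (1 / c) *\<^sub>R cnj (wave (B *v y) (T *v \<xi>) * G (B *v y)))"
      by (simp add: H_def wT wave_minus mult.commute)
    also have "\<dots> = cnj ((1 / c) *\<^sub>R (LINT y|lborel. wave (B *v y) (T *v \<xi>) * G (B *v y)))"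
      by (simp only: complex_cnj_scaleR integral_scaleR_right Bochner_Integration.integral_cnj)
    also have "(LINT y|lborel. wave (B *v y) (T *v \<xi>) * G (B *v y)) = c *\<^sub>R (LINT y|lborel. wave y (T *v \<xi>) * G y)"
      by (rule c_eq) measurable
    also have "cnj ((1 / c) *\<^sub>R (c *\<^sub>R (LINT y|lborel. wave y (T *v \<xi>) * G y))) = cnj (wave z (T *v \<xi>))"
      using c by (simp add: G_ft[OF \<xi>])
    also have "\<dots> = wave x (- \<xi>)" by (simp add: z_def wT wave_minus)
    finally show "(LINT y|lborel. H y * wave y (- \<xi>)) = wave x (- \<xi>)" .
  qed
  moreover have "(LINT y|lborel. H y * cnj (f y)) = cnj (LINT y|lborel. g y * G y)"
  proof -
    have [measurable]: "g \<in> borel_measurable borel" by (rule g)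
    have "(LINT y|lborel. H y * cnj (f y)) = (LINT y|lborel. (1 / c) *\<^sub>R cnj (g (B *v y) * G (B *v y)))"
      by (simp add: H_def g_def Binv mult.commute)
    also have "\<dots> = cnj ((1 / c) *\<^sub>R (LINT y|lborel. g (B *v y) * G (B *v y)))"
      by (simp only: complex_cnj_scaleR integral_scaleR_right Bochner_Integration.integral_cnj)
    also have "(LINT y|lborel. g (B *v y) * G (B *v y)) = c *\<^sub>R (LINT y|lborel. g y * G y)"
      by (rule c_eq) measurable
    finally show ?thesis using c by simp
  qed
  ultimately have fx: "(LINT y|lborel. g y * G y) = f x" by (simp add: complex_cnj_cancel_iff)
  \<comment> \<open>Absolute convergence along the enumeration is what turns \<open>sums\<close>
    into the unconditional \<open>has_sum\<close>.\<close>
  have "((\<lambda>n. \<phi> (z + e n) * (LINT y|lborel. g y * N (- e n - y))) has_sum f x) UNIV"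
    using lattice_series(1)[OF assms(8) e N(2,1) g, of z] lattice_series(3)[OF assms(8) e N(2,1) g, of z]
    unfolding G_def[symmetric] fx by (intro norm_summable_imp_has_sum)
  then have "((\<lambda>n. convolution g N (- e n) * \<phi> (z - (- e n))) has_sum f x) UNIV"
    by (simp add: conv mult.commute)
  moreover have "bij_betw (\<lambda>n. - e n) UNIV int_lattice"
  proof -
    have "bij_betw uminus (int_lattice :: (real^'d) set) int_lattice"
      by (rule bij_betwI[where g=uminus]) (auto intro: int_lattice_minus)
    from bij_betw_trans[OF e this] show ?thesis by (simp add: o_def)
  qed
  ultimately have "((\<lambda>k. convolution g N k * \<phi> (z - k)) has_sum f x) int_lattice"
    using has_sum_reindex_bij_betw[where g="\<lambda>n. - e n" and f="\<lambda>k. convolution g N k * \<phi> (z - k)"] by blast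
  then show "((\<lambda>k. convolution (\<lambda>y. f (matrix_inv (mat_pow M j) *v y))
                      (smoothed_reflection \<eta> (mat 1) \<psi>) k
                   * \<phi> (mat_pow M j *v x - k)) has_sum f x) int_lattice"
    by (simp add: g_def[abs_def] N_def z_def B_def)
qed

end
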